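(* Let $n\ge1$, let $q$ be a prime power, let $\psi$ be a nontrivial additive character of $\mathbb F_q$, and define $$\kappa_n=\left(4n\left\lfloor n-\tfrac12\left\lfloor\tfrac{n-1}{2}\right\rfloor\right\rfloor\right)^{-1}.$$ Let $A\in\operatorname{GL}(n,q)$ be diagonalisable, with multiplicative order $\tau$, and let $t$ be the multiplicative order of $\det A$. Let $\mathbf a,\mathbf b\in\mathbb F_q^n$ ($\mathbf a$ a row vector, $\mathbf b$ a column vector) be such that the $n$ vectors $\mathbf aA^i$, $i=0,\ldots,n-1$, are linearly independent over $\mathbb F_q$ and the $n$ vectors $A^i\mathbf b$, $i=0,\ldots,n-1$, are linearly independent over $\mathbb F_q$. Set $$S_{n,q}(\mathbf a,\mathbf b;A)=\sum_{x=1}^{\tau}\psi\left(\mathbf aA^x\mathbf b\right).$$ Then $$S_{n,q}(\mathbf a,\mathbf b;A)\ll\begin{cases} t^{1/4}\tau^{1/2-\kappa_n}q^{n/4}, & \text{if } \tau>q^{n/2},\\ t^{1/4}\tau^{3/4-\kappa_n}q^{n/8}, & \text{if } \tau\le q^{n/2},\end{cases}$$ where the implied constants depend only on $n$.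
   Context: $\operatorname{GL}(n,q)$ is the group of invertible $n\times n$ matrices over $\mathbb F_q$; diagonalisable means diagonalisable over the algebraic closure $\overline{\mathbb F}_q$. The multiplicative order of $A$ is the least $\tau\ge1$ with $A^\tau=I$. $U\ll V$ means $|U|\le cV$ for some constant $c>0$. *)

theory Defs
  imports
    Complex_Main
    "HOL-Algebra.Algebraic_Closure"
    "HOL-Combinatorics.Permutations"
    "Jordan_Normal_Form.Matrix"
begin

text \<open>
  The implied constant must not depend on the finite field, so fields have to be quantified
  over inside the formula and cannot be types of class \<open>field\<close>. They are therefore records
  of HOL-Algebra. Over an infinite carrier type such as \<open>nat\<close>, every finite field occurs up to
  isomorphism. The types \<open>'a mat\<close> and \<open>'a vec\<close> serve only as containers of entries;
  their type-class based arithmetic is not used.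
\<close>

definition mat_monoid :: "('a, 'm) ring_scheme \<Rightarrow> nat \<Rightarrow> 'a mat monoid" where
  "mat_monoid R n =
    \<lparr>carrier = {A \<in> carrier_mat n n. elements_mat A \<subseteq> carrier R},
     monoid.mult = (\<lambda>A B. mat n n (\<lambda>(i, j). \<Oplus>\<^bsub>R\<^esub>k\<in>{..<n}. A $$ (i, k) \<otimes>\<^bsub>R\<^esub> B $$ (k, j))),
     one = mat n n (\<lambda>(i, j). if i = j then \<one>\<^bsub>R\<^esub> else \<zero>\<^bsub>R\<^esub>)\<rparr>"

definition GL :: "('a, 'm) ring_scheme \<Rightarrow> nat \<Rightarrow> 'a mat monoid" where
  "GL R n = units_of (mat_monoid R n)"

definition mult_order :: "('a, 'm) monoid_scheme \<Rightarrow> 'a \<Rightarrow> nat" where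
  "mult_order G x = (LEAST k::nat. 1 \<le> k \<and> x [^]\<^bsub>G\<^esub> k = \<one>\<^bsub>G\<^esub>)"

definition determinant :: "('a, 'm) ring_scheme \<Rightarrow> nat \<Rightarrow> 'a mat \<Rightarrow> 'a" where
  "determinant R n A =
    (\<Oplus>\<^bsub>R\<^esub>p\<in>{p. p permutes {..<n}}.
      (if evenperm p then \<one>\<^bsub>R\<^esub> else \<ominus>\<^bsub>R\<^esub> \<one>\<^bsub>R\<^esub>) \<otimes>\<^bsub>R\<^esub> (\<Otimes>\<^bsub>R\<^esub>i\<in>{..<n}. A $$ (i, p i)))"

definition diagonalisable :: "('a, 'm) ring_scheme \<Rightarrow> nat \<Rightarrow> 'a mat \<Rightarrow> bool" where
  "diagonalisable K n A \<longleftrightarrow>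
    (\<exists>P\<in>carrier (GL K n). \<exists>D\<in>carrier (mat_monoid K n).
      (\<forall>i<n. \<forall>j<n. i \<noteq> j \<longrightarrow> D $$ (i, j) = \<zero>\<^bsub>K\<^esub>) \<and>
      A = P \<otimes>\<^bsub>mat_monoid K n\<^esub> D \<otimes>\<^bsub>mat_monoid K n\<^esub> inv\<^bsub>mat_monoid K n\<^esub> P)"

text \<open>
  \<open>ring.indexed_const R\<close> is the embedding of \<open>R\<close> into its algebraic closure
  \<open>field.alg_closure R\<close> (see the library fact \<open>field.alg_closureE\<close>).
\<close>

definition diagonalisable_over_closure :: "('a, 'm) ring_scheme \<Rightarrow> nat \<Rightarrow> 'a mat \<Rightarrow> bool" where
  "diagonalisable_over_closure R n A \<longleftrightarrow>
    diagonalisable (field.alg_closure R) n (map_mat (ring.indexed_const R) A)"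

definition vecs :: "('a, 'm) ring_scheme \<Rightarrow> nat \<Rightarrow> 'a vec set" where
  "vecs R n = {v \<in> carrier_vec n. set\<^sub>v v \<subseteq> carrier R}"

definition row_mult_mat :: "('a, 'm) ring_scheme \<Rightarrow> nat \<Rightarrow> 'a vec \<Rightarrow> 'a mat \<Rightarrow> 'a vec" where
  "row_mult_mat R n a A = vec n (\<lambda>j. \<Oplus>\<^bsub>R\<^esub>i\<in>{..<n}. a $ i \<otimes>\<^bsub>R\<^esub> A $$ (i, j))"

definition mat_mult_col :: "('a, 'm) ring_scheme \<Rightarrow> nat \<Rightarrow> 'a mat \<Rightarrow> 'a vec \<Rightarrow> 'a vec" where
  "mat_mult_col R n A b = vec n (\<lambda>i. \<Oplus>\<^bsub>R\<^esub>j\<in>{..<n}. A $$ (i, j) \<otimes>\<^bsub>R\<^esub> b $ j)"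

definition row_mult_col :: "('a, 'm) ring_scheme \<Rightarrow> nat \<Rightarrow> 'a vec \<Rightarrow> 'a vec \<Rightarrow> 'a" where
  "row_mult_col R n a b = (\<Oplus>\<^bsub>R\<^esub>i\<in>{..<n}. a $ i \<otimes>\<^bsub>R\<^esub> b $ i)"

text \<open>
  Linear independence of the family \<open>v 0, \<dots>, v (m - 1)\<close> of vectors of dimension \<open>n\<close>;
  in particular, these vectors are distinct.
\<close>

definition lin_indep_family :: "('a, 'm) ring_scheme \<Rightarrow> nat \<Rightarrow> nat \<Rightarrow> (nat \<Rightarrow> 'a vec) \<Rightarrow> bool" where
  "lin_indep_family R n m v \<longleftrightarrow>
    (\<forall>c\<in>{..<m} \<rightarrow> carrier R.
      (\<forall>j<n. (\<Oplus>\<^bsub>R\<^esub>i\<in>{..<m}. c i \<otimes>\<^bsub>R\<^esub> v i $ j) = \<zero>\<^bsub>R\<^esub>) \<longrightarrow> (\<forall>i<m. c i = \<zero>\<^bsub>R\<^esub>))"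

definition additive_character :: "('a, 'm) ring_scheme \<Rightarrow> ('a \<Rightarrow> complex) \<Rightarrow> bool" where
  "additive_character R \<psi> \<longleftrightarrow>
    \<psi> \<in> hom (add_monoid R) \<lparr>carrier = UNIV - {0}, monoid.mult = times, one = 1\<rparr>"

definition nontrivial_additive_character ::
    "('a, 'm) ring_scheme \<Rightarrow> ('a \<Rightarrow> complex) \<Rightarrow> bool" where
  "nontrivial_additive_character R \<psi> \<longleftrightarrow>
    additive_character R \<psi> \<and> (\<exists>x\<in>carrier R. \<psi> x \<noteq> 1)"

definition matrix_exp_sum ::
    "('a, 'm) ring_scheme \<Rightarrow> nat \<Rightarrow> ('a \<Rightarrow> complex) \<Rightarrow> 'a vec \<Rightarrow> 'a vec \<Rightarrow> 'a mat \<Rightarrow> complex" where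
  "matrix_exp_sum R n \<psi> a b A =
    (\<Sum>x = 1..mult_order (GL R n) A.
      \<psi> (row_mult_col R n (row_mult_mat R n a (A [^]\<^bsub>GL R n\<^esub> x)) b))"

definition kappa :: "nat \<Rightarrow> real" where
  "kappa n =
    inverse (4 * real n *
      real_of_int \<lfloor>real n - 1 / 2 * real_of_int \<lfloor>(real n - 1) / 2\<rfloor>\<rfloor>)"

end

theory Submission
  imports Defs "HOL-Number_Theory.Cong" "HOL-Analysis.Convex"
begin

text \<open>
  Let \<open>E\<close> be the number of solutions of \<open>A^x1 + A^x2 = A^x3 + A^x4\<close> modulo \<open>\<tau>\<close>.
  Orthogonality of characters and the Cauchy--Schwarz inequality give
  \<open>\<tau> |S|^4 \<le> q^n E\<close> and \<open>|S|^8 \<le> q^n E^2\<close>; that \<open>a\<close> and \<open>b\<close> are cyclic vectors is used to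
  turn relations between the vectors \<open>a A^x\<close> or \<open>A^x b\<close> into relations between the matrices \<open>A^x\<close>.
  So it suffices to bound \<open>E\<close> by a constant times \<open>t \<tau>^(3 - 4 \<kappa>)\<close>.

  On the eigenvalues \<open>l i\<close> of \<open>A\<close> the relation reads \<open>l i ^ x1 + l i ^ x2 - l i ^ x3 = l i ^ x4\<close>, and the
  product over all \<open>i\<close> of the right-hand sides is a power of \<open>det A\<close>, hence one of at most \<open>t\<close>
  values. For fixed \<open>x1\<close> and \<open>x2\<close>, the product of the left-hand sides, restricted to a
  progression of values of \<open>x3\<close> whose step is chosen by Dirichlet's theorem on simultaneous
  approximation, is a nonconstant Laurent polynomial of small degree in a root of unity. Counting
  its zeros saves a factor \<open>\<tau>^(1 / (2 n))\<close> over the trivial bound, and \<open>4 \<kappa> \<le> 1 / (2 n)\<close> for \<open>n \<ge> 2\<close>.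
  For \<open>n = 1\<close> the trivial bound \<open>E \<le> \<tau>^3\<close> suffices, since then \<open>t = \<tau>\<close>.
\<close>

section \<open>Roots of unity and polynomials over fields\<close>

text \<open>The factor q^n enters by completion. The values \<open>\<psi> (a A^x b)\<close> have
  period \<tau>, so the sum of \<open>\<psi> (a A^y v)\<close> over \<open>y\<close> equals S for
  each of the \<tau> distinct vectors v = A^x b. Extending v to all of F_q^n turns the fourth moment
  into q^n times a count of relations. For the eighth power, v runs over the differences A^x1 b -
  A^x2 b, whose total for fixed \<open>y\<close> is |S|^2; coincidences among these differences are
  again relations of the same shape, hence the square of E. After inserting the bound for E, the two
  estimates agree at \<tau> = q^(n/2), and the case distinction selects the smaller one. The
  obstacle in bounding E: a Laurent polynomial in a root of unity is useful only if its degree is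
  small and its coefficients do not vanish. A small degree asks for a long search range of steps,
  nonvanishing coefficients ask for steps divisible by the small orders, and the product of both
  must stay below \<tau>, because a step divisible by \<tau> makes the polynomial constant. Sharing
  \<tau> evenly between the two demands produces the exponent 1 / (2 n).\<close>

lemma (in field) finite_card_roots_le_degree:
  assumes "p \<in> carrier (poly_ring R)" "p \<noteq> []"
  shows "finite {x \<in> carrier R. eval p x = \<zero>}"
    and "card {x \<in> carrier R. eval p x = \<zero>} \<le> degree p"
proof -
  have *: "{x \<in> carrier R. eval p x = \<zero>} = set_mset (roots p)"
    using roots_mem_iff_is_root[OF assms(1)] assms(2) by (auto simp: is_root_def)
  show "finite {x \<in> carrier R. eval p x = \<zero>}" unfolding * by simp
  have "card (set_mset (roots p)) \<le> size (roots p)"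
    unfolding size_multiset_overloaded_eq
    by (metis card_eq_sum count_greater_eq_one_iff sum_mono)
  then show "card {x \<in> carrier R. eval p x = \<zero>} \<le> degree p"
    using size_roots_le_degree[OF assms(1)] * by simp
qed

lemma (in domain) binomial_polynomial:
  fixes d :: nat
  assumes "a \<in> carrier R" "b \<in> carrier R" "b \<noteq> \<zero>" "0 < d"
  obtains p where "p \<in> carrier (poly_ring R)" "p \<noteq> []" "degree p = d"
    "\<And>x. x \<in> carrier R \<Longrightarrow> eval p x = a \<oplus> b \<otimes> x [^] d"
proof -
  \<comment> \<open>Polynomials are coefficient lists without leading zeros, so the zero constant
    has to be the empty list.\<close>
  let ?c = "if a = \<zero> then [] else [a]"
  let ?p = "poly_add (monom b d) ?c"
  have m: "polynomial (carrier R) (monom b d)" 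
    using assms by (intro monom_is_polynomial[OF carrier_is_subring]) auto
  have c: "polynomial (carrier R) ?c"
    using assms by (auto simp: polynomial_def)
  have dm: "degree (monom b d) = d" by (simp add: monom_def)
  have deg: "degree ?p = d"
    by (subst poly_add_degree_eq[OF carrier_is_subring m c]) (use dm assms(4) in auto)
  show ?thesis
  proof (rule that[of ?p])
    show "?p \<in> carrier (poly_ring R)"
      using poly_add_is_polynomial[OF carrier_is_subring polynomial_incl[OF m] polynomial_incl[OF c]]
      by (simp add: univ_poly_carrier)
    show "?p \<noteq> []" using deg assms(4) by (metis list.size(3) diff_is_0_eq' less_irrefl zero_le_one)
    show "degree ?p = d" by (rule deg)
    show "eval ?p x = a \<oplus> b \<otimes> x [^] d" if "x \<in> carrier R" for x
      using assms that m c
      by (subst eval_poly_add[OF polynomial_incl polynomial_incl]) (auto simp: eval_monom a_comm)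
  qed
qed

lemma (in field) card_nth_roots_le:
  fixes d :: nat
  assumes "0 < d" "c \<in> carrier R"
  shows "finite {x \<in> carrier R. x [^] d = c}" "card {x \<in> carrier R. x [^] d = c} \<le> d"
proof -
  obtain p where p: "p \<in> carrier (poly_ring R)" "p \<noteq> []" "degree p = d"
    "\<And>x. x \<in> carrier R \<Longrightarrow> eval p x = \<ominus> c \<oplus> \<one> \<otimes> x [^] d"
    using binomial_polynomial[of "\<ominus> c" \<one> d] assms by auto
  have "{x \<in> carrier R. x [^] d = c} = {x \<in> carrier R. eval p x = \<zero>}"
    using p(4) assms(2) by (auto simp: l_neg) (metis a_comm minus_equality minus_minus add.inv_closed nat_pow_closed)
  then show "finite {x \<in> carrier R. x [^] d = c}" "card {x \<in> carrier R. x [^] d = c} \<le> d"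
    using finite_card_roots_le_degree[OF p(1,2)] p(3) by auto
qed

section \<open>Orders of elements in abelian groups and roots of unity\<close>

lemma (in comm_group) ord_mult_coprime:
  assumes x: "x \<in> carrier G" and y: "y \<in> carrier G" and cop: "coprime (ord x) (ord y)"
  shows "ord (x \<otimes> y) = ord x * ord y"
proof (rule dvd_antisym)
  show "ord (x \<otimes> y) dvd ord x * ord y" using x y by (rule abelian_ord_mul_divides)
  \<comment> \<open>The exponent \<open>?n * ord w\<close> kills both the product and
    \<open>w\<close>, hence also \<open>u\<close>; coprimality then removes
    \<open>ord w\<close>.\<close>
  have *: "ord u dvd ord (u \<otimes> w)"
    if u: "u \<in> carrier G" and w: "w \<in> carrier G" and c: "coprime (ord u) (ord w)" for u w
  proof -
    let ?n = "ord (u \<otimes> w)"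
    have "(u \<otimes> w) [^] (?n * ord w) = \<one>" using u w by (simp add: pow_eq_id)
    then have "u [^] (?n * ord w) \<otimes> w [^] (?n * ord w) = \<one>" 
      using u w by (simp add: nat_pow_distrib)
    moreover have "w [^] (?n * ord w) = \<one>" using w by (simp add: pow_eq_id)
    ultimately have "ord u dvd ?n * ord w" using u by (simp add: pow_eq_id)
    then show ?thesis using c by (simp add: coprime_dvd_mult_left_iff)
  qed
  show "ord x * ord y dvd ord (x \<otimes> y)"
    using *[OF x y cop] *[OF y x] cop x y by (simp add: divides_mult m_comm coprime_commute)
qed

text \<open>A prime power dividing the order of some element but not the order of \<open>g\<close> could be used
  to increase the order of \<open>g\<close>.\<close>
lemma (in comm_group) ord_dvd_max_ord:
  assumes g: "g \<in> carrier G" and y: "y \<in> carrier G"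
    and pos: "0 < ord g" "0 < ord y" and max: "\<And>z. z \<in> carrier G \<Longrightarrow> ord z \<le> ord g"
  shows "ord y dvd ord g"
proof (rule multiplicity_le_imp_dvd[where ?'a = nat])
  show "ord y \<noteq> 0" using pos by simp
  fix p :: nat
  assume p: "prime p"
  define j k where "j = multiplicity p (ord g)" and "k = multiplicity p (ord y)"
  obtain m where m: "ord g = p ^ j * m" "\<not> p dvd m"
    using pos p unfolding j_def by (metis multiplicity_decompose' not_prime_unit neq0_conv)
  have "p ^ k dvd ord y" unfolding k_def by (rule multiplicity_dvd)
  then obtain b where b: "ord y = b * p ^ k" by (metis dvd_def mult.commute)
  \<comment> \<open>The \<open>p\<close>-part of \<open>g\<close> is exchanged for that of
    \<open>y\<close>: the product below has order \<open>m * p ^ k\<close>, which maximality limits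
    to \<open>p ^ j * m\<close>.\<close>
  have "ord (g [^] (p ^ j)) = m"
    using ord_pow[OF g, of "p ^ j"] m(1) p by (simp add: prime_gt_0_nat)
  moreover have "ord (y [^] b) = p ^ k"
    using ord_pow[OF y, of b] b pos by (cases "b = 0") auto
  moreover have "coprime m (p ^ k)"
    using p m(2) by (metis coprime_commute coprime_power_right_iff prime_imp_coprime)
  ultimately have "ord (g [^] (p ^ j) \<otimes> y [^] b) = m * p ^ k"
    using g y by (subst ord_mult_coprime) auto
  then have "m * p ^ k \<le> p ^ j * m" using max[of "g [^] (p ^ j) \<otimes> y [^] b"] g y m(1) by simp
  then have "p ^ k \<le> p ^ j" using pos m(1) by (simp add: mult.commute)
  then show "multiplicity p (ord y) \<le> multiplicity p (ord g)"
    using p unfolding j_def k_def by (metis power_le_imp_le_exp prime_gt_1_nat)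
qed

lemma (in comm_group) obtain_max_ord:
  assumes fin: "finite (carrier G)"
  obtains g where "g \<in> carrier G" "\<And>x. x \<in> carrier G \<Longrightarrow> ord x dvd ord g"
proof -
  have "Max (ord ` carrier G) \<in> ord ` carrier G" by (rule Max_in) (use fin in auto)
  then obtain g where g: "g \<in> carrier G" "Max (ord ` carrier G) = ord g" by blast
  have "ord x \<le> ord g" if "x \<in> carrier G" for x
    using that fin g(2) by (metis Max_ge finite_imageI imageI)
  then show ?thesis
    using that g(1) ord_dvd_max_ord[OF g(1)] ord_ge_1[OF fin] by (metis less_eq_Suc_le One_nat_def)
qed

text \<open>The \<tau>-th roots of unity form a finite abelian group \<open>H\<close>. If
  \<open>m\<close> is its largest order, all of \<open>H\<close> are roots of X^m - 1, so
  \<open>H\<close> has at most \<open>m\<close> elements and is cyclic. Since \<open>m\<close> kills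
  every \<open>l i\<close>, \<open>exact\<close> gives \<open>m = \<tau>\<close>. With all
  \<open>l i\<close> written as powers of one \<open>g\<close>, conditions on their powers become
  congruences modulo \<tau> for the exponents \<open>e i\<close>.\<close>

lemma (in field) obtain_primitive_root:
  fixes l :: "nat \<Rightarrow> 'a" and \<tau> n :: nat
  assumes \<tau>: "0 < \<tau>" and l: "\<And>i. i < n \<Longrightarrow> l i \<in> carrier R"
    and ltau: "\<And>i. i < n \<Longrightarrow> l i [^] \<tau> = \<one>"
    and exact: "\<And>x. (\<And>i. i < n \<Longrightarrow> l i [^] (x::nat) = \<one>) \<Longrightarrow> \<tau> dvd x"
  obtains g e where "g \<in> carrier R" "\<And>k::nat. g [^] k = \<one> \<longleftrightarrow> \<tau> dvd k"
    "\<And>i. i < n \<Longrightarrow> l i = g [^] (e i :: nat)"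
proof -
  define H where "H = {x \<in> carrier R. x [^] \<tau> = \<one>}"
  define G where "G = \<lparr>carrier = H, monoid.mult = (\<otimes>), one = \<one>\<rparr>"
  have Hcar: "x \<in> carrier R" and Hpow: "x [^] \<tau> = \<one>" if "x \<in> H" for x
    using that by (auto simp: H_def)
  have finH: "finite H" using card_nth_roots_le[OF \<tau>, of \<one>] by (simp add: H_def)
  have G_simps: "carrier G = H" "monoid.mult G = (\<otimes>)" "\<one>\<^bsub>G\<^esub> = \<one>" by (simp_all add: G_def)
  have pw: "x [^]\<^bsub>G\<^esub> k = x [^] k" for x and k :: nat
    by (simp add: nat_pow_def G_simps)
  have "comm_group G"
  proof (rule comm_groupI, unfold G_simps)
    fix x assume x: "x \<in> H"
    have inv: "x [^] (\<tau> - 1) \<otimes> x = \<one>" using Hcar[OF x] Hpow[OF x] \<tau> by (simp flip: nat_pow_Suc)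
    have "(x [^] (\<tau> - 1)) [^] \<tau> = (x [^] \<tau>) [^] (\<tau> - 1)"
      using Hcar[OF x] by (metis mult.commute nat_pow_pow)
    then have "(x [^] (\<tau> - 1)) [^] \<tau> = \<one>" by (simp only: nat_pow_one Hpow[OF x])
    then have "x [^] (\<tau> - 1) \<in> H" using Hcar[OF x] by (simp add: H_def)
    then show "\<exists>y\<in>H. y \<otimes> x = \<one>" using inv by blast
  qed (auto simp: H_def nat_pow_distrib m_assoc intro: m_comm)
  then interpret G: comm_group G .
  obtain g where g: "g \<in> H" and max: "\<And>z. z \<in> H \<Longrightarrow> G.ord z dvd G.ord g"
    using G.obtain_max_ord finH unfolding G_simps by blast
  define m where "m = G.ord g"
  have m: "0 < m" using G.ord_ge_1[of g] finH g unfolding m_def G_simps by simp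
  have gm: "g [^] k = \<one> \<longleftrightarrow> m dvd k" for k :: nat
    using G.pow_eq_id[of g k] g unfolding m_def G_simps pw by simp
  have gH: "x [^] m = \<one>" if "x \<in> H" for x
    using G.pow_eq_id[of x m] max[OF that] that unfolding m_def G_simps pw by simp
  have gk: "g [^] k \<in> H" for k :: nat
    using G.nat_pow_closed[of g k] g unfolding G_simps pw by simp
  have "card H \<le> card {x \<in> carrier R. x [^] m = \<one>}"
    by (rule card_mono) (use card_nth_roots_le[OF m, of \<one>] gH Hcar in auto)
  also have "\<dots> \<le> m" using card_nth_roots_le[OF m, of \<one>] by simp
  also have "m = card ((\<lambda>k. g [^] k) ` {0..m - 1})"
    using g G.ord_inj[of g] m unfolding G_simps pw m_def by (simp add: card_image)
  finally have H: "(\<lambda>k. g [^] k) ` {0..m - 1} = H"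
    using gk by (intro card_seteq[OF finH]) auto
  have "\<exists>e. \<forall>i<n. l i = g [^] (e i :: nat)"
  proof -
    have "\<exists>k::nat. l i = g [^] k" if "i < n" for i
    proof -
      have "l i \<in> H" using l ltau that by (simp add: H_def)
      then show ?thesis unfolding H[symmetric] by auto
    qed
    then show ?thesis by metis
  qed
  moreover have "m = \<tau>"
  proof (rule dvd_antisym)
    show "m dvd \<tau>" using gm Hpow[OF g] by simp
    show "\<tau> dvd m" by (rule exact) (use l ltau gH in \<open>auto simp: H_def\<close>)
  qed
  ultimately show ?thesis using that Hcar[OF g] gm by metis
qed

text \<open>\<open>u i\<close> stands for z^(f i), negative exponents being encoded by an equation
  instead of an inverse. Multiplication by z^n, where n is the total of the negative exponents,
  makes the product a polynomial p of degree D, the sum of all |f i|. Then \<open>Z\<close> consists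
  of roots of p - v X^n, which has degree at most D.\<close>

lemma (in field) laurent_product_card_le:
  fixes f :: "'i \<Rightarrow> int" and \<alpha> \<beta> :: "'i \<Rightarrow> 'a"
  assumes I: "finite I" "I \<noteq> {}"
    and \<alpha>: "\<And>i. i \<in> I \<Longrightarrow> \<alpha> i \<in> carrier R - {\<zero>}" and \<beta>: "\<And>i. i \<in> I \<Longrightarrow> \<beta> i \<in> carrier R - {\<zero>}"
    and f: "\<And>i. i \<in> I \<Longrightarrow> f i \<noteq> 0" and v: "v \<in> carrier R - {\<zero>}"
    and Z: "Z \<subseteq> carrier R"
      "\<And>z. z \<in> Z \<Longrightarrow> \<exists>u. (\<forall>i\<in>I. u i \<in> carrier R \<and> (0 < f i \<longrightarrow> u i = z [^] nat (f i)) \<and>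
          (f i < 0 \<longrightarrow> u i \<otimes> z [^] nat (- f i) = \<one>)) \<and> (\<Otimes>i\<in>I. \<alpha> i \<ominus> \<beta> i \<otimes> u i) = v"
  shows "finite Z" "card Z \<le> (\<Sum>i\<in>I. nat \<bar>f i\<bar>)"
proof -
  define N where "N i = nat (- f i)" for i
  \<comment> \<open>The clause on \<open>eval p \<zero>\<close> is carried through the induction
    because the degree alone does not show p - v X^n to be nonzero when n = D.\<close>
  have prod: "\<exists>p. p \<in> carrier (poly_ring R) \<and> p \<noteq> [] \<and> degree p = (\<Sum>i\<in>J. nat \<bar>f i\<bar>) \<and> eval p \<zero> \<noteq> \<zero> \<and>
      (\<forall>z\<in>carrier R. \<forall>u. (\<forall>i\<in>J. u i \<in> carrier R \<and> (0 < f i \<longrightarrow> u i = z [^] nat (f i)) \<and>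
          (f i < 0 \<longrightarrow> u i \<otimes> z [^] nat (- f i) = \<one>)) \<longrightarrow>
        eval p z = (\<Otimes>i\<in>J. \<alpha> i \<ominus> \<beta> i \<otimes> u i) \<otimes> z [^] (\<Sum>i\<in>J. N i))"
    if "J \<subseteq> I" for J
    using finite_subset[OF that I(1)] that
  proof (induction J rule: finite_induct)
    case empty
    show ?case by (rule exI[of _ "[\<one>]"]) (auto simp: univ_poly_carrier[symmetric] polynomial_def)
  next
    case (insert j J)
    from insert.prems have "J \<subseteq> I" by simp
    from insert.IH[OF this] obtain p where p: "p \<in> carrier (poly_ring R)" "p \<noteq> []"
        "degree p = (\<Sum>i\<in>J. nat \<bar>f i\<bar>)" "eval p \<zero> \<noteq> \<zero>"
      and pz: "\<forall>z\<in>carrier R. \<forall>u. (\<forall>i\<in>J. u i \<in> carrier R \<and> (0 < f i \<longrightarrow> u i = z [^] nat (f i)) \<and>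
          (f i < 0 \<longrightarrow> u i \<otimes> z [^] nat (- f i) = \<one>)) \<longrightarrow>
        eval p z = (\<Otimes>i\<in>J. \<alpha> i \<ominus> \<beta> i \<otimes> u i) \<otimes> z [^] (\<Sum>i\<in>J. N i)"
      by (elim exE conjE)
    have jI: "j \<in> I" using insert by simp
    note aj = \<alpha>[OF jI] and bj = \<beta>[OF jI] and fj = f[OF jI]
    obtain q where q: "q \<in> carrier (poly_ring R)" "q \<noteq> []" "degree q = nat \<bar>f j\<bar>" "eval q \<zero> \<noteq> \<zero>"
      and qz: "\<And>z w. z \<in> carrier R \<Longrightarrow> w \<in> carrier R \<and> (0 < f j \<longrightarrow> w = z [^] nat (f j)) \<and>
          (f j < 0 \<longrightarrow> w \<otimes> z [^] nat (- f j) = \<one>) \<Longrightarrow>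
        eval q z = (\<alpha> j \<ominus> \<beta> j \<otimes> w) \<otimes> z [^] N j"
    proof (cases "0 < f j")
      case True
      obtain q where "q \<in> carrier (poly_ring R)" "q \<noteq> []" "degree q = nat (f j)"
        "\<And>x. x \<in> carrier R \<Longrightarrow> eval q x = \<alpha> j \<oplus> (\<ominus> \<beta> j) \<otimes> x [^] nat (f j)"
        using binomial_polynomial[of "\<alpha> j" "\<ominus> \<beta> j" "nat (f j)"] aj bj True by auto
      then show ?thesis using that[of q] aj bj True
        by (auto simp: N_def nat_pow_zero minus_eq l_minus simp del: pow_nat)
    next
      case False
      \<comment> \<open>For a negative exponent the factor is multiplied by z^(- f j), so the
        constant and the leading coefficient exchange their roles.\<close>
      obtain q where q: "q \<in> carrier (poly_ring R)" "q \<noteq> []" "degree q = nat (- f j)"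
        "\<And>x. x \<in> carrier R \<Longrightarrow> eval q x = \<ominus> \<beta> j \<oplus> \<alpha> j \<otimes> x [^] nat (- f j)"
        using binomial_polynomial[of "\<ominus> \<beta> j" "\<alpha> j" "nat (- f j)"] aj bj fj False by auto
      have "eval q z = (\<alpha> j \<ominus> \<beta> j \<otimes> w) \<otimes> z [^] N j" 
        if z: "z \<in> carrier R" and w: "w \<in> carrier R" and wz: "w \<otimes> z [^] nat (- f j) = \<one>" for z w
      proof -
        have "(\<alpha> j \<ominus> \<beta> j \<otimes> w) \<otimes> z [^] N j = \<alpha> j \<otimes> z [^] N j \<ominus> \<beta> j \<otimes> (w \<otimes> z [^] N j)"
          using aj bj z w by (simp add: minus_eq l_distr l_minus m_assoc)
        then show ?thesis using q(4)[OF z] wz aj bj z by (simp add: N_def minus_eq a_comm)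
      qed
      then show ?thesis using that[of q] q aj bj fj False by (auto simp: nat_pow_zero simp del: pow_nat)
    qed
    let ?r = "q \<otimes>\<^bsub>poly_ring R\<^esub> p"
    have pq: "set p \<subseteq> carrier R" "set q \<subseteq> carrier R"
      using p(1) q(1) by (auto simp: univ_poly_carrier[symmetric] polynomial_def)
    have ev: "eval ?r z = eval q z \<otimes> eval p z" if "z \<in> carrier R" for z
      using eval_poly_mult[OF pq(2,1) that] by (simp add: univ_poly_mult)
    have deg: "degree ?r = degree q + degree p"
      using poly_mult_degree_eq[OF carrier_is_subring, of q p] p q by (simp add: univ_poly_mult univ_poly_carrier)
    interpret P: ring "poly_ring R" by (rule univ_poly_is_ring[OF carrier_is_subring])
    have e0: "eval ?r \<zero> \<noteq> \<zero>" using ev[of \<zero>] p(4) q(4) pq by (simp add: integral_iff eval_in_carrier)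
    show ?case
    proof (intro exI[of _ ?r] conjI ballI allI impI)
      show "?r \<in> carrier (poly_ring R)" using p q by simp
      show "?r \<noteq> []" using e0 by auto
      show "degree ?r = (\<Sum>i\<in>insert j J. nat \<bar>f i\<bar>)" using insert deg p q by simp
      show "eval ?r \<zero> \<noteq> \<zero>" by (rule e0)
      fix z u assume z: "z \<in> carrier R" and u: "\<forall>i\<in>insert j J. u i \<in> carrier R \<and>
        (0 < f i \<longrightarrow> u i = z [^] nat (f i)) \<and> (f i < 0 \<longrightarrow> u i \<otimes> z [^] nat (- f i) = \<one>)"
      have c: "(\<lambda>i. \<alpha> i \<ominus> \<beta> i \<otimes> u i) \<in> J \<rightarrow> carrier R" "\<alpha> j \<ominus> \<beta> j \<otimes> u j \<in> carrier R"
        using u insert.prems \<alpha> \<beta> by (auto simp: subset_iff)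
      have "eval ?r z = ((\<alpha> j \<ominus> \<beta> j \<otimes> u j) \<otimes> z [^] N j) \<otimes> 
          ((\<Otimes>i\<in>J. \<alpha> i \<ominus> \<beta> i \<otimes> u i) \<otimes> z [^] (\<Sum>i\<in>J. N i))"
        unfolding ev[OF z] using qz[OF z, of "u j"] spec[OF bspec[OF pz z], of u] u by (simp del: pow_nat)
      also have "\<dots> = (\<Otimes>i\<in>insert j J. \<alpha> i \<ominus> \<beta> i \<otimes> u i) \<otimes> z [^] (\<Sum>i\<in>insert j J. N i)"
        using insert c z by (simp add: m_ac finprod_closed flip: nat_pow_mult)
      finally show "eval ?r z = (\<Otimes>i\<in>insert j J. \<alpha> i \<ominus> \<beta> i \<otimes> u i) \<otimes> z [^] (\<Sum>i\<in>insert j J. N i)" .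
    qed
  qed
  define D where "D = (\<Sum>i\<in>I. nat \<bar>f i\<bar>)"
  define n where "n = (\<Sum>i\<in>I. N i)"
  obtain p where p: "p \<in> carrier (poly_ring R)" "p \<noteq> []" "degree p = D" "eval p \<zero> \<noteq> \<zero>"
    and pz: "\<forall>z\<in>carrier R. \<forall>u. (\<forall>i\<in>I. u i \<in> carrier R \<and> (0 < f i \<longrightarrow> u i = z [^] nat (f i)) \<and>
          (f i < 0 \<longrightarrow> u i \<otimes> z [^] nat (- f i) = \<one>)) \<longrightarrow>
        eval p z = (\<Otimes>i\<in>I. \<alpha> i \<ominus> \<beta> i \<otimes> u i) \<otimes> z [^] n"
    using prod[OF subset_refl] unfolding D_def[symmetric] n_def[symmetric] by (elim exE conjE)
  have nD: "n \<le> D" unfolding n_def D_def N_def by (rule sum_mono) auto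
  obtain i where i: "i \<in> I" using I by blast
  have D0: "0 < D" unfolding D_def using i f[OF i] I by (intro sum_pos2[of _ i]) auto
  let ?m = "monom (\<ominus> v) n"
  let ?r = "poly_add p ?m"
  have pm: "polynomial (carrier R) p" "polynomial (carrier R) ?m" "degree ?m = n"
    using p v monom_is_polynomial[OF carrier_is_subring, of "\<ominus> v" n]
    by (auto simp: univ_poly_carrier monom_def)
  note pc = polynomial_incl[OF pm(1)] polynomial_incl[OF pm(2)]
  have rc: "?r \<in> carrier (poly_ring R)"
    using poly_add_is_polynomial[OF carrier_is_subring pc] by (simp add: univ_poly_carrier)
  have er: "eval ?r z = eval p z \<ominus> v \<otimes> z [^] n" if "z \<in> carrier R" for z
    using eval_poly_add[OF pc that] v that by (simp add: eval_monom minus_eq l_minus)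
  have dr: "degree ?r \<le> D" using poly_add_degree[of p ?m] p(3) pm(3) nD by simp
  \<comment> \<open>For n < D the leading term of \<open>p\<close> survives. For n = D, when all
    exponents are negative, it may cancel; but D > 0 makes v X^n vanish at zero, where
    \<open>p\<close> does not.\<close>
  have r: "?r \<noteq> []"
  proof (cases "n = D")
    case True
    have "eval ?r \<zero> \<noteq> \<zero>" using er[of \<zero>] p(4) True D0 v pc by (simp add: nat_pow_zero minus_eq eval_in_carrier)
    then show ?thesis by auto
  next
    case False
    have "degree ?r = max (degree p) (degree ?m)"
      by (rule poly_add_degree_eq[OF carrier_is_subring pm(1,2)]) (use False p(3) pm(3) in simp)
    then show ?thesis using D0 p(3) by auto
  qed
  have sub: "Z \<subseteq> {z \<in> carrier R. eval ?r z = \<zero>}"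
  proof
    fix z assume z: "z \<in> Z"
    then have "z \<in> carrier R" using Z(1) by auto
    moreover obtain u where u: "\<forall>i\<in>I. u i \<in> carrier R \<and> (0 < f i \<longrightarrow> u i = z [^] nat (f i)) \<and>
          (f i < 0 \<longrightarrow> u i \<otimes> z [^] nat (- f i) = \<one>)" "(\<Otimes>i\<in>I. \<alpha> i \<ominus> \<beta> i \<otimes> u i) = v"
      using Z(2)[OF z] by (elim exE conjE)
    moreover have "eval p z = v \<otimes> z [^] n"
      using mp[OF spec[OF bspec[OF pz \<open>z \<in> carrier R\<close>]] u(1)] unfolding u(2) .
    ultimately show "z \<in> {z \<in> carrier R. eval ?r z = \<zero>}" using er[of z] v by simp
  qed
  show "finite Z" using sub finite_card_roots_le_degree(1)[OF rc r] by (rule finite_subset)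
  have "card Z \<le> degree ?r"
    using card_mono[OF finite_card_roots_le_degree(1)[OF rc r] sub] finite_card_roots_le_degree(2)[OF rc r] by simp
  then show "card Z \<le> (\<Sum>i\<in>I. nat \<bar>f i\<bar>)" using dr unfolding D_def by simp
qed

section \<open>Periodic counts and simultaneous approximation\<close>

lemma sum_periodic_shift:
  fixes h :: "nat \<Rightarrow> 'b :: cancel_comm_monoid_add"
  assumes "\<And>x. h (x + \<tau>) = h x"
  shows "(\<Sum>x<\<tau>. h (x + s)) = (\<Sum>x<\<tau>. h x)"
proof (induction s)
  case (Suc s)
  have "(\<Sum>x<\<tau>. h (Suc x + s)) + h s = (\<Sum>x<\<tau>. h (x + s)) + h (\<tau> + s)"
    using sum.lessThan_Suc_shift[of "\<lambda>x. h (x + s)" \<tau>] by (simp add: add.commute)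
  moreover have "h (\<tau> + s) = h s" using assms[of s] by (simp add: add.commute)
  ultimately show ?case using Suc by simp
qed simp

text \<open>Double counting over a start \<open>x\<close> and an index \<open>k\<close>: for fixed
  \<open>k\<close> the shift by \<open>r * k\<close> preserves the count by periodicity, and for
  fixed \<open>x\<close> the progression contributes at most \<open>B\<close>. Averaging over all
  starts copes with progressions that revisit residues because \<open>r\<close> and \<tau> share a
  factor.\<close>

lemma card_periodic_le:
  fixes \<tau> r B :: nat
  assumes "0 < \<tau>" and per: "\<And>x. P (x + \<tau>) \<longleftrightarrow> P x"
    and B: "\<And>x. card {k \<in> {..<\<tau>}. P (x + r * k)} \<le> B"
  shows "card {x \<in> {..<\<tau>}. P x} \<le> B"
proof -
  have c: "card {x \<in> {..<\<tau>}. Q x} = (\<Sum>x<\<tau>. of_bool (Q x))" for Q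
    by (simp add: of_bool_def sum.If_cases Collect_conj_eq Int_commute lessThan_def)
  have shift: "(\<Sum>x<\<tau>. of_bool (P (x + s))) = (\<Sum>x<\<tau>. of_bool (P x) :: nat)" for s
    by (rule sum_periodic_shift) (simp add: per)
  have "\<tau> * card {x \<in> {..<\<tau>}. P x} = (\<Sum>k<\<tau>. \<Sum>x<\<tau>. of_bool (P (x + r * k)))"
    unfolding c shift by simp
  also have "\<dots> = (\<Sum>x<\<tau>. card {k \<in> {..<\<tau>}. P (x + r * k)})"
    unfolding c by (rule sum.swap)
  also have "\<dots> \<le> \<tau> * B" using sum_bounded_above[of "{..<\<tau>}" _ B] B by simp
  finally show ?thesis using assms(1) by simp
qed

text \<open>Dirichlet's pigeonhole argument with residues modulo \<tau> in place of fractional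
  parts: the multipliers 0, ..., M^n fall into M^n boxes, and the difference of two in one box is
  the step \<open>r\<close>. The \<open>f i\<close> are signed representatives of
  \<open>r * e i\<close>.\<close>

lemma simultaneous_small_residues:
  fixes e :: "nat \<Rightarrow> nat" and n M \<tau> :: nat
  assumes "0 < M" "0 < \<tau>"
  obtains r f where "1 \<le> r" "r \<le> M ^ n"
    "\<And>i. i < n \<Longrightarrow> \<bar>f i\<bar> * int M < int \<tau>" "\<And>i. i < n \<Longrightarrow> int \<tau> dvd int (r * e i) - f i"
proof -
  let ?b = "\<lambda>r. \<lambda>i\<in>{..<n}. (r * e i mod \<tau>) * M div \<tau>"
  have "?b ` {..M ^ n} \<subseteq> {..<n} \<rightarrow>\<^sub>E {..<M}"
  proof -
    have "(r * e i mod \<tau>) * M div \<tau> < M" for r i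
      using assms by (simp add: div_less_iff_less_mult mult.commute)
    then show ?thesis by (auto simp: PiE_iff extensional_def split: if_splits)
  qed
  then have "card (?b ` {..M ^ n}) \<le> card ({..<n} \<rightarrow>\<^sub>E {..<M})"
    by (intro card_mono finite_PiE) auto
  also have "\<dots> = M ^ n" by (simp add: card_PiE)
  finally have "\<not> inj_on ?b {..M ^ n}" using card_image[of ?b "{..M ^ n}"] by auto
  then obtain r s where rs: "r < s" "s \<le> M ^ n" "?b r = ?b s"
    unfolding inj_on_def by (metis atMost_iff linorder_neqE_nat)
  let ?f = "\<lambda>i. int (s * e i mod \<tau>) - int (r * e i mod \<tau>)"
  show ?thesis
  proof (rule that[of "s - r" ?f])
    show "1 \<le> s - r" "s - r \<le> M ^ n" using rs by auto
    fix i assume i: "i < n"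
    have eq: "(r * e i mod \<tau>) * M div \<tau> = (s * e i mod \<tau>) * M div \<tau>"
      using fun_cong[OF rs(3), of i] i by simp
    \<comment> \<open>Equal quotients by \<tau> mean lying in a common interval of length \<tau>.
      Applied to residues scaled by \<open>M\<close>, this bounds the product |f i| M
      directly.\<close>
    have *: "\<bar>int a - int b\<bar> < int \<tau>" if "a div \<tau> = b div \<tau>" for a b
    proof -
      have "int a - int b = int (a mod \<tau>) - int (b mod \<tau>)"
        using that div_mult_mod_eq[of a \<tau>] div_mult_mod_eq[of b \<tau>] by (metis add_diff_cancel_left of_nat_add)
      then show ?thesis using mod_less_divisor[OF assms(2), of a] mod_less_divisor[OF assms(2), of b] by linarith
    qed
    have "\<bar>?f i\<bar> * int M = \<bar>?f i * int M\<bar>" by (simp add: abs_mult)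
    also have "?f i * int M = int ((s * e i mod \<tau>) * M) - int ((r * e i mod \<tau>) * M)" by (simp add: left_diff_distrib)
    also have "\<bar>\<dots>\<bar> < int \<tau>" by (rule *) (rule eq[symmetric])
    finally show "\<bar>?f i\<bar> * int M < int \<tau>" .
    have se: "int ((s - r) * e i) = int (s * e i) - int (r * e i)" using rs by (simp add: of_nat_diff left_diff_distrib)
    have *: "int \<tau> dvd int a - int (a mod \<tau>)" for a
      by (simp add: of_nat_mod minus_mod_eq_mult_div)
    have "int (s * e i) - int (r * e i) - ?f i =
      (int (s * e i) - int (s * e i mod \<tau>)) - (int (r * e i) - int (r * e i mod \<tau>))" by linarith
    then have "int \<tau> dvd int (s * e i) - int (r * e i) - ?f i"
      by (simp only: dvd_diff[OF * *])
    then show "int \<tau> dvd int ((s - r) * e i) - ?f i" unfolding se .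
  qed
qed

text \<open>Members of one residue class modulo \<open>d\<close> are separated by their quotients by
  \<open>d\<close>, of which only \<open>\<tau> div d\<close> occur.\<close>

lemma card_residue_class_le:
  fixes d \<tau> :: nat
  assumes "0 < d" "d dvd \<tau>" "S \<subseteq> {..<\<tau>}" "\<And>x y. x \<in> S \<Longrightarrow> y \<in> S \<Longrightarrow> [x = y] (mod d)"
  shows "card S * d \<le> \<tau>"
proof -
  have "inj_on (\<lambda>x. x div d) S"
    by (rule inj_onI) (metis assms(4) cong_def div_mult_mod_eq)
  moreover have "(\<lambda>x. x div d) ` S \<subseteq> {..<\<tau> div d}"
    using assms by (auto simp: div_less_iff_less_mult)
  ultimately have "card S \<le> \<tau> div d" using card_inj_on_le[of "\<lambda>x. x div d" S "{..<\<tau> div d}"] by simp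
  then show ?thesis using assms(1,2) by (simp add: less_eq_div_iff_mult_less_eq)
qed

text \<open>Along the progression a factor with \<open>f i \<noteq> 0\<close> depends on
  \<open>k\<close> only through z = g^k, with l i ^ (r k) = z^(f i), because \<open>r * e i\<close>
  and \<open>f i\<close> agree modulo \<tau>. Factors with \<open>f i = 0\<close> are constant and
  are divided out. Distinct \<open>k\<close> below \<tau> give distinct z, so the count of zeros of
  a Laurent product applies.\<close>

lemma (in field) card_product_fibre_le:
  fixes l \<alpha> :: "nat \<Rightarrow> 'a" and \<tau> n r x N :: nat and f :: "nat \<Rightarrow> int" and e :: "nat \<Rightarrow> nat"
  assumes \<tau>: "0 < \<tau>" and g: "g \<in> carrier R" "\<And>k::nat. g [^] k = \<one> \<longleftrightarrow> \<tau> dvd k"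
    and l: "\<And>i. i < n \<Longrightarrow> l i = g [^] e i"
    and f: "\<And>i. i < n \<Longrightarrow> int \<tau> dvd int (r * e i) - f i"
    and I: "i0 < n" "f i0 \<noteq> 0"
    and \<alpha>: "\<And>i. i < n \<Longrightarrow> \<alpha> i \<in> carrier R" "\<And>i. i < n \<Longrightarrow> f i \<noteq> 0 \<Longrightarrow> \<alpha> i \<noteq> \<zero>"
    and v: "v \<in> carrier R" "v \<noteq> \<zero>"
  shows "card {k \<in> {..<\<tau>}. (\<Otimes>i\<in>{..<n}. \<alpha> i \<ominus> l i [^] (x + r * k)) = v} \<le> (\<Sum>i<n. nat \<bar>f i\<bar>)"
proof (cases "\<exists>k. (\<Otimes>i\<in>{..<n}. \<alpha> i \<ominus> l i [^] (x + r * k)) = v")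
  case ex: True
  let ?K = "{k \<in> {..<\<tau>}. (\<Otimes>i\<in>{..<n}. \<alpha> i \<ominus> l i [^] (x + r * k)) = v}"
  have gU: "g \<noteq> \<zero>" using g(2)[of \<tau>] \<tau> g(1) by (auto simp: nat_pow_zero)
  have gk: "g [^] k \<noteq> \<zero>" "g [^] k \<in> carrier R" for k :: nat
    using gU g(1) by (induction k) (auto simp: integral_iff)
  have gcong: "g [^] a = g [^] b" if "int \<tau> dvd int a - int b" for a b :: nat
  proof -
    have *: "g [^] (b + \<tau> * c) = g [^] b" for b c
      using g(1) g(2)[of "\<tau> * c"] by (simp flip: nat_pow_mult)
    have "[a = b] (mod \<tau>)" using that by (simp add: cong_iff_dvd_diff flip: cong_int_iff)
    then obtain c d where "b + c * \<tau> = a + d * \<tau>" unfolding cong_iff_lin_nat by blast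
    then have "b + \<tau> * c = a + \<tau> * d" by (simp only: mult.commute)
    then show ?thesis using *[of a d] *[of b c] by (simp only:)
  qed
  have lc: "l i \<in> carrier R" "l i [^] k \<noteq> \<zero>" "l i [^] k \<in> carrier R" if "i < n" for i and k :: nat
    using l[OF that] g(1) gk by (auto simp: nat_pow_pow)
  have lpow: "l i [^] (x + r * k) = l i [^] x \<otimes> (l i [^] r) [^] k" if "i < n" for i k
    using lc[OF that] by (simp add: nat_pow_mult nat_pow_pow)
  have lr: "l i [^] r = g [^] (r * e i)" if "i < n" for i
    using l[OF that] g(1) by (simp add: nat_pow_pow mult.commute)
  define I where "I = {i. i < n \<and> f i \<noteq> 0}"
  define J where "J = {i. i < n \<and> f i = 0}"
  have IJ: "{..<n} = I \<union> J" "I \<inter> J = {}" "finite I" "finite J" by (auto simp: I_def J_def)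
  have J: "l i [^] (x + r * k) = l i [^] x" if "i \<in> J" for i k
  proof -
    have "i < n" "f i = 0" using that by (auto simp: J_def)
    then have "l i [^] r = \<one>" using f[of i] lr g(2)[of "r * e i"] by (simp add: int_dvd_int_iff del: of_nat_mult)
    then show ?thesis using \<open>i < n\<close> lpow lc by simp
  qed
  have split: "(\<Otimes>i\<in>{..<n}. \<alpha> i \<ominus> l i [^] (x + r * k)) =
      (\<Otimes>i\<in>I. \<alpha> i \<ominus> l i [^] (x + r * k)) \<otimes> (\<Otimes>i\<in>J. \<alpha> i \<ominus> l i [^] x)" for k
  proof -
    have "(\<Otimes>i\<in>J. \<alpha> i \<ominus> l i [^] (x + r * k)) = (\<Otimes>i\<in>J. \<alpha> i \<ominus> l i [^] x)"
      using \<alpha>(1) lc J by (intro finprod_cong') (auto simp: J_def)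
    moreover have "(\<Otimes>i\<in>{..<n}. \<alpha> i \<ominus> l i [^] (x + r * k)) =
      (\<Otimes>i\<in>I. \<alpha> i \<ominus> l i [^] (x + r * k)) \<otimes> (\<Otimes>i\<in>J. \<alpha> i \<ominus> l i [^] (x + r * k))"
      unfolding IJ(1) using \<alpha>(1) lc IJ by (intro finprod_Un_disjoint) (auto simp: I_def J_def)
    ultimately show ?thesis by simp
  qed
  define c where "c = (\<Otimes>i\<in>J. \<alpha> i \<ominus> l i [^] x)"
  have pc: "(\<Otimes>i\<in>I. \<alpha> i \<ominus> l i [^] (x + r * k)) \<in> carrier R" for k
    using \<alpha>(1) lc by (intro finprod_closed) (auto simp: I_def)
  have c: "c \<in> carrier R" unfolding c_def using \<alpha>(1) lc by (intro finprod_closed) (auto simp: J_def)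
  \<comment> \<open>This is why values that are never attained were split off: an attained nonzero
    \<open>v\<close> has \<open>c\<close> as a factor.\<close>
  have c0: "c \<noteq> \<zero>"
  proof
    assume "c = \<zero>"
    moreover obtain k where "(\<Otimes>i\<in>{..<n}. \<alpha> i \<ominus> l i [^] (x + r * k)) = v" using ex by blast
    ultimately show False using split[of k] pc[of k] v unfolding c_def[symmetric] by simp
  qed
  let ?w = "v \<otimes> inv c"
  have ic: "inv c \<in> carrier R" "c \<otimes> inv c = \<one>"
    using c c0 by (auto simp: field_Units)
  have "inv c \<noteq> \<zero>" using ic c by (metis r_null zero_not_one)
  have w: "?w \<in> carrier R - {\<zero>}" using v ic \<open>inv c \<noteq> \<zero>\<close> by (simp add: integral_iff)
  have main: "card ((\<lambda>k. g [^] k) ` ?K) \<le> (\<Sum>i\<in>I. nat \<bar>f i\<bar>)"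
  proof (rule laurent_product_card_le(2)[where \<alpha> = \<alpha> and \<beta> = "\<lambda>i. l i [^] x" and v = ?w])
    show "finite I" "I \<noteq> {}" using IJ I unfolding I_def by auto
    show "\<alpha> i \<in> carrier R - {\<zero>}" "l i [^] x \<in> carrier R - {\<zero>}" "f i \<noteq> 0" if "i \<in> I" for i
      using that \<alpha> lc by (auto simp: I_def)
    show "?w \<in> carrier R - {\<zero>}" by (rule w)
    show "(\<lambda>k. g [^] k) ` ?K \<subseteq> carrier R" using gk by auto
    fix z assume "z \<in> (\<lambda>k. g [^] k) ` ?K"
    then obtain k where k: "z = g [^] k" "(\<Otimes>i\<in>{..<n}. \<alpha> i \<ominus> l i [^] (x + r * k)) = v" by auto
    show "\<exists>u. (\<forall>i\<in>I. u i \<in> carrier R \<and> (0 < f i \<longrightarrow> u i = z [^] nat (f i)) \<and>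
          (f i < 0 \<longrightarrow> u i \<otimes> z [^] nat (- f i) = \<one>)) \<and> (\<Otimes>i\<in>I. \<alpha> i \<ominus> l i [^] x \<otimes> u i) = ?w"
    proof (intro exI[of _ "\<lambda>i. (l i [^] r) [^] k"] conjI ballI impI)
      fix i assume i: "i \<in> I"
      then have "i < n" by (simp add: I_def)
      show "(l i [^] r) [^] k \<in> carrier R" using lc[OF \<open>i < n\<close>] by simp
      have rk: "(l i [^] r) [^] k = g [^] (r * e i * k)"
        using lr[OF \<open>i < n\<close>] g(1) by (simp add: nat_pow_pow)
      {
        assume "0 < f i"
        then have eq: "int (r * e i * k) - int (nat (f i) * k) = (int (r * e i) - f i) * int k"
          by (simp add: algebra_simps)
        have "g [^] (r * e i * k) = g [^] (nat (f i) * k)"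
          by (rule gcong, unfold eq) (rule dvd_mult2[OF f[OF \<open>i < n\<close>]])
        then show "(l i [^] r) [^] k = z [^] nat (f i)"
          unfolding rk k(1) nat_pow_pow[OF g(1)] by (simp add: mult.commute)
      next
        assume "f i < 0"
        then have eq: "int (r * e i * k + k * nat (- f i)) - int 0 = (int (r * e i) - f i) * int k"
          by (simp add: algebra_simps)
        have "g [^] (r * e i * k + k * nat (- f i)) = g [^] (0::nat)"
          by (rule gcong, unfold eq) (rule dvd_mult2[OF f[OF \<open>i < n\<close>]])
        then show "(l i [^] r) [^] k \<otimes> z [^] nat (- f i) = \<one>"
          unfolding rk k(1) nat_pow_pow[OF g(1)] nat_pow_mult[OF g(1)] by simp
      }
    next
      have "(\<Otimes>i\<in>I. \<alpha> i \<ominus> l i [^] x \<otimes> (l i [^] r) [^] k) = (\<Otimes>i\<in>I. \<alpha> i \<ominus> l i [^] (x + r * k))"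
        using \<alpha>(1) lc by (intro finprod_cong') (auto simp: I_def lpow)
      also have "\<dots> = \<dots> \<otimes> c \<otimes> inv c" using pc c ic by (simp add: m_assoc)
      also have "\<dots> = ?w" using split[of k] k(2) c_def by simp
      finally show "(\<Otimes>i\<in>I. \<alpha> i \<ominus> l i [^] x \<otimes> (l i [^] r) [^] k) = ?w" .
    qed
  qed
  have "inj_on (\<lambda>k. g [^] k) {..<\<tau>}"
  proof -
    have "a = b" if ab: "g [^] a = g [^] b" "b < \<tau>" "a \<le> b" for a b :: nat
    proof -
      have "g [^] a \<otimes> g [^] (b - a) = g [^] a \<otimes> \<one>"
        using ab(1) nat_pow_mult[OF g(1), of a "b - a"] le_add_diff_inverse[OF ab(3)] gk by simp
      then have "g [^] (b - a) = \<one>" using gk m_lcancel by blast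
      then show ?thesis using g(2)[of "b - a"] ab nat_dvd_not_less[of "b - a" \<tau>] by (cases "a < b") auto
    qed
    note eq = this
    show ?thesis
    proof (rule inj_onI)
      fix a b assume "a \<in> {..<\<tau>}" "b \<in> {..<\<tau>}" "g [^] a = g [^] b"
      then show "a = b" using eq[of a b] eq[of b a] by (cases "a \<le> b") auto
    qed
  qed
  then have "inj_on (\<lambda>k. g [^] k) ?K" by (rule inj_on_subset) auto
  then have "card ?K \<le> (\<Sum>i\<in>I. nat \<bar>f i\<bar>)" using main by (simp add: card_image)
  also have "\<dots> \<le> (\<Sum>i<n. nat \<bar>f i\<bar>)" by (rule sum_mono2) (auto simp: I_def)
  finally show ?thesis .
qed auto

section \<open>Additive energy of the eigenvalues\<close>

text \<open>The additive energy of the family of points (l 0 ^ x, ..., l (n - 1) ^ x) with x <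
  \<tau>, recorded through the exponents. The nesting into two pairs separates the two sides of the
  equation and matches the index sets that arise from fourth powers of sums.\<close>

definition energy_set :: "('a, 'm) ring_scheme \<Rightarrow> nat \<Rightarrow> nat \<Rightarrow> (nat \<Rightarrow> 'a) \<Rightarrow> ((nat \<times> nat) \<times> nat \<times> nat) set" where
  "energy_set R n \<tau> l = {((x1, x2), (x3, x4)) |x1 x2 x3 x4. x1 < \<tau> \<and> x2 < \<tau> \<and> x3 < \<tau> \<and> x4 < \<tau> \<and>
     (\<forall>i<n. l i [^]\<^bsub>R\<^esub> x1 \<oplus>\<^bsub>R\<^esub> l i [^]\<^bsub>R\<^esub> x2 = l i [^]\<^bsub>R\<^esub> x3 \<oplus>\<^bsub>R\<^esub> l i [^]\<^bsub>R\<^esub> x4)}"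

text \<open>The first three exponents determine every \<open>l i ^ x4\<close>, and by
  \<open>exact\<close> these powers determine \<open>x4\<close> below \<tau>.\<close>

lemma (in field) energy_fibre_inj:
  fixes l :: "nat \<Rightarrow> 'a" and \<tau> n :: nat
  assumes \<tau>: "0 < \<tau>" and l: "\<And>i. i < n \<Longrightarrow> l i \<in> carrier R"
    and ltau: "\<And>i. i < n \<Longrightarrow> l i [^] \<tau> = \<one>"
    and exact: "\<And>x. (\<And>i. i < n \<Longrightarrow> l i [^] (x::nat) = \<one>) \<Longrightarrow> \<tau> dvd x"
  shows "inj_on (\<lambda>((x1, x2), (x3, x4)). (x1, x2, x3)) (energy_set R n \<tau> l)"
proof -
  have lnz: "l i \<noteq> \<zero>" if "i < n" for i using ltau[OF that] \<tau> by (auto simp: nat_pow_zero)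
  then have lk: "l i [^] k \<noteq> \<zero>" "l i [^] k \<in> carrier R" if "i < n" for i and k :: nat
    using that l by (induction k) (auto simp: integral_iff)
  have "a = b" if ab: "a \<le> b" "b < \<tau>" "\<And>i. i < n \<Longrightarrow> l i [^] a = l i [^] b" for a b
  proof -
    have "l i [^] (b - a) = \<one>" if i: "i < n" for i
    proof -
      have "l i [^] a \<otimes> l i [^] (b - a) = l i [^] a \<otimes> \<one>"
        using ab(3)[OF i] nat_pow_mult[OF l[OF i], of a "b - a"] le_add_diff_inverse[OF ab(1)] lk[OF i] by simp
      then show ?thesis using lk[OF i] m_lcancel by blast
    qed
    then have "\<tau> dvd b - a" by (rule exact)
    then show ?thesis using ab
      nat_dvd_not_less[of "b - a" \<tau>] by (cases "a < b") auto
  qed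
  note le = this
  have eq: "a = b" if "a < \<tau>" "b < \<tau>" "\<And>i. i < n \<Longrightarrow> l i [^] a = l i [^] b" for a b
    using le[of a b] le[of b a] that by (cases "a \<le> b") auto
  show ?thesis
  proof (rule inj_onI)
    fix p p' assume p: "p \<in> energy_set R n \<tau> l" "p' \<in> energy_set R n \<tau> l"
      and pp: "(\<lambda>((x1, x2), x3, x4). (x1, x2, x3)) p = (\<lambda>((x1, x2), x3, x4). (x1, x2, x3)) p'"
    obtain x1 x2 x3 x4 where x: "p = ((x1, x2), x3, x4)" "x4 < \<tau>"
      "\<forall>i<n. l i [^] x1 \<oplus> l i [^] x2 = l i [^] x3 \<oplus> l i [^] x4"
      using p(1) unfolding energy_set_def by blast
    obtain y4 where y: "p' = ((x1, x2), x3, y4)" "y4 < \<tau>"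
      "\<forall>i<n. l i [^] x1 \<oplus> l i [^] x2 = l i [^] x3 \<oplus> l i [^] y4"
      using p(2) pp unfolding energy_set_def x(1) by auto
    have "l i [^] x4 = l i [^] y4" if i: "i < n" for i
    proof -
      have "l i [^] x3 \<oplus> l i [^] x4 = l i [^] x3 \<oplus> l i [^] y4" using x(3) y(3) i by simp
      then show ?thesis using lk[OF i] by (simp add: add.l_cancel)
    qed
    then have "x4 = y4" using x(2) y(2) eq by blast
    then show "p = p'" using x(1) y(1) by simp
  qed
qed

lemma (in field) card_energy_set_le_cube:
  fixes l :: "nat \<Rightarrow> 'a" and \<tau> n :: nat
  assumes \<tau>: "0 < \<tau>" and l: "\<And>i. i < n \<Longrightarrow> l i \<in> carrier R"
    and ltau: "\<And>i. i < n \<Longrightarrow> l i [^] \<tau> = \<one>"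
    and exact: "\<And>x. (\<And>i. i < n \<Longrightarrow> l i [^] (x::nat) = \<one>) \<Longrightarrow> \<tau> dvd x"
  shows "finite (energy_set R n \<tau> l)" "card (energy_set R n \<tau> l) \<le> \<tau> ^ 3"
proof -
  have s: "energy_set R n \<tau> l \<subseteq> ({..<\<tau>} \<times> {..<\<tau>}) \<times> {..<\<tau>} \<times> {..<\<tau>}" by (auto simp: energy_set_def)
  then show "finite (energy_set R n \<tau> l)" by (rule finite_subset) auto
  have "card (energy_set R n \<tau> l) \<le> card ({..<\<tau>} \<times> {..<\<tau>} \<times> {..<\<tau>})"
    by (rule card_inj_on_le[OF energy_fibre_inj[OF assms]]) (auto simp: energy_set_def)
  then show "card (energy_set R n \<tau> l) \<le> \<tau> ^ 3" by (simp add: power3_eq_cube)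
qed

text \<open>\<open>K\<close> is the product of those orders that are below \<open>y\<close>; there
  are at most \<open>n\<close> of them.\<close>

lemma small_orders_product:
  fixes o' :: "nat \<Rightarrow> nat" and y :: real and n :: nat
  assumes "1 \<le> y" "\<And>i. i < n \<Longrightarrow> 0 < o' i"
  obtains K where "0 < K" "real K \<le> y ^ n" "\<And>i. i < n \<Longrightarrow> real (o' i) < y \<Longrightarrow> o' i dvd K"
proof -
  define S where "S = {i \<in> {..<n}. real (o' i) < y}"
  have fin: "finite S" by (simp add: S_def)
  have "(\<Prod>i\<in>S. real (o' i)) \<le> (\<Prod>i\<in>S. y)" by (rule prod_mono) (auto simp: S_def)
  also have "\<dots> \<le> y ^ n" 
    using assms(1) card_mono[of "{..<n}" S] by (auto simp: S_def intro!: power_increasing)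
  finally have "real (\<Prod>i\<in>S. o' i) \<le> y ^ n" by simp
  moreover have "0 < (\<Prod>i\<in>S. o' i)" using assms(2) by (intro prod_pos) (auto simp: S_def)
  moreover have "o' i dvd (\<Prod>i\<in>S. o' i)" if "i < n" "real (o' i) < y" for i
    using fin that by (intro dvd_prodI) (auto simp: S_def)
  ultimately show ?thesis using that by blast
qed

text \<open>
  For fixed \<open>x1\<close>, \<open>x2\<close> the product over \<open>i\<close> of \<open>l i ^ x1 + l i ^ x2 - l i ^ x3\<close> is a power of the
  product of all \<open>l i\<close>, so it takes at most \<open>t\<close> values. Along a progression \<open>x3 + r * k\<close> with all
  \<open>r * e i\<close> small modulo \<open>\<tau>\<close> this product is a Laurent polynomial of small degree.
  The factor \<open>K\<close> of \<open>r\<close> removes the \<open>l i\<close> of small order, for which too many pairs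
  \<open>(x1, x2)\<close> may satisfy \<open>l i ^ x1 + l i ^ x2 = 0\<close>.
\<close>
lemma (in field) energy_bound:
  fixes l :: "nat \<Rightarrow> 'a" and \<tau> n t :: nat
  assumes n: "0 < n" and \<tau>: "0 < \<tau>" and l: "\<And>i. i < n \<Longrightarrow> l i \<in> carrier R"
    and ltau: "\<And>i. i < n \<Longrightarrow> l i [^] \<tau> = \<one>"
    and exact: "\<And>x. (\<And>i. i < n \<Longrightarrow> l i [^] (x::nat) = \<one>) \<Longrightarrow> \<tau> dvd x"
    and t: "0 < t" "(\<Otimes>i\<in>{..<n}. l i) [^] t = \<one>"
  shows "real (card (energy_set R n \<tau> l)) \<le> 3 * real n * real t * real \<tau> ^ 3 / real \<tau> powr (1 / (2 * real n))"
proof (cases "\<tau> = 1")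
  case True
  then have "card (energy_set R n \<tau> l) \<le> 1" using card_energy_set_le_cube[of \<tau> n l] assms by simp
  moreover have "1 \<le> 3 * n * t" using n t by simp
  ultimately have "card (energy_set R n \<tau> l) \<le> 3 * n * t" by linarith
  then have "real (card (energy_set R n \<tau> l)) \<le> real (3 * n * t)" by (simp only: of_nat_le_iff)
  then show ?thesis using True by simp
next
  case False
  then have \<tau>2: "2 \<le> \<tau>" using \<tau> by simp
  \<comment> \<open>Since y^(2 n) = \<tau>, the steps below \<tau> leave room for a factor up to y^n
    in \<open>K\<close> and another one for Dirichlet's multiplier. Both the degree \<open>N\<close>
    and the exceptional sets \<open>D x1\<close> then gain a factor 1 / y.\<close>
  define y where "y = real \<tau> powr (1 / (2 * real n))"
  have y1: "1 < y" unfolding y_def using \<tau>2 n by simp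
  have yn: "y ^ n * y ^ n = real \<tau>"
  proof -
    have "y ^ n = real \<tau> powr (1 / 2)"
      unfolding y_def using n \<tau> by (simp add: powr_powr flip: powr_realpow)
    then show ?thesis using \<tau> by (simp flip: powr_add)
  qed
  obtain g e where g: "g \<in> carrier R" "\<And>k::nat. g [^] k = \<one> \<longleftrightarrow> \<tau> dvd k"
    and le: "\<And>i. i < n \<Longrightarrow> l i = g [^] (e i :: nat)"
    using obtain_primitive_root[of \<tau> n l] \<tau> l ltau exact by metis
  \<comment> \<open>\<open>oo i\<close> is the order of \<open>l i\<close>, computed from its
    exponent.\<close>
  define oo where "oo i = \<tau> div gcd (e i) \<tau>" for i
  have oo0: "0 < oo i" for i unfolding oo_def using \<tau> by (simp add: div_greater_zero_iff gcd_le2_nat)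
  have oodvd: "oo i dvd \<tau>" for i unfolding oo_def by (metis dvd_div_mult_self dvd_triv_left gcd_dvd2)
  have dvd_iff: "\<tau> dvd k * e i \<longleftrightarrow> oo i dvd k" for i k
  proof -
    let ?d = "gcd (e i) \<tau>"
    have d: "0 < ?d" using \<tau> by simp
    have "\<tau> dvd k * e i \<longleftrightarrow> oo i * ?d dvd (k * (e i div ?d)) * ?d"
      by (simp add: oo_def mult.assoc)
    also have "\<dots> \<longleftrightarrow> oo i dvd k * (e i div ?d)" using d by simp
    also have "\<dots> \<longleftrightarrow> oo i dvd k"
      using div_gcd_coprime[of "e i" \<tau>] \<tau> by (simp add: oo_def coprime_dvd_mult_left_iff coprime_commute)
    finally show ?thesis .
  qed
  have lpow1: "l i [^] k = \<one> \<longleftrightarrow> oo i dvd k" if "i < n" for i k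
    using le[OF that] g dvd_iff[of k i] by (simp add: nat_pow_pow mult.commute)
  obtain K where K: "0 < K" "real K \<le> y ^ n" "\<And>i. i < n \<Longrightarrow> real (oo i) < y \<Longrightarrow> oo i dvd K"
    using small_orders_product[of y n oo] y1 oo0 by auto
  \<comment> \<open>The largest integer strictly below \<open>y\<close>: strictness yields r <
    \<tau> further down, and y \<le> 2 M costs only a factor 2.\<close>
  define M where "M = nat (\<lceil>y\<rceil> - 1)"
  have cy: "2 \<le> \<lceil>y\<rceil>" using y1 by linarith
  then have Mr: "real M = of_int \<lceil>y\<rceil> - 1" unfolding M_def by simp
  have M: "0 < M" "real M < y" "y \<le> 2 * real M" using Mr cy y1 by linarith+
  \<comment> \<open>The approximation is applied to \<open>K * e i\<close>, so that the actual step
    \<open>r = K * r'\<close> is a multiple of every small order.\<close>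
  obtain r' f where r': "1 \<le> r'" "r' \<le> M ^ n" 
    and fM: "\<And>i. i < n \<Longrightarrow> \<bar>f i\<bar> * int M < int \<tau>" 
    and fr': "\<And>i. i < n \<Longrightarrow> int \<tau> dvd int (r' * (K * e i)) - f i"
    using simultaneous_small_residues[OF M(1) \<tau>, of n "\<lambda>i. K * e i"] by metis
  define r where "r = K * r'"
  have fr: "int \<tau> dvd int (r * e i) - f i" if "i < n" for i
    using fr'[OF that] by (simp add: r_def algebra_simps)
  have f0: "f i = 0" if i: "i < n" and "\<tau> dvd r * e i" for i
  proof -
    have "int \<tau> dvd int (r * e i)" using that by (simp only: int_dvd_int_iff)
    then have "int \<tau> dvd f i" using fr[OF i] dvd_diff_right_iff by blast
    moreover have "\<bar>f i\<bar> * 1 \<le> \<bar>f i\<bar> * int M" using M(1) by (intro mult_left_mono) auto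
    ultimately show ?thesis using fM[OF i] dvd_imp_le_int[of "f i" "int \<tau>"] by auto
  qed
  have f_small: "f i = 0" if "i < n" "real (oo i) < y" for i
    using f0[of i] that K(3)[of i] dvd_iff[of r i] by (simp add: r_def)
  \<comment> \<open>Otherwise \<open>r\<close> would kill every eigenvalue and be a multiple of
    \<tau>, although 0 < r < y^n y^n = \<tau>. A nonzero \<open>f i\<close> is what keeps the
    product from being constant along the progression.\<close>
  have "\<exists>i<n. f i \<noteq> 0"
  proof (rule ccontr)
    assume "\<not> ?thesis"
    then have "\<tau> dvd r * e i" if "i < n" for i using fr[OF that] that by (simp add: int_dvd_int_iff del: of_nat_mult)
    then have "\<tau> dvd r" using exact[of r] lpow1 dvd_iff by metis
    moreover have "real r < real \<tau>"
    proof -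
      have "real r' \<le> real M ^ n" using r'(2) by (simp flip: of_nat_power)
      also have "\<dots> < y ^ n" using M n by (intro power_strict_mono) auto
      finally have "real K * real r' < y ^ n * y ^ n" using K y1 r' by (intro mult_le_less_imp_less) auto
      then show ?thesis by (simp add: r_def yn)
    qed
    moreover have "0 < r" using K r' by (simp add: r_def)
    ultimately show False by (auto dest: dvd_imp_le)
  qed
  then obtain i0 where i0: "i0 < n" "f i0 \<noteq> 0" by blast
  define N where "N = (\<Sum>i<n. nat \<bar>f i\<bar>)"
  have N: "real N \<le> 2 * real n * real \<tau> / y"
  proof -
    have "real (nat \<bar>f i\<bar>) \<le> 2 * real \<tau> / y" if "i < n" for i
    proof -
      have "real_of_int (\<bar>f i\<bar> * int M) < real_of_int (int \<tau>)" using fM[OF that] by (simp only: of_int_less_iff)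
      then have "real (nat \<bar>f i\<bar>) * real M \<le> real \<tau>" by simp
      then have "real (nat \<bar>f i\<bar>) * (2 * real M) \<le> 2 * real \<tau>" by simp
      moreover have "real (nat \<bar>f i\<bar>) * y \<le> real (nat \<bar>f i\<bar>) * (2 * real M)" using M by (intro mult_left_mono) auto
      ultimately show ?thesis using y1 by (simp add: pos_le_divide_eq)
    qed
    then have "(\<Sum>i<n. real (nat \<bar>f i\<bar>)) \<le> real n * (2 * real \<tau> / y)"
      using sum_bounded_above[of "{..<n}" "\<lambda>i. real (nat \<bar>f i\<bar>)" "2 * real \<tau> / y"] by simp
    then show ?thesis by (simp add: N_def mult_ac)
  qed
  have lk: "l i [^] k \<noteq> \<zero>" "l i [^] k \<in> carrier R" if "i < n" for i and k :: nat
  proof -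
    have "l i \<noteq> \<zero>" using ltau[OF that] \<tau> by (auto simp: nat_pow_zero)
    then show "l i [^] k \<noteq> \<zero>" "l i [^] k \<in> carrier R"
      using that l by (induction k) (auto simp: integral_iff)
  qed
  \<comment> \<open>Membership in \<open>V\<close> eliminates \<open>x4\<close>: the powers of the
    product of all \<open>l i\<close> are \<open>t\<close>-th roots of unity.\<close>
  define V where "V = {v \<in> carrier R. v [^] t = \<one>}"
  have V: "finite V" "card V \<le> t" "\<zero> \<notin> V"
    unfolding V_def using card_nth_roots_le[OF t(1), of \<one>] t(1) by (auto simp: nat_pow_zero)
  define \<alpha> where "\<alpha> x1 x2 i = l i [^] x1 \<oplus> l i [^] x2" for x1 x2 i :: nat
  have \<alpha>c: "\<alpha> x1 x2 i \<in> carrier R" if "i < n" for x1 x2 i unfolding \<alpha>_def using lk[OF that] by simp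
  define F where "F x1 x2 x3 = (\<Otimes>i\<in>{..<n}. \<alpha> x1 x2 i \<ominus> l i [^] x3)" for x1 x2 x3 :: nat
  have Fper: "F x1 x2 (x3 + \<tau>) = F x1 x2 x3" for x1 x2 x3
    unfolding F_def using \<alpha>c lk l ltau by (intro finprod_cong') (auto simp flip: nat_pow_mult)
  \<comment> \<open>The exceptional \<open>x2\<close>. Only indices of large order are tested, since
    a small order forces \<open>f i = 0\<close> and such factors do not enter the Laurent
    product.\<close>
  define D where "D x1 = {x2 \<in> {..<\<tau>}. \<exists>i<n. y \<le> real (oo i) \<and> \<alpha> x1 x2 i = \<zero>}" for x1
  have good: "card {x3 \<in> {..<\<tau>}. F x1 x2 x3 \<in> V} \<le> t * N" if x2: "x2 < \<tau>" "x2 \<notin> D x1" for x1 x2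
  proof (rule card_periodic_le[OF \<tau>])
    show "F x1 x2 (x + \<tau>) \<in> V \<longleftrightarrow> F x1 x2 x \<in> V" for x by (simp add: Fper)
    fix x
    have "{k \<in> {..<\<tau>}. F x1 x2 (x + r * k) \<in> V} \<subseteq> (\<Union>v\<in>V. {k \<in> {..<\<tau>}. F x1 x2 (x + r * k) = v})" by auto
    then have "card {k \<in> {..<\<tau>}. F x1 x2 (x + r * k) \<in> V} \<le> 
        card (\<Union>v\<in>V. {k \<in> {..<\<tau>}. F x1 x2 (x + r * k) = v})"
      by (rule card_mono[rotated]) (use V in auto)
    also have "\<dots> \<le> (\<Sum>v\<in>V. card {k \<in> {..<\<tau>}. F x1 x2 (x + r * k) = v})"
      by (rule card_UN_le[OF V(1)])
    also have "\<dots> \<le> (\<Sum>v\<in>V. N)"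
    proof (rule sum_mono)
      fix v assume "v \<in> V"
      then have v: "v \<in> carrier R" "v \<noteq> \<zero>" using V(3) by (auto simp: V_def)
      have "\<alpha> x1 x2 i \<noteq> \<zero>" if "i < n" "f i \<noteq> 0" for i
        using f_small[OF that(1)] that x2 by (force simp: D_def)
      then show "card {k \<in> {..<\<tau>}. F x1 x2 (x + r * k) = v} \<le> N"
        unfolding F_def N_def using \<alpha>c v
        by (intro card_product_fibre_le[where g = g and e = e and ?i0.0 = i0] \<tau> g le fr i0) auto
    qed
    also have "\<dots> \<le> t * N" using V(2) by simp
    finally show "card {k \<in> {..<\<tau>}. F x1 x2 (x + r * k) \<in> V} \<le> t * N" .
  qed
  have Dfin: "finite (D x1)" "D x1 \<subseteq> {..<\<tau>}" for x1 by (auto simp: D_def)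
  \<comment> \<open>A vanishing coefficient prescribes \<open>l i ^ x2\<close>, hence
    \<open>x2\<close> modulo \<open>oo i \<ge> y\<close>, so each index contributes at most \<tau> /
    y exceptions.\<close>
  have Dcard: "real (card (D x1)) \<le> real n * real \<tau> / y" for x1
  proof -
    let ?S = "\<lambda>i. {x2 \<in> {..<\<tau>}. y \<le> real (oo i) \<and> \<alpha> x1 x2 i = \<zero>}"
    have "D x1 = (\<Union>i\<in>{..<n}. ?S i)" by (auto simp: D_def)
    then have "card (D x1) \<le> (\<Sum>i<n. card (?S i))" by (simp only: card_UN_le finite_lessThan)
    then have "real (card (D x1)) \<le> real (\<Sum>i<n. card (?S i))" by (simp only: of_nat_le_iff)
    also have "\<dots> = (\<Sum>i<n. real (card (?S i)))" by simp
    also have "\<dots> \<le> (\<Sum>i<n. real \<tau> / y)"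
    proof (rule sum_mono)
      fix i assume "i \<in> {..<n}"
      then have i: "i < n" by simp
      show "real (card (?S i)) \<le> real \<tau> / y"
      proof (cases "y \<le> real (oo i)")
        case large: True
        have cong: "[a = b] (mod oo i)" 
          if ab: "l i [^] x1 \<oplus> l i [^] a = \<zero>" "l i [^] x1 \<oplus> l i [^] b = \<zero>" "a \<le> b" for a b :: nat
        proof -
          have "l i [^] a = l i [^] b" using ab(1,2) lk[OF i] by (metis add.l_cancel)
          then have "l i [^] a \<otimes> l i [^] (b - a) = l i [^] a \<otimes> \<one>"
            using nat_pow_mult[OF l[OF i], of a "b - a"] le_add_diff_inverse[OF ab(3)] lk[OF i] by simp
          then have "l i [^] (b - a) = \<one>" using lk[OF i] m_lcancel by blast
          then have "oo i dvd b - a" using lpow1[OF i] by simp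
          then show ?thesis using ab(3) by (metis cong_altdef_nat cong_sym)
        qed
        have "card (?S i) * oo i \<le> \<tau>"
        proof (rule card_residue_class_le[OF oo0 oodvd])
          fix a b assume "a \<in> ?S i" "b \<in> ?S i"
          then show "[a = b] (mod oo i)" using cong[of a b] cong[of b a]
            by (cases "a \<le> b") (auto simp: \<alpha>_def cong_sym)
        qed auto
        then have "real (card (?S i) * oo i) \<le> real \<tau>" by (simp only: of_nat_le_iff)
        moreover have "real (card (?S i)) * y \<le> real (card (?S i)) * real (oo i)"
          using large by (intro mult_left_mono) auto
        ultimately show ?thesis using y1 by (simp add: pos_le_divide_eq)
      qed (use y1 in simp)
    qed
    finally show ?thesis by simp
  qed
  \<comment> \<open>An exceptional \<open>x2\<close> is charged the trivial number \<tau> of values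
    of \<open>x3\<close>.\<close>
  have per_x1: "(\<Sum>x2<\<tau>. card {x3 \<in> {..<\<tau>}. F x1 x2 x3 \<in> V}) \<le> \<tau> * (t * N) + card (D x1) * \<tau>" for x1
  proof -
    have "(\<Sum>x2<\<tau>. card {x3 \<in> {..<\<tau>}. F x1 x2 x3 \<in> V}) \<le> (\<Sum>x2<\<tau>. t * N + (if x2 \<in> D x1 then \<tau> else 0))"
    proof (rule sum_mono)
      fix x2 assume "x2 \<in> {..<\<tau>}"
      moreover have "card {x3 \<in> {..<\<tau>}. F x1 x2 x3 \<in> V} \<le> \<tau>"
        using card_mono[of "{..<\<tau>}" "{x3 \<in> {..<\<tau>}. F x1 x2 x3 \<in> V}"] by auto
      ultimately show "card {x3 \<in> {..<\<tau>}. F x1 x2 x3 \<in> V} \<le> t * N + (if x2 \<in> D x1 then \<tau> else 0)"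
        using good[of x2 x1] by auto
    qed
    also have "\<dots> = \<tau> * (t * N) + card ({..<\<tau>} \<inter> D x1) * \<tau>"
      by (simp add: sum.distrib sum.If_cases)
    also have "{..<\<tau>} \<inter> D x1 = D x1" using Dfin by blast
    finally show ?thesis .
  qed
  have "card (energy_set R n \<tau> l) \<le> card (SIGMA x1:{..<\<tau>}. SIGMA x2:{..<\<tau>}. {x3 \<in> {..<\<tau>}. F x1 x2 x3 \<in> V})"
  proof (rule card_inj_on_le[OF energy_fibre_inj[of \<tau> n l]])
    show "(\<lambda>((x1, x2), x3, x4). (x1, x2, x3)) ` energy_set R n \<tau> l \<subseteq> 
      (SIGMA x1:{..<\<tau>}. SIGMA x2:{..<\<tau>}. {x3 \<in> {..<\<tau>}. F x1 x2 x3 \<in> V})"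
    proof (clarsimp simp: energy_set_def)
      fix x1 x2 x3 x4 :: nat assume a: "\<forall>i<n. l i [^] x1 \<oplus> l i [^] x2 = l i [^] x3 \<oplus> l i [^] x4"
      have "\<alpha> x1 x2 i \<ominus> l i [^] x3 = l i [^] x4" if i: "i < n" for i
      proof -
        have "\<alpha> x1 x2 i \<ominus> l i [^] x3 = (l i [^] x3 \<oplus> l i [^] x4) \<ominus> l i [^] x3" using a i by (simp add: \<alpha>_def)
        also have "\<dots> = l i [^] x4" using lk[OF i] by algebra
        finally show ?thesis .
      qed
      then have "F x1 x2 x3 = (\<Otimes>i\<in>{..<n}. l i [^] x4)"
        unfolding F_def using lk by (intro finprod_cong') auto
      also have "\<dots> = (\<Otimes>i\<in>{..<n}. l i) [^] x4"
        using l by (induction x4) (auto simp: finprod_multf lk finprod_one_eqI)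
      finally have F: "F x1 x2 x3 = (\<Otimes>i\<in>{..<n}. l i) [^] x4" .
      have P: "(\<Otimes>i\<in>{..<n}. l i) \<in> carrier R" using l by (intro finprod_closed) auto
      have "F x1 x2 x3 [^] t = ((\<Otimes>i\<in>{..<n}. l i) [^] t) [^] x4"
        using P unfolding F by (simp add: nat_pow_pow mult.commute)
      then show "F x1 x2 x3 \<in> V" using P t(2) by (simp add: V_def F)
    qed
  qed (use assms in auto)
  also have "\<dots> = (\<Sum>x1<\<tau>. \<Sum>x2<\<tau>. card {x3 \<in> {..<\<tau>}. F x1 x2 x3 \<in> V})"
    by (simp add: card_SigmaI)
  also have "\<dots> \<le> (\<Sum>x1<\<tau>. \<tau> * (t * N) + card (D x1) * \<tau>)" by (rule sum_mono) (rule per_x1)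
  finally have "real (card (energy_set R n \<tau> l)) \<le> real (\<Sum>x1<\<tau>. \<tau> * (t * N) + card (D x1) * \<tau>)"
    by (simp only: of_nat_le_iff)
  also have "\<dots> = (\<Sum>x1<\<tau>. real \<tau> * (real t * real N) + real (card (D x1)) * real \<tau>)" by simp
  also have "\<dots> \<le> (\<Sum>x1<\<tau>. real \<tau> * (real t * (2 * real n * real \<tau> / y)) + (real n * real \<tau> / y) * real \<tau>)"
    by (intro sum_mono add_mono mult_left_mono mult_right_mono N Dcard) auto
  also have "\<dots> = (2 * real n * real t + real n) * (real \<tau> ^ 3 / y)"
    by (simp add: divide_inverse algebra_simps power3_eq_cube)
  \<comment> \<open>The 2 comes from y \<le> 2 M; the exceptional pairs carry no \<open>t\<close>
    and are absorbed using t \<ge> 1.\<close>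
  also have "\<dots> \<le> (3 * real n * real t) * (real \<tau> ^ 3 / y)"
  proof (rule mult_right_mono)
    have "real n * 1 \<le> real n * real t" using t by (intro mult_left_mono) auto
    then show "2 * real n * real t + real n \<le> 3 * real n * real t" by simp
  qed (use y1 in simp)
  finally show ?thesis by (simp add: y_def)
qed

section \<open>Matrices over commutative rings\<close>

lemma (in abelian_monoid) finsum_swap:
  assumes "finite A" "finite B" "\<And>i j. i \<in> A \<Longrightarrow> j \<in> B \<Longrightarrow> f i j \<in> carrier G"
  shows "(\<Oplus>i\<in>A. \<Oplus>j\<in>B. f i j) = (\<Oplus>j\<in>B. \<Oplus>i\<in>A. f i j)"
  using assms(1,3)
proof (induction A rule: finite_induct)
  case empty
  then show ?case using assms(2) by (simp add: finsum_zero)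
next
  case (insert a A)
  have "(\<Oplus>i\<in>insert a A. \<Oplus>j\<in>B. f i j) = (\<Oplus>j\<in>B. f a j) \<oplus> (\<Oplus>j\<in>B. \<Oplus>i\<in>A. f i j)"
    using insert by (simp add: finsum_insert Pi_def)
  also have "\<dots> = (\<Oplus>j\<in>B. f a j \<oplus> (\<Oplus>i\<in>A. f i j))"
    using insert by (simp add: finsum_addf Pi_def)
  also have "\<dots> = (\<Oplus>j\<in>B. \<Oplus>i\<in>insert a A. f i j)"
    using insert by (intro finsum_cong') (auto simp: Pi_def)
  finally show ?case .
qed

lemma (in abelian_monoid) finsum_Times:
  assumes "finite A" "finite B" "\<And>i j. i \<in> A \<Longrightarrow> j \<in> B \<Longrightarrow> f i j \<in> carrier G"
  shows "(\<Oplus>i\<in>A. \<Oplus>j\<in>B. f i j) = (\<Oplus>p\<in>A \<times> B. f (fst p) (snd p))"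
  using assms(1,3)
proof (induction A rule: finite_induct)
  case empty
  then show ?case by simp
next
  case (insert a A)
  have "(\<Oplus>p\<in>insert a A \<times> B. f (fst p) (snd p)) = (\<Oplus>p\<in>Pair a ` B \<union> A \<times> B. f (fst p) (snd p))"
    by (rule arg_cong[where f = "finsum G _"]) auto
  also have "\<dots> = (\<Oplus>p\<in>Pair a ` B. f (fst p) (snd p)) \<oplus> (\<Oplus>p\<in>A \<times> B. f (fst p) (snd p))"
    using insert assms(2) by (intro finsum_Un_disjoint) auto
  also have "(\<Oplus>p\<in>Pair a ` B. f (fst p) (snd p)) = (\<Oplus>j\<in>B. f a j)"
    using insert by (subst finsum_reindex) (auto simp: inj_on_def)
  finally show ?case using insert by (simp add: finsum_insert Pi_def)
qed

text \<open>This is (x M) y = x (M y). Associativity of the matrix product and of its actions on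
  rows and columns are instances of it, entry by entry.\<close>

lemma (in cring) finsum_mult_assoc:
  assumes "finite A" "finite B" "\<And>i. i \<in> A \<Longrightarrow> x i \<in> carrier R" "\<And>j. j \<in> B \<Longrightarrow> y j \<in> carrier R"
    "\<And>i j. i \<in> A \<Longrightarrow> j \<in> B \<Longrightarrow> m i j \<in> carrier R"
  shows "(\<Oplus>j\<in>B. (\<Oplus>i\<in>A. x i \<otimes> m i j) \<otimes> y j) = (\<Oplus>i\<in>A. x i \<otimes> (\<Oplus>j\<in>B. m i j \<otimes> y j))"
proof -
  have "(\<Oplus>j\<in>B. (\<Oplus>i\<in>A. x i \<otimes> m i j) \<otimes> y j) = (\<Oplus>j\<in>B. \<Oplus>i\<in>A. x i \<otimes> (m i j \<otimes> y j))"
    using assms by (intro finsum_cong') (auto simp: finsum_ldistr Pi_def m_assoc intro!: finsum_cong')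
  also have "\<dots> = (\<Oplus>i\<in>A. \<Oplus>j\<in>B. x i \<otimes> (m i j \<otimes> y j))"
    using assms by (intro finsum_swap[symmetric]) auto
  also have "\<dots> = (\<Oplus>i\<in>A. x i \<otimes> (\<Oplus>j\<in>B. m i j \<otimes> y j))"
    using assms by (intro finsum_cong') (auto simp: finsum_rdistr Pi_def)
  finally show ?thesis .
qed

lemma mat_monoid_carrier_iff:
  "A \<in> carrier (mat_monoid R n) \<longleftrightarrow> A \<in> carrier_mat n n \<and> (\<forall>i<n. \<forall>j<n. A $$ (i, j) \<in> carrier R)"
proof -
  have "(\<forall>i<n. \<forall>j<n. A $$ (i, j) \<in> carrier R)" if "A \<in> carrier_mat n n" "elements_mat A \<subseteq> carrier R"
    using elements_matI[OF that(1)] that(2) by (simp add: subset_iff)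
  moreover have "elements_mat A \<subseteq> carrier R"
    if "A \<in> carrier_mat n n" and A: "\<forall>i<n. \<forall>j<n. A $$ (i, j) \<in> carrier R"
  proof
    fix a assume "a \<in> elements_mat A"
    from elements_matD[OF this] that(1) A show "a \<in> carrier R" by auto
  qed
  ultimately show ?thesis unfolding mat_monoid_def partial_object.simps mem_Collect_eq by blast
qed

lemma vecs_iff: "v \<in> vecs R n \<longleftrightarrow> dim_vec v = n \<and> (\<forall>i<n. v $ i \<in> carrier R)"
  unfolding vecs_def vec_set_def carrier_vec_def mem_Collect_eq image_subset_iff by blast

lemma mat_monoid_mult_index:
  "i < n \<Longrightarrow> j < n \<Longrightarrow> (A \<otimes>\<^bsub>mat_monoid R n\<^esub> B) $$ (i, j) = (\<Oplus>\<^bsub>R\<^esub>k\<in>{..<n}. A $$ (i, k) \<otimes>\<^bsub>R\<^esub> B $$ (k, j))"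
  by (simp add: mat_monoid_def)

lemma mat_monoid_one_index:
  "i < n \<Longrightarrow> j < n \<Longrightarrow> \<one>\<^bsub>mat_monoid R n\<^esub> $$ (i, j) = (if i = j then \<one>\<^bsub>R\<^esub> else \<zero>\<^bsub>R\<^esub>)"
  by (simp add: mat_monoid_def)

lemma mat_monoid_dim [simp]:
  "dim_row (A \<otimes>\<^bsub>mat_monoid R n\<^esub> B) = n" "dim_col (A \<otimes>\<^bsub>mat_monoid R n\<^esub> B) = n"
  "dim_row \<one>\<^bsub>mat_monoid R n\<^esub> = n" "dim_col \<one>\<^bsub>mat_monoid R n\<^esub> = n"
  by (simp_all add: mat_monoid_def)

lemma (in cring) finsum_delta_left:
  assumes "i < (n::nat)" "\<And>k. k < n \<Longrightarrow> x k \<in> carrier R"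
  shows "(\<Oplus>k\<in>{..<n}. (if i = k then \<one> else \<zero>) \<otimes> x k) = x i"
proof -
  have "(\<Oplus>k\<in>{..<n}. (if i = k then \<one> else \<zero>) \<otimes> x k) = (\<Oplus>k\<in>{..<n}. if i = k then x k else \<zero>)"
    using assms by (intro finsum_cong') auto
  also have "\<dots> = x i" using assms by (intro finsum_singleton) auto
  finally show ?thesis .
qed

lemma (in cring) finsum_delta_right:
  assumes "j < (n::nat)" "\<And>k. k < n \<Longrightarrow> x k \<in> carrier R"
  shows "(\<Oplus>k\<in>{..<n}. x k \<otimes> (if k = j then \<one> else \<zero>)) = x j"
proof -
  have "(\<Oplus>k\<in>{..<n}. x k \<otimes> (if k = j then \<one> else \<zero>)) = (\<Oplus>k\<in>{..<n}. (if j = k then \<one> else \<zero>) \<otimes> x k)"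
    using assms by (intro finsum_cong') auto
  then show ?thesis using finsum_delta_left[OF assms] by simp
qed

lemma (in cring) monoid_mat_monoid: "monoid (mat_monoid R n)"
proof
  let ?M = "mat_monoid R n"
  show cl: "A \<otimes>\<^bsub>?M\<^esub> B \<in> carrier ?M" if "A \<in> carrier ?M" "B \<in> carrier ?M" for A B
    using that by (auto simp: mat_monoid_carrier_iff mat_monoid_mult_index intro!: carrier_matI finsum_closed)
  show "\<one>\<^bsub>?M\<^esub> \<in> carrier ?M"
    by (auto simp: mat_monoid_carrier_iff mat_monoid_one_index intro!: carrier_matI)
  show "A \<otimes>\<^bsub>?M\<^esub> B \<otimes>\<^bsub>?M\<^esub> C = A \<otimes>\<^bsub>?M\<^esub> (B \<otimes>\<^bsub>?M\<^esub> C)"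
    if "A \<in> carrier ?M" "B \<in> carrier ?M" "C \<in> carrier ?M" for A B C
  proof (rule eq_matI)
    fix i j assume "i < dim_row (A \<otimes>\<^bsub>?M\<^esub> (B \<otimes>\<^bsub>?M\<^esub> C))" "j < dim_col (A \<otimes>\<^bsub>?M\<^esub> (B \<otimes>\<^bsub>?M\<^esub> C))"
    then show "(A \<otimes>\<^bsub>?M\<^esub> B \<otimes>\<^bsub>?M\<^esub> C) $$ (i, j) = (A \<otimes>\<^bsub>?M\<^esub> (B \<otimes>\<^bsub>?M\<^esub> C)) $$ (i, j)"
      using that finsum_mult_assoc[of "{..<n}" "{..<n}" "\<lambda>l. A $$ (i, l)" "\<lambda>k. C $$ (k, j)" "\<lambda>l k. B $$ (l, k)"]
      by (simp add: mat_monoid_carrier_iff mat_monoid_mult_index finsum_closed Pi_def cong: finsum_cong)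
  qed auto
  show "\<one>\<^bsub>?M\<^esub> \<otimes>\<^bsub>?M\<^esub> A = A" if "A \<in> carrier ?M" for A
    by (rule eq_matI) (use that in \<open>auto simp: mat_monoid_carrier_iff mat_monoid_mult_index mat_monoid_one_index finsum_delta_left cong: finsum_cong\<close>)
  show "A \<otimes>\<^bsub>?M\<^esub> \<one>\<^bsub>?M\<^esub> = A" if "A \<in> carrier ?M" for A
    by (rule eq_matI) (use that in \<open>auto simp: mat_monoid_carrier_iff mat_monoid_mult_index mat_monoid_one_index finsum_delta_right cong: finsum_cong\<close>)
qed

lemma row_mult_mat_index [simp]:
  "j < n \<Longrightarrow> row_mult_mat R n a A $ j = (\<Oplus>\<^bsub>R\<^esub>i\<in>{..<n}. a $ i \<otimes>\<^bsub>R\<^esub> A $$ (i, j))"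
  "dim_vec (row_mult_mat R n a A) = n"
  by (simp_all add: row_mult_mat_def)

lemma mat_mult_col_index [simp]:
  "i < n \<Longrightarrow> mat_mult_col R n A b $ i = (\<Oplus>\<^bsub>R\<^esub>j\<in>{..<n}. A $$ (i, j) \<otimes>\<^bsub>R\<^esub> b $ j)"
  "dim_vec (mat_mult_col R n A b) = n"
  by (simp_all add: mat_mult_col_def)

context cring
begin

lemma row_mult_mat_closed:
  "a \<in> vecs R n \<Longrightarrow> A \<in> carrier (mat_monoid R n) \<Longrightarrow> row_mult_mat R n a A \<in> vecs R n"
  by (auto simp: vecs_iff mat_monoid_carrier_iff intro!: finsum_closed)

lemma mat_mult_col_closed:
  "A \<in> carrier (mat_monoid R n) \<Longrightarrow> b \<in> vecs R n \<Longrightarrow> mat_mult_col R n A b \<in> vecs R n"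
  by (auto simp: vecs_iff mat_monoid_carrier_iff intro!: finsum_closed)

lemma row_mult_col_closed:
  "a \<in> vecs R n \<Longrightarrow> b \<in> vecs R n \<Longrightarrow> row_mult_col R n a b \<in> carrier R"
  by (auto simp: vecs_iff row_mult_col_def intro!: finsum_closed)

lemma row_mult_mat_assoc:
  assumes "a \<in> vecs R n" "A \<in> carrier (mat_monoid R n)" "B \<in> carrier (mat_monoid R n)"
  shows "row_mult_mat R n (row_mult_mat R n a A) B = row_mult_mat R n a (A \<otimes>\<^bsub>mat_monoid R n\<^esub> B)"
proof (rule eq_vecI)
  fix j assume "j < dim_vec (row_mult_mat R n a (A \<otimes>\<^bsub>mat_monoid R n\<^esub> B))"
  then show "row_mult_mat R n (row_mult_mat R n a A) B $ j = row_mult_mat R n a (A \<otimes>\<^bsub>mat_monoid R n\<^esub> B) $ j"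
    using assms finsum_mult_assoc[of "{..<n}" "{..<n}" "\<lambda>l. a $ l" "\<lambda>k. B $$ (k, j)" "\<lambda>l k. A $$ (l, k)"]
    by (simp add: vecs_iff mat_monoid_carrier_iff mat_monoid_mult_index finsum_closed Pi_def cong: finsum_cong)
qed auto

lemma mat_mult_col_assoc:
  assumes "b \<in> vecs R n" "A \<in> carrier (mat_monoid R n)" "B \<in> carrier (mat_monoid R n)"
  shows "mat_mult_col R n A (mat_mult_col R n B b) = mat_mult_col R n (A \<otimes>\<^bsub>mat_monoid R n\<^esub> B) b"
proof (rule eq_vecI)
  fix i assume "i < dim_vec (mat_mult_col R n (A \<otimes>\<^bsub>mat_monoid R n\<^esub> B) b)"
  then show "mat_mult_col R n A (mat_mult_col R n B b) $ i = mat_mult_col R n (A \<otimes>\<^bsub>mat_monoid R n\<^esub> B) b $ i"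
    using assms finsum_mult_assoc[of "{..<n}" "{..<n}" "\<lambda>l. A $$ (i, l)" "\<lambda>k. b $ k" "\<lambda>l k. B $$ (l, k)"]
    by (simp add: vecs_iff mat_monoid_carrier_iff mat_monoid_mult_index finsum_closed Pi_def cong: finsum_cong)
qed auto

lemma row_mult_col_assoc:
  assumes "a \<in> vecs R n" "b \<in> vecs R n" "A \<in> carrier (mat_monoid R n)"
  shows "row_mult_col R n (row_mult_mat R n a A) b = row_mult_col R n a (mat_mult_col R n A b)"
  using assms finsum_mult_assoc[of "{..<n}" "{..<n}" "\<lambda>l. a $ l" "\<lambda>k. b $ k" "\<lambda>l k. A $$ (l, k)"]
  by (simp add: row_mult_col_def vecs_iff mat_monoid_carrier_iff finsum_closed Pi_def cong: finsum_cong)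

end

text \<open>Expanding the product chooses one summand from each factor. Extensional functions keep
  the set of choices finite and make the extension \<open>g(a := k)\<close> of a choice on
  \<open>I\<close> to \<open>insert a I\<close> injective.\<close>

lemma (in cring) finprod_finsum_PiE:
  assumes "finite I" "finite S" "\<And>i k. i \<in> I \<Longrightarrow> k \<in> S \<Longrightarrow> f i k \<in> carrier R"
  shows "(\<Otimes>i\<in>I. \<Oplus>k\<in>S. f i k) = (\<Oplus>g\<in>I \<rightarrow>\<^sub>E S. \<Otimes>i\<in>I. f i (g i))"
  using assms(1,3)
proof (induction I rule: finite_induct)
  case empty
  show ?case by simp
next
  case (insert a I)
  let ?h = "\<lambda>(k, g). g(a := k)"
  have cl: "(\<Otimes>i\<in>I. f i (g i)) \<in> carrier R" if "g \<in> I \<rightarrow>\<^sub>E S" for g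
    using insert.prems that by (intro finprod_closed) (auto simp: PiE_iff)
  have cl2: "(\<Oplus>k\<in>S. f i k) \<in> carrier R" if "i \<in> insert a I" for i
    using insert.prems that by (intro finsum_closed) auto
  have inj: "inj_on ?h (S \<times> (I \<rightarrow>\<^sub>E S))"
  proof (rule inj_onI)
    fix p p' assume p: "p \<in> S \<times> (I \<rightarrow>\<^sub>E S)" "p' \<in> S \<times> (I \<rightarrow>\<^sub>E S)" and eq: "?h p = ?h p'"
    obtain k g k' g' where kg: "p = (k, g)" "p' = (k', g')" by (metis surj_pair)
    have gI: "g \<in> I \<rightarrow>\<^sub>E S" "g' \<in> I \<rightarrow>\<^sub>E S" using p kg by auto
    have eq': "(g(a := k)) x = (g'(a := k')) x" for x using eq unfolding kg by simp
    have "g x = g' x" for x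
    proof (cases "x = a")
      case True
      then show ?thesis using PiE_arb[OF gI(1) insert.hyps(2)] PiE_arb[OF gI(2) insert.hyps(2)] by simp
    next
      case False
      then show ?thesis using eq'[of x] by simp
    qed
    moreover have "k = k'" using eq'[of a] by simp
    ultimately show "p = p'" using kg by blast
  qed
  have im: "?h ` (S \<times> (I \<rightarrow>\<^sub>E S)) = insert a I \<rightarrow>\<^sub>E S"
    unfolding PiE_insert_eq[of a I "\<lambda>_. S"] ..
  have "(\<Otimes>i\<in>insert a I. \<Oplus>k\<in>S. f i k) = (\<Oplus>k\<in>S. f a k) \<otimes> (\<Oplus>g\<in>I \<rightarrow>\<^sub>E S. \<Otimes>i\<in>I. f i (g i))"
    using insert cl2 by (simp add: Pi_def)
  also have "\<dots> = (\<Oplus>k\<in>S. \<Oplus>g\<in>I \<rightarrow>\<^sub>E S. f a k \<otimes> (\<Otimes>i\<in>I. f i (g i)))"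
  proof -
    have "(\<Oplus>k\<in>S. f a k) \<otimes> (\<Oplus>g\<in>I \<rightarrow>\<^sub>E S. \<Otimes>i\<in>I. f i (g i)) =
        (\<Oplus>k\<in>S. f a k \<otimes> (\<Oplus>g\<in>I \<rightarrow>\<^sub>E S. \<Otimes>i\<in>I. f i (g i)))"
      by (rule finsum_ldistr) (use insert.prems assms(2) cl in \<open>auto intro!: finsum_closed\<close>)
    also have "\<dots> = (\<Oplus>k\<in>S. \<Oplus>g\<in>I \<rightarrow>\<^sub>E S. f a k \<otimes> (\<Otimes>i\<in>I. f i (g i)))"
    proof (intro finsum_cong' refl)
      fix k assume "k \<in> S"
      then show "f a k \<otimes> (\<Oplus>g\<in>I \<rightarrow>\<^sub>E S. \<Otimes>i\<in>I. f i (g i)) = (\<Oplus>g\<in>I \<rightarrow>\<^sub>E S. f a k \<otimes> (\<Otimes>i\<in>I. f i (g i)))"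
        by (intro finsum_rdistr finite_PiE) (use insert.hyps insert.prems assms(2) cl in auto)
    qed (use insert.prems cl in \<open>auto intro!: finsum_closed\<close>)
    finally show ?thesis .
  qed
  also have "\<dots> = (\<Oplus>p\<in>S \<times> (I \<rightarrow>\<^sub>E S). f a (fst p) \<otimes> (\<Otimes>i\<in>I. f i (snd p i)))"
    by (rule finsum_Times) (use insert.hyps insert.prems assms(2) cl in \<open>auto intro!: finite_PiE\<close>)
  also have "\<dots> = (\<Oplus>p\<in>S \<times> (I \<rightarrow>\<^sub>E S). \<Otimes>i\<in>insert a I. f i (?h p i))"
  proof (intro finsum_cong' refl)
    fix p assume p: "p \<in> S \<times> (I \<rightarrow>\<^sub>E S)"
    obtain k g where kg: "p = (k, g)" "k \<in> S" "g \<in> I \<rightarrow>\<^sub>E S" using p by auto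
    have "(\<Otimes>i\<in>I. f i ((g(a := k)) i)) = (\<Otimes>i\<in>I. f i (g i))"
      using insert kg by (intro finprod_cong') (auto simp: PiE_iff)
    moreover have "(\<lambda>i. f i ((g(a := k)) i)) \<in> I \<rightarrow> carrier R" using insert kg by (auto simp: PiE_iff)
    ultimately show "f a (fst p) \<otimes> (\<Otimes>i\<in>I. f i (snd p i)) = (\<Otimes>i\<in>insert a I. f i (?h p i))"
      using insert kg by simp
  qed (use insert in \<open>auto simp: PiE_iff intro!: finprod_closed\<close>)
  also have "\<dots> = (\<Oplus>g\<in>?h ` (S \<times> (I \<rightarrow>\<^sub>E S)). \<Otimes>i\<in>insert a I. f i (g i))"
    using inj insert by (subst finsum_reindex) (auto simp: PiE_iff intro!: finprod_closed)
  finally show ?case unfolding im .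
qed

section \<open>Determinants\<close>

definition perm_sign :: "('a, 'm) ring_scheme \<Rightarrow> (nat \<Rightarrow> nat) \<Rightarrow> 'a" where
  "perm_sign R p = (if evenperm p then \<one>\<^bsub>R\<^esub> else \<ominus>\<^bsub>R\<^esub> \<one>\<^bsub>R\<^esub>)"

lemma determinant_perm_sign:
  "determinant R n A = (\<Oplus>\<^bsub>R\<^esub>p\<in>{p. p permutes {..<n}}. perm_sign R p \<otimes>\<^bsub>R\<^esub> (\<Otimes>\<^bsub>R\<^esub>i\<in>{..<n}. A $$ (i, p i)))"
  by (simp add: determinant_def perm_sign_def)

context cring
begin

lemma perm_sign_closed [simp]: "perm_sign R p \<in> carrier R"
  by (simp add: perm_sign_def)

lemma perm_sign_comp:
  assumes "p permutes {..<n}" "q permutes {..<n}"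
  shows "perm_sign R (p \<circ> q) = perm_sign R p \<otimes> perm_sign R q"
proof -
  have "permutation p" "permutation q" using assms by (auto intro: permutes_imp_permutation[of "{..<n}"])
  then show ?thesis by (auto simp: perm_sign_def evenperm_comp l_minus r_minus)
qed

lemma permutes_lessThan [simp]: "p permutes {..<n} \<Longrightarrow> i < n \<Longrightarrow> p i < (n::nat)"
  using permutes_in_image[of p "{..<n}" i] by simp

lemma finite_perms [simp]: "finite {p. p permutes {..<n::nat}}"
  by (simp add: finite_permutations)

text \<open>This is the determinant of a matrix with two equal rows. Composition with the
  transposition of \<open>a\<close> and \<open>b\<close> keeps the product, flips the sign, and
  matches even with odd permutations. The two halves are cancelled termwise because in
  characteristic 2 it would prove nothing that the sum is its own negative.\<close>

lemma leibniz_zero: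
  fixes g :: "nat \<Rightarrow> nat"
  assumes B: "\<And>i j. i < n \<Longrightarrow> j < n \<Longrightarrow> B i j \<in> carrier R"
    and g: "\<And>i. i < n \<Longrightarrow> g i < n" and ab: "a < n" "b < n" "a \<noteq> b" "g a = g b"
  shows "(\<Oplus>p\<in>{p. p permutes {..<n}}. perm_sign R p \<otimes> (\<Otimes>i\<in>{..<n}. B (g i) (p i))) = \<zero>"
proof -
  let ?P = "{p. p permutes {..<n}}"
  let ?t = "transpose a b"
  define h where "h p = perm_sign R p \<otimes> (\<Otimes>i\<in>{..<n}. B (g i) (p i))" for p
  have t: "?t permutes {..<n}" using ab by (intro permutes_swap_id) auto
  have hc: "h p \<in> carrier R" if "p \<in> ?P" for p
    unfolding h_def using that B g by (intro m_closed finprod_closed) auto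
  have neg: "h (p \<circ> ?t) = \<ominus> h p" if p: "p \<in> ?P" for p
  proof -
    have gt: "g (?t i) = g i" for i using ab(4) by (auto simp: transpose_def)
    have "(\<Otimes>i\<in>{..<n}. B (g i) (p i)) = (\<Otimes>i\<in>?t ` {..<n}. B (g i) (p i))"
      by (simp only: permutes_image[OF t])
    also have "\<dots> = (\<Otimes>i\<in>{..<n}. B (g (?t i)) (p (?t i)))"
      using p B g t permutes_inj_on[OF t] by (intro finprod_reindex) (auto simp: permutes_image[OF t])
    finally have "(\<Otimes>i\<in>{..<n}. B (g i) ((p \<circ> ?t) i)) = (\<Otimes>i\<in>{..<n}. B (g i) (p i))"
      by (simp add: gt)
    moreover have "perm_sign R (p \<circ> ?t) = \<ominus> perm_sign R p"
      using p t ab(3) perm_sign_comp[of p n ?t] by (simp add: perm_sign_def[of R ?t] evenperm_swap r_minus)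
    moreover have "(\<Otimes>i\<in>{..<n}. B (g i) (p i)) \<in> carrier R"
      using p B g by (intro finprod_closed) auto
    ultimately show ?thesis by (simp add: h_def l_minus)
  qed
  let ?E = "{p \<in> ?P. evenperm p}" and ?O = "{p \<in> ?P. \<not> evenperm p}"
  have inj: "inj_on (\<lambda>p. p \<circ> ?t) ?E"
    by (rule inj_onI) (metis comp_assoc comp_id transpose_comp_involutory)
  have tt: "p \<circ> ?t \<circ> ?t = p" for p :: "nat \<Rightarrow> nat" by (simp add: comp_assoc)
  have ev: "evenperm (p \<circ> ?t) \<longleftrightarrow> \<not> evenperm p" if "p \<in> ?P" for p
    using that t ab(3) permutes_imp_permutation[of "{..<n}"] by (subst evenperm_comp) (auto simp: evenperm_swap)
  have im: "(\<lambda>p. p \<circ> ?t) ` ?E = ?O"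
  proof (intro equalityI subsetI)
    fix p assume "p \<in> (\<lambda>p. p \<circ> ?t) ` ?E"
    then show "p \<in> ?O" using ev permutes_compose[OF t] by auto
  next
    fix p assume "p \<in> ?O"
    then have "p = (p \<circ> ?t) \<circ> ?t" "p \<circ> ?t \<in> ?E" using ev[of p] permutes_compose[OF t] by (auto simp: tt)
    then show "p \<in> (\<lambda>p. p \<circ> ?t) ` ?E" by blast
  qed
  have "(\<Oplus>p\<in>?O. h p) = (\<Oplus>p\<in>(\<lambda>p. p \<circ> ?t) ` ?E. h p)" by (simp only: im)
  also have "\<dots> = (\<Oplus>p\<in>?E. h (p \<circ> ?t))"
    by (rule finsum_reindex) (use inj im hc in auto)
  also have "\<dots> = (\<Oplus>p\<in>?E. \<ominus> h p)" using neg hc by (intro finsum_cong') auto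
  finally have "(\<Oplus>p\<in>?E. h p) \<oplus> (\<Oplus>p\<in>?O. h p) = (\<Oplus>p\<in>?E. h p \<oplus> \<ominus> h p)"
    using hc by (subst finsum_addf) auto
  also have "\<dots> = (\<Oplus>p\<in>?E. \<zero>)" using hc by (intro finsum_cong') (auto simp: r_neg)
  also have "\<dots> = \<zero>" by (simp add: finsum_zero)
  also have "(\<Oplus>p\<in>?E. h p) \<oplus> (\<Oplus>p\<in>?O. h p) = (\<Oplus>p\<in>?E \<union> ?O. h p)"
    using hc by (intro finsum_Un_disjoint[symmetric]) auto
  also have "?E \<union> ?O = ?P" by blast
  finally show ?thesis by (simp add: h_def)
qed

text \<open>Reindexing the permutations by composition with \<open>q\<close> restores the order of
  the rows at the cost of the sign of \<open>q\<close>.\<close>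

lemma leibniz_permuted_rows:
  assumes B: "\<And>i j. i < n \<Longrightarrow> j < n \<Longrightarrow> B i j \<in> carrier R" and q: "q permutes {..<n}"
  shows "(\<Oplus>p\<in>{p. p permutes {..<n}}. perm_sign R p \<otimes> (\<Otimes>i\<in>{..<n}. B (q i) (p i))) =
    perm_sign R q \<otimes> (\<Oplus>p\<in>{p. p permutes {..<n}}. perm_sign R p \<otimes> (\<Otimes>i\<in>{..<n}. B i (p i)))"
proof -
  let ?P = "{p. p permutes {..<n}}"
  define h where "h p = (\<Otimes>i\<in>{..<n}. B (q i) (p i))" for p
  define k where "k p = (\<Otimes>i\<in>{..<n}. B i (p i))" for p
  have hc: "h p \<in> carrier R" and kc: "k p \<in> carrier R" if "p \<in> ?P" for p
    unfolding h_def k_def using that B q by (auto intro!: finprod_closed)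
  have hk: "h (p \<circ> q) = k p" if p: "p \<in> ?P" for p
  proof -
    have "k p = (\<Otimes>i\<in>q ` {..<n}. B i (p i))" unfolding k_def by (simp only: permutes_image[OF q])
    also have "\<dots> = (\<Otimes>i\<in>{..<n}. B (q i) (p (q i)))"
      using p B q permutes_inj_on[OF q] by (intro finprod_reindex) (auto simp: permutes_image[OF q])
    finally show ?thesis by (simp add: h_def)
  qed
  have inj: "inj_on (\<lambda>p. p \<circ> q) ?P"
    by (rule inj_onI) (metis comp_assoc comp_id permutes_inv_o(1)[OF q])
  have im: "(\<lambda>p. p \<circ> q) ` ?P = ?P"
  proof (rule endo_inj_surj)
    show "(\<lambda>p. p \<circ> q) ` ?P \<subseteq> ?P" using permutes_compose[OF q] by auto
  qed (use inj in auto)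
  have "(\<Oplus>p\<in>?P. perm_sign R p \<otimes> h p) = (\<Oplus>p\<in>(\<lambda>p. p \<circ> q) ` ?P. perm_sign R p \<otimes> h p)" by (simp only: im)
  also have "\<dots> = (\<Oplus>p\<in>?P. perm_sign R (p \<circ> q) \<otimes> h (p \<circ> q))"
    using inj hc im by (intro finsum_reindex) auto
  also have "\<dots> = (\<Oplus>p\<in>?P. perm_sign R q \<otimes> (perm_sign R p \<otimes> k p))"
    using kc hk perm_sign_comp[OF _ q] by (intro finsum_cong') (auto simp: m_ac)
  also have "\<dots> = perm_sign R q \<otimes> (\<Oplus>p\<in>?P. perm_sign R p \<otimes> k p)"
    using kc by (intro finsum_rdistr[symmetric]) auto
  finally show ?thesis unfolding h_def k_def .
qed

lemma determinant_closed:
  "A \<in> carrier (mat_monoid R n) \<Longrightarrow> determinant R n A \<in> carrier R"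
  unfolding determinant_perm_sign mat_monoid_carrier_iff
  by (intro finsum_closed) (auto intro!: m_closed finprod_closed)

text \<open>The rows of the product are combinations of rows of \<open>B\<close>, so the determinant
  expands into a sum over functions \<open>g\<close> choosing a row of \<open>B\<close> for each row
  of \<open>A\<close>. Choices with a repeated row cancel; the others are permutations, each
  contributing its sign times the determinant of \<open>B\<close>.\<close>

lemma determinant_mult:
  assumes A: "A \<in> carrier (mat_monoid R n)" and B: "B \<in> carrier (mat_monoid R n)"
  shows "determinant R n (A \<otimes>\<^bsub>mat_monoid R n\<^esub> B) = determinant R n A \<otimes> determinant R n B"
proof -
  let ?P = "{p. p permutes {..<n}}" and ?I = "{..<n}"
  let ?G = "?I \<rightarrow>\<^sub>E ?I"
  have Ac: "A $$ (i, j) \<in> carrier R" and Bc: "B $$ (i, j) \<in> carrier R" if "i < n" "j < n" for i j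
    using A B that by (auto simp: mat_monoid_carrier_iff)
  define a where "a g = (\<Otimes>i\<in>?I. A $$ (i, g i))" for g
  define b where "b g p = (\<Otimes>i\<in>?I. B $$ (g i, p i))" for g p
  define s where "s g = (\<Oplus>p\<in>?P. perm_sign R p \<otimes> b g p)" for g
  have ac: "a g \<in> carrier R" if "\<And>i. i < n \<Longrightarrow> g i < n" for g
    unfolding a_def using that Ac by (intro finprod_closed) auto
  have bc: "b g p \<in> carrier R" if "\<And>i. i < n \<Longrightarrow> g i < n" "p \<in> ?P" for g p
    unfolding b_def using that Bc by (intro finprod_closed) auto
  have sc: "s g \<in> carrier R" if "\<And>i. i < n \<Longrightarrow> g i < n" for g
    unfolding s_def using that bc by (intro finsum_closed) auto
  have Gn: "g i < n" if "g \<in> ?G" "i < n" for g i using that by (auto simp: PiE_iff)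
  have expand: "perm_sign R p \<otimes> (\<Otimes>i\<in>?I. (A \<otimes>\<^bsub>mat_monoid R n\<^esub> B) $$ (i, p i)) =
      (\<Oplus>g\<in>?G. a g \<otimes> (perm_sign R p \<otimes> b g p))" if p: "p \<in> ?P" for p
  proof -
    have "(\<Otimes>i\<in>?I. (A \<otimes>\<^bsub>mat_monoid R n\<^esub> B) $$ (i, p i)) =
        (\<Otimes>i\<in>?I. \<Oplus>k\<in>?I. A $$ (i, k) \<otimes> B $$ (k, p i))"
      using p Ac Bc by (intro finprod_cong') (auto simp: mat_monoid_mult_index intro!: finsum_closed)
    also have "\<dots> = (\<Oplus>g\<in>?G. \<Otimes>i\<in>?I. A $$ (i, g i) \<otimes> B $$ (g i, p i))"
      using p Ac Bc by (intro finprod_finsum_PiE) auto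
    also have "\<dots> = (\<Oplus>g\<in>?G. a g \<otimes> b g p)"
      using p Ac Bc Gn ac bc unfolding a_def b_def by (intro finsum_cong') (auto simp: finprod_multf Pi_def)
    finally have "perm_sign R p \<otimes> (\<Otimes>i\<in>?I. (A \<otimes>\<^bsub>mat_monoid R n\<^esub> B) $$ (i, p i)) = 
      perm_sign R p \<otimes> (\<Oplus>g\<in>?G. a g \<otimes> b g p)" by simp
    also have "\<dots> = (\<Oplus>g\<in>?G. perm_sign R p \<otimes> (a g \<otimes> b g p))"
      using p Gn ac bc by (intro finsum_rdistr finite_PiE) auto
    also have "\<dots> = (\<Oplus>g\<in>?G. a g \<otimes> (perm_sign R p \<otimes> b g p))"
      using p Gn ac bc by (intro finsum_cong') (auto simp: m_ac)
    finally show ?thesis .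
  qed
  have "determinant R n (A \<otimes>\<^bsub>mat_monoid R n\<^esub> B) = (\<Oplus>p\<in>?P. \<Oplus>g\<in>?G. a g \<otimes> (perm_sign R p \<otimes> b g p))"
    unfolding determinant_perm_sign using Gn ac bc by (intro finsum_cong') (auto simp: expand intro!: finsum_closed)
  also have "\<dots> = (\<Oplus>g\<in>?G. \<Oplus>p\<in>?P. a g \<otimes> (perm_sign R p \<otimes> b g p))"
    using Gn ac bc by (intro finsum_swap finite_PiE) auto
  also have "\<dots> = (\<Oplus>g\<in>?G. a g \<otimes> s g)"
    unfolding s_def using Gn ac bc by (intro finsum_cong' finsum_rdistr[symmetric]) (auto intro!: finsum_closed)
  \<comment> \<open>Choice functions are \<open>undefined\<close> outside the index range, whereas
    permutations are the identity there, so the two are matched by restriction.\<close>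
  also have "\<dots> = (\<Oplus>g\<in>(\<lambda>p. restrict p ?I) ` ?P. a g \<otimes> s g)"
  proof (rule add.finprod_mono_neutral_cong_right)
    show "(\<lambda>p. restrict p ?I) ` ?P \<subseteq> ?G" by (auto simp: PiE_iff split: if_splits)
    show "a g \<otimes> s g = \<zero>" if g: "g \<in> ?G - (\<lambda>p. restrict p ?I) ` ?P" for g
    proof -
      have "\<not> inj_on g ?I"
      proof
        assume inj: "inj_on g ?I"
        let ?p = "\<lambda>i. if i < n then g i else i"
        have "g ` ?I \<subseteq> ?I" using g by auto
        then have "g ` ?I = ?I" using inj by (intro endo_inj_surj) auto
        then have "bij_betw ?p ?I ?I" using inj by (simp add: bij_betw_def inj_on_def image_def)
        then have "?p permutes ?I" by (rule bij_imp_permutes) auto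
        moreover have "g = restrict ?p ?I" using g by (auto simp: PiE_iff extensional_def restrict_def)
        ultimately show False using g by blast
      qed
      then obtain i j where ij: "i < n" "j < n" "i \<noteq> j" "g i = g j" by (auto simp: inj_on_def)
      have "s g = \<zero>" unfolding s_def b_def using ij g Gn Bc by (intro leibniz_zero[of n "\<lambda>i j. B $$ (i, j)" g i j]) auto
      then show ?thesis using ac g Gn by simp
    qed
  qed (use ac sc Gn in \<open>auto intro!: finite_PiE\<close>)
  also have "\<dots> = (\<Oplus>p\<in>?P. a (restrict p ?I) \<otimes> s (restrict p ?I))"
  proof (rule finsum_reindex)
    show "inj_on (\<lambda>p. restrict p ?I) ?P"
    proof (rule inj_onI)
      fix p p' assume p: "p \<in> ?P" "p' \<in> ?P" "restrict p ?I = restrict p' ?I"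
      show "p = p'"
      proof
        fix i show "p i = p' i" using fun_cong[OF p(3), of i] p(1,2) by (cases "i < n") (auto simp: permutes_def)
      qed
    qed
  qed (use ac sc in auto)
  also have "\<dots> = (\<Oplus>p\<in>?P. (perm_sign R p \<otimes> a p) \<otimes> determinant R n B)"
  proof (intro finsum_cong' refl)
    fix p assume p: "p \<in> ?P"
    have "a (restrict p ?I) = a p" unfolding a_def using p Ac by (intro finprod_cong') auto
    moreover have "s (restrict p ?I) = s p"
      unfolding s_def b_def using p Bc by (intro finsum_cong' arg_cong2[where f = "(\<otimes>)"] finprod_cong') (auto intro!: m_closed finprod_closed)
    moreover have "s p = perm_sign R p \<otimes> determinant R n B"
      unfolding s_def b_def determinant_perm_sign using p Bc
      by (intro leibniz_permuted_rows[of n "\<lambda>i j. B $$ (i, j)"]) auto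
    ultimately show "a (restrict p ?I) \<otimes> s (restrict p ?I) = (perm_sign R p \<otimes> a p) \<otimes> determinant R n B"
      using p ac determinant_closed[OF B] by (simp add: m_ac)
  qed (use ac determinant_closed[OF B] in auto)
  also have "\<dots> = (\<Oplus>p\<in>?P. perm_sign R p \<otimes> a p) \<otimes> determinant R n B"
    using ac determinant_closed[OF B] by (intro finsum_ldistr[symmetric]) auto
  finally show ?thesis unfolding a_def determinant_perm_sign[of R n A] .
qed

lemma determinant_diagonal:
  assumes D: "D \<in> carrier (mat_monoid R n)"
    and diag: "\<forall>i<n. \<forall>j<n. i \<noteq> j \<longrightarrow> D $$ (i, j) = \<zero>"
  shows "determinant R n D = (\<Otimes>i\<in>{..<n}. D $$ (i, i))"
proof -
  have Dc: "D $$ (i, j) \<in> carrier R" if "i < n" "j < n" for i j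
    using D that by (auto simp: mat_monoid_carrier_iff)
  have z: "(\<Otimes>i\<in>{..<n}. D $$ (i, p i)) = \<zero>" if p: "p permutes {..<n}" "p \<noteq> id" for p
  proof -
    obtain i where i: "i < n" "p i \<noteq> i"
      using p by (metis id_apply lessThan_iff permutes_def ext)
    have "{..<n} = insert i ({..<n} - {i})" using i by auto
    then have "(\<Otimes>i\<in>{..<n}. D $$ (i, p i)) = (\<Otimes>i\<in>insert i ({..<n} - {i}). D $$ (i, p i))" by simp
    also have "\<dots> = D $$ (i, p i) \<otimes> (\<Otimes>i\<in>{..<n} - {i}. D $$ (i, p i))"
      using p i Dc by (intro finprod_insert) auto
    also have "D $$ (i, p i) = \<zero>" using diag i p by auto
    finally show ?thesis using p Dc by (simp add: finprod_closed Pi_def)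
  qed
  have idP: "id \<in> {p. p permutes {..<n}}" by (simp add: permutes_id)
  have "determinant R n D = (\<Oplus>p\<in>{p. p permutes {..<n}}. if id = p then (\<Otimes>i\<in>{..<n}. D $$ (i, i)) else \<zero>)"
    unfolding determinant_perm_sign
    using z Dc by (intro finsum_cong') (auto simp: perm_sign_def finprod_closed Pi_def)
  also have "\<dots> = (\<Otimes>i\<in>{..<n}. D $$ (i, i))"
    using idP Dc by (intro finsum_singleton) (auto intro!: finprod_closed)
  finally show ?thesis .
qed

end

section \<open>Diagonalisable matrices and cyclic vectors\<close>

lemma nat_pow_GL: "A [^]\<^bsub>GL R n\<^esub> (k::nat) = A [^]\<^bsub>mat_monoid R n\<^esub> k"
  by (simp add: nat_pow_def GL_def units_of_def)

lemma carrier_GL: "carrier (GL R n) = Units (mat_monoid R n)"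
  by (simp add: GL_def units_of_def)

lemma one_GL: "\<one>\<^bsub>GL R n\<^esub> = \<one>\<^bsub>mat_monoid R n\<^esub>"
  by (simp add: GL_def units_of_def)

lemma (in cring) group_GL: "group (GL R n)"
  unfolding GL_def by (rule monoid.units_group[OF monoid_mat_monoid])

lemma mat_monoid_eqI:
  assumes "A \<in> carrier (mat_monoid R n)" "B \<in> carrier (mat_monoid R n)"
    "\<And>i j. i < n \<Longrightarrow> j < n \<Longrightarrow> A $$ (i, j) = B $$ (i, j)"
  shows "A = B"
proof -
  have "A \<in> carrier_mat n n" "B \<in> carrier_mat n n"
    using assms(1,2) unfolding mat_monoid_carrier_iff by blast+
  note d = this[THEN carrier_matD(1)] this[THEN carrier_matD(2)]
  show ?thesis by (rule eq_matI) (simp_all only: d assms(3))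
qed

lemma finite_mat_monoid:
  assumes "finite (carrier R)"
  shows "finite (carrier (mat_monoid R n))"
proof (rule finite_subset)
  show "carrier (mat_monoid R n) \<subseteq> (\<lambda>f. mat n n f) ` (({..<n} \<times> {..<n}) \<rightarrow>\<^sub>E carrier R)"
  proof
    fix A assume A: "A \<in> carrier (mat_monoid R n)"
    let ?f = "\<lambda>p\<in>{..<n} \<times> {..<n}. A $$ p"
    have "A \<in> carrier_mat n n" using A unfolding mat_monoid_carrier_iff by blast
    note d = this[THEN carrier_matD(1)] this[THEN carrier_matD(2)]
    have "A = mat n n ?f" by (rule eq_matI) (simp_all add: d)
    moreover have "?f \<in> ({..<n} \<times> {..<n}) \<rightarrow>\<^sub>E carrier R"
      unfolding restrict_PiE_iff using A by (simp add: mat_monoid_carrier_iff)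
    ultimately show "A \<in> (\<lambda>f. mat n n f) ` (({..<n} \<times> {..<n}) \<rightarrow>\<^sub>E carrier R)" by (rule image_eqI)
  qed
  show "finite ((\<lambda>f. mat n n f) ` (({..<n} \<times> {..<n}) \<rightarrow>\<^sub>E carrier R))"
    by (intro finite_imageI finite_PiE) (use assms in simp_all)
qed

lemma card_vecs:
  assumes "finite (carrier R)"
  shows "finite (vecs R n)" "card (vecs R n) = card (carrier R) ^ n"
proof -
  have b: "bij_betw (\<lambda>f. vec n f) ({..<n} \<rightarrow>\<^sub>E carrier R) (vecs R n)"
  proof (rule bij_betwI[where g = "\<lambda>v. \<lambda>i\<in>{..<n}. v $ i"])
    show "(\<lambda>f. vec n f) \<in> ({..<n} \<rightarrow>\<^sub>E carrier R) \<rightarrow> vecs R n"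
      by (simp add: Pi_iff vecs_iff PiE_iff)
    show "(\<lambda>v. \<lambda>i\<in>{..<n}. v $ i) \<in> vecs R n \<rightarrow> ({..<n} \<rightarrow>\<^sub>E carrier R)"
      unfolding Pi_iff restrict_PiE_iff by (simp add: vecs_iff)
    show "(\<lambda>i\<in>{..<n}. vec n f $ i) = f" if "f \<in> {..<n} \<rightarrow>\<^sub>E carrier R" for f
    proof
      fix i show "(\<lambda>i\<in>{..<n}. vec n f $ i) i = f i"
        using that by (cases "i < n") (simp_all add: PiE_arb[OF that])
    qed
    show "vec n (\<lambda>i\<in>{..<n}. v $ i) = v" if "v \<in> vecs R n" for v
      by (rule eq_vecI) (use that in \<open>simp_all add: vecs_iff\<close>)
  qed
  have "finite ({..<n} \<rightarrow>\<^sub>E carrier R)" using assms by (intro finite_PiE) simp_all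
  then show "finite (vecs R n)" using bij_betw_finite[OF b] by simp
  show "card (vecs R n) = card (carrier R) ^ n"
    using bij_betw_same_card[OF b] by (simp add: card_PiE)
qed

text \<open>The \<open>LEAST\<close> has a meaning only if some positive power is the unit. In a
  finite group one exists, and the value is then \<open>ord\<close>, whose divisibility property
  carries over.\<close>

lemma mult_order_group:
  assumes "group G" "finite (carrier G)" "x \<in> carrier G"
  shows "0 < mult_order G x" "\<And>k::nat. x [^]\<^bsub>G\<^esub> k = \<one>\<^bsub>G\<^esub> \<longleftrightarrow> mult_order G x dvd k"
proof -
  interpret group G by fact
  have o: "1 \<le> ord x" by (rule ord_ge_1[OF assms(2,3)])
  have "mult_order G x = ord x"
    unfolding mult_order_def pow_eq_id[OF assms(3)]
  proof (rule Least_equality)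
    show "1 \<le> ord x \<and> ord x dvd ord x" using o by simp
    show "ord x \<le> k" if "1 \<le> k \<and> ord x dvd k" for k using that by (simp add: dvd_imp_le)
  qed
  then show "0 < mult_order G x" "\<And>k::nat. x [^]\<^bsub>G\<^esub> k = \<one>\<^bsub>G\<^esub> \<longleftrightarrow> mult_order G x dvd k"
    using o pow_eq_id[OF assms(3)] by simp_all
qed

lemma mult_order_units_of: "mult_order (units_of R) x = mult_order R x"
  by (simp add: mult_order_def nat_pow_def units_of_def)

text \<open>Intended for the order of the determinant, which is taken in the multiplicative monoid
  of a ring. Powers of a unit are the same there and in the group of units.\<close>

lemma (in monoid) mult_order_unit:
  assumes "finite (carrier G)" "x \<in> Units G"
  shows "0 < mult_order G x" "x [^] mult_order G x = \<one>"
proof -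
  have "finite (carrier (units_of G))"
    using assms(1) Units_closed by (auto simp: units_of_carrier intro: finite_subset)
  note * = mult_order_group[OF units_group this, of x]
  show "0 < mult_order G x" using *(1) assms(2) by (simp add: units_of_carrier mult_order_units_of)
  have "x [^]\<^bsub>units_of G\<^esub> mult_order G x = \<one>\<^bsub>units_of G\<^esub>"
    using *(2)[of "mult_order G x"] assms(2) by (simp add: units_of_carrier mult_order_units_of)
  then show "x [^] mult_order G x = \<one>" by (simp add: nat_pow_def units_of_def)
qed

context cring
begin

lemma mat_pow_closed:
  "A \<in> carrier (mat_monoid R n) \<Longrightarrow> A [^]\<^bsub>mat_monoid R n\<^esub> (k::nat) \<in> carrier (mat_monoid R n)"
  by (rule monoid.nat_pow_closed[OF monoid_mat_monoid])

lemma determinant_one: "determinant R n \<one>\<^bsub>mat_monoid R n\<^esub> = \<one>"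
proof -
  have "determinant R n \<one>\<^bsub>mat_monoid R n\<^esub> = (\<Otimes>i\<in>{..<n}. \<one>\<^bsub>mat_monoid R n\<^esub> $$ (i, i))"
    by (rule determinant_diagonal[OF monoid.one_closed[OF monoid_mat_monoid]]) (simp add: mat_monoid_one_index)
  also have "\<dots> = \<one>" by (rule finprod_one_eqI) (simp add: mat_monoid_one_index)
  finally show ?thesis .
qed

lemma determinant_Units:
  assumes "A \<in> Units (mat_monoid R n)"
  shows "determinant R n A \<in> Units R"
proof -
  interpret M: monoid "mat_monoid R n" by (rule monoid_mat_monoid)
  have A: "A \<in> carrier (mat_monoid R n)" "inv\<^bsub>mat_monoid R n\<^esub> A \<in> carrier (mat_monoid R n)" 
    using M.Units_closed[OF assms] M.Units_inv_closed[OF assms] by simp_all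
  have "determinant R n A \<otimes> determinant R n (inv\<^bsub>mat_monoid R n\<^esub> A) = \<one>"
    using determinant_mult[OF A] assms by (simp add: determinant_one)
  then show ?thesis
    using determinant_closed[OF A(1)] determinant_closed[OF A(2)] unfolding Units_def
    by (intro CollectI conjI bexI[of _ "determinant R n (inv\<^bsub>mat_monoid R n\<^esub> A)"]) (simp_all add: m_comm)
qed

lemma diagonal_pow:
  assumes D: "D \<in> carrier (mat_monoid R n)" and diag: "\<forall>i<n. \<forall>j<n. i \<noteq> j \<longrightarrow> D $$ (i, j) = \<zero>"
  shows "i < n \<Longrightarrow> j < n \<Longrightarrow>
    (D [^]\<^bsub>mat_monoid R n\<^esub> (x::nat)) $$ (i, j) = (if i = j then D $$ (i, i) [^] x else \<zero>)"
proof (induction x arbitrary: i j)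
  case 0
  then show ?case using monoid.nat_pow_0[OF monoid_mat_monoid] by (simp add: mat_monoid_one_index)
next
  case (Suc x)
  have Dc: "D $$ (k, j) \<in> carrier R" if "k < n" "j < n" for k j using D that by (simp add: mat_monoid_carrier_iff)
  have "(D [^]\<^bsub>mat_monoid R n\<^esub> Suc x) $$ (i, j) = (\<Oplus>k\<in>{..<n}. (D [^]\<^bsub>mat_monoid R n\<^esub> x) $$ (i, k) \<otimes> D $$ (k, j))"
    using Suc.prems by (simp add: mat_monoid_mult_index nat_pow_def)
  also have "\<dots> = (\<Oplus>k\<in>{..<n}. if i = k then D $$ (i, i) [^] x \<otimes> D $$ (i, j) else \<zero>)"
    using Suc.IH Suc.prems Dc by (intro finsum_cong') simp_all
  also have "\<dots> = D $$ (i, i) [^] x \<otimes> D $$ (i, j)"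
    using Suc.prems Dc by (intro finsum_singleton) simp_all
  finally show ?case using diag Suc.prems Dc by simp
qed

end

text \<open>Meant for the image of the given matrix over the algebraic closure. The columns of
  \<open>P\<close> are eigenvectors, which is how \<open>P\<close> is used below.\<close>

locale mat_diagonalisation = field R for R (structure) +
  fixes n :: nat and A P D :: "'a mat"
  assumes P: "P \<in> Units (mat_monoid R n)" and D: "D \<in> carrier (mat_monoid R n)"
    and diag: "\<forall>i<n. \<forall>j<n. i \<noteq> j \<longrightarrow> D $$ (i, j) = \<zero>"
    and A_eq: "A = P \<otimes>\<^bsub>mat_monoid R n\<^esub> D \<otimes>\<^bsub>mat_monoid R n\<^esub> inv\<^bsub>mat_monoid R n\<^esub> P"
begin

abbreviation "M \<equiv> mat_monoid R n"

definition eigenvalue :: "nat \<Rightarrow> 'a" where "eigenvalue i = D $$ (i, i)"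

sublocale M: monoid M by (rule monoid_mat_monoid)

lemma P_closed: "P \<in> carrier M" and A_closed: "A \<in> carrier M"
  using M.Units_closed[OF P] M.Units_inv_closed[OF P] D by (simp_all add: A_eq)

lemma eigenvalue_closed: "i < n \<Longrightarrow> eigenvalue i \<in> carrier R"
  using D by (simp add: eigenvalue_def mat_monoid_carrier_iff)

text \<open>Induction from A P = P D. Keeping \<open>P\<close> on both sides leaves no inverse in
  later entrywise computations.\<close>

lemma pow_mult_P: "A [^]\<^bsub>M\<^esub> (x::nat) \<otimes>\<^bsub>M\<^esub> P = P \<otimes>\<^bsub>M\<^esub> D [^]\<^bsub>M\<^esub> x"
proof (induction x)
  case 0
  show ?case using P_closed by simp
next
  case (Suc x)
  have AP: "A \<otimes>\<^bsub>M\<^esub> P = P \<otimes>\<^bsub>M\<^esub> D" using P D P_closed by (simp add: A_eq M.m_assoc)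
  have "A [^]\<^bsub>M\<^esub> Suc x \<otimes>\<^bsub>M\<^esub> P = A [^]\<^bsub>M\<^esub> x \<otimes>\<^bsub>M\<^esub> (P \<otimes>\<^bsub>M\<^esub> D)"
    using A_closed P_closed AP by (simp add: M.m_assoc)
  also have "\<dots> = (A [^]\<^bsub>M\<^esub> x \<otimes>\<^bsub>M\<^esub> P) \<otimes>\<^bsub>M\<^esub> D"
    using A_closed P_closed D by (simp add: M.m_assoc)
  also have "\<dots> = P \<otimes>\<^bsub>M\<^esub> D [^]\<^bsub>M\<^esub> Suc x"
    using Suc P_closed D by (simp add: M.m_assoc)
  finally show ?case .
qed

lemma pow_eq_one_iff: "A [^]\<^bsub>M\<^esub> (x::nat) = \<one>\<^bsub>M\<^esub> \<longleftrightarrow> (\<forall>i<n. eigenvalue i [^] x = \<one>)"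
proof -
  have Dx: "D [^]\<^bsub>M\<^esub> x = \<one>\<^bsub>M\<^esub> \<longleftrightarrow> (\<forall>i<n. eigenvalue i [^] x = \<one>)"
  proof
    assume "D [^]\<^bsub>M\<^esub> x = \<one>\<^bsub>M\<^esub>"
    then have "eigenvalue i [^] x = \<one>" if "i < n" for i
      using diagonal_pow[OF D diag that that, of x] that by (simp add: eigenvalue_def mat_monoid_one_index)
    then show "\<forall>i<n. eigenvalue i [^] x = \<one>" by simp
  next
    assume "\<forall>i<n. eigenvalue i [^] x = \<one>"
    then show "D [^]\<^bsub>M\<^esub> x = \<one>\<^bsub>M\<^esub>"
      using diagonal_pow[OF D diag, of _ _ x] D
      by (intro mat_monoid_eqI[of _ R n]) (simp_all add: eigenvalue_def mat_monoid_one_index)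
  qed
  have "A [^]\<^bsub>M\<^esub> x = \<one>\<^bsub>M\<^esub>" if "D [^]\<^bsub>M\<^esub> x = \<one>\<^bsub>M\<^esub>"
  proof -
    have "A [^]\<^bsub>M\<^esub> x \<otimes>\<^bsub>M\<^esub> P = P" using pow_mult_P[of x] that P_closed by simp
    then have "A [^]\<^bsub>M\<^esub> x \<otimes>\<^bsub>M\<^esub> P \<otimes>\<^bsub>M\<^esub> inv\<^bsub>M\<^esub> P = \<one>\<^bsub>M\<^esub>" using P by simp
    then show ?thesis using P P_closed A_closed by (simp add: M.m_assoc)
  qed
  moreover have "D [^]\<^bsub>M\<^esub> x = \<one>\<^bsub>M\<^esub>" if "A [^]\<^bsub>M\<^esub> x = \<one>\<^bsub>M\<^esub>"
  proof -
    have "P \<otimes>\<^bsub>M\<^esub> D [^]\<^bsub>M\<^esub> x = P" using pow_mult_P[of x] that P_closed by simp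
    then have "inv\<^bsub>M\<^esub> P \<otimes>\<^bsub>M\<^esub> (P \<otimes>\<^bsub>M\<^esub> D [^]\<^bsub>M\<^esub> x) = \<one>\<^bsub>M\<^esub>" using P by simp
    then show ?thesis using P P_closed D by (simp flip: M.m_assoc)
  qed
  ultimately show ?thesis using Dx by blast
qed

text \<open>Taking determinants in A P = P D leaves the determinant of \<open>P\<close> on both
  sides, a unit that commutes and cancels.\<close>

lemma determinant_eq: "determinant R n A = (\<Otimes>i\<in>{..<n}. eigenvalue i)"
proof -
  have "determinant R n A \<otimes> determinant R n P = determinant R n P \<otimes> determinant R n D"
    using pow_mult_P[of 1] A_closed P_closed D by (simp flip: determinant_mult)
  moreover have "determinant R n P \<in> Units R" by (rule determinant_Units[OF P])
  ultimately have "determinant R n A = determinant R n D"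
    using determinant_closed[OF A_closed] determinant_closed[OF D] determinant_closed[OF P_closed]
    by (simp add: m_comm[of "determinant R n A"] Units_l_cancel)
  then show ?thesis using determinant_diagonal[OF D diag] by (simp add: eigenvalue_def)
qed

text \<open>The matrix relation is applied to the eigenvector in column \<open>i\<close> of
  \<open>P\<close> and read off in a row \<open>j\<close> where that column is nonzero.\<close>

lemma eigenvalue_relation:
  fixes x1 x2 x3 x4 :: nat
  assumes rel: "\<And>j k. j < n \<Longrightarrow> k < n \<Longrightarrow>
      (A [^]\<^bsub>M\<^esub> x1) $$ (j, k) \<oplus> (A [^]\<^bsub>M\<^esub> x2) $$ (j, k) = (A [^]\<^bsub>M\<^esub> x3) $$ (j, k) \<oplus> (A [^]\<^bsub>M\<^esub> x4) $$ (j, k)"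
    and i: "i < n"
  shows "eigenvalue i [^] x1 \<oplus> eigenvalue i [^] x2 = eigenvalue i [^] x3 \<oplus> eigenvalue i [^] x4"
proof -
  let ?e = "eigenvalue i"
  have Pc: "P $$ (k, l) \<in> carrier R" and Pic: "(inv\<^bsub>M\<^esub> P) $$ (k, l) \<in> carrier R" if "k < n" "l < n" for k l
    using P_closed M.Units_inv_closed[OF P] that by (simp_all add: mat_monoid_carrier_iff)
  have Ac: "(A [^]\<^bsub>M\<^esub> x) $$ (k, l) \<in> carrier R" if "k < n" "l < n" for k l and x :: nat
    using mat_pow_closed[OF A_closed, of x] that by (simp add: mat_monoid_carrier_iff)
  have ec: "?e [^] x \<in> carrier R" for x :: nat using eigenvalue_closed[OF i] by simp
  \<comment> \<open>A zero column of \<open>P\<close> would put a zero on the diagonal of the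
    identity matrix.\<close>
  have "\<exists>j<n. P $$ (j, i) \<noteq> \<zero>"
  proof (rule ccontr)
    assume "\<not> ?thesis"
    then have z: "P $$ (j, i) = \<zero>" if "j < n" for j using that by simp
    have "\<one> = (inv\<^bsub>M\<^esub> P \<otimes>\<^bsub>M\<^esub> P) $$ (i, i)" using P i by (simp add: mat_monoid_one_index)
    also have "\<dots> = (\<Oplus>k\<in>{..<n}. (inv\<^bsub>M\<^esub> P) $$ (i, k) \<otimes> P $$ (k, i))" using i by (simp add: mat_monoid_mult_index)
    also have "\<dots> = (\<Oplus>k\<in>{..<n}. \<zero>)" using z Pic i by (intro finsum_cong') simp_all
    finally show False by (simp add: finsum_zero)
  qed
  then obtain j where j: "j < n" "P $$ (j, i) \<noteq> \<zero>" by (elim exE conjE)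
  have ev: "(\<Oplus>k\<in>{..<n}. (A [^]\<^bsub>M\<^esub> x) $$ (j, k) \<otimes> P $$ (k, i)) = P $$ (j, i) \<otimes> ?e [^] x" for x :: nat
  proof -
    have "(\<Oplus>k\<in>{..<n}. (A [^]\<^bsub>M\<^esub> x) $$ (j, k) \<otimes> P $$ (k, i)) = (P \<otimes>\<^bsub>M\<^esub> D [^]\<^bsub>M\<^esub> x) $$ (j, i)"
      using j i by (simp add: mat_monoid_mult_index flip: pow_mult_P)
    also have "\<dots> = (\<Oplus>k\<in>{..<n}. P $$ (j, k) \<otimes> (D [^]\<^bsub>M\<^esub> x) $$ (k, i))"
      using j i by (simp add: mat_monoid_mult_index)
    also have "\<dots> = (\<Oplus>k\<in>{..<n}. if i = k then P $$ (j, k) \<otimes> ?e [^] x else \<zero>)"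
      using diagonal_pow[OF D diag _ i, of _ x] Pc j ec
      by (intro finsum_cong') (simp_all add: eigenvalue_def Pi_def)
    also have "\<dots> = P $$ (j, i) \<otimes> ?e [^] x" using i Pc j ec by (intro finsum_singleton) simp_all
    finally show ?thesis .
  qed
  have sum2: "P $$ (j, i) \<otimes> (?e [^] x \<oplus> ?e [^] y) =
      (\<Oplus>k\<in>{..<n}. ((A [^]\<^bsub>M\<^esub> x) $$ (j, k) \<oplus> (A [^]\<^bsub>M\<^esub> y) $$ (j, k)) \<otimes> P $$ (k, i))" for x y :: nat
  proof -
    have "(\<Oplus>k\<in>{..<n}. ((A [^]\<^bsub>M\<^esub> x) $$ (j, k) \<oplus> (A [^]\<^bsub>M\<^esub> y) $$ (j, k)) \<otimes> P $$ (k, i)) =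
        (\<Oplus>k\<in>{..<n}. (A [^]\<^bsub>M\<^esub> x) $$ (j, k) \<otimes> P $$ (k, i) \<oplus> (A [^]\<^bsub>M\<^esub> y) $$ (j, k) \<otimes> P $$ (k, i))"
      using Ac Pc i j by (intro finsum_cong') (simp_all add: l_distr)
    also have "\<dots> = (\<Oplus>k\<in>{..<n}. (A [^]\<^bsub>M\<^esub> x) $$ (j, k) \<otimes> P $$ (k, i)) \<oplus> (\<Oplus>k\<in>{..<n}. (A [^]\<^bsub>M\<^esub> y) $$ (j, k) \<otimes> P $$ (k, i))"
      using Ac Pc i j by (intro finsum_addf) simp_all
    finally show ?thesis unfolding ev using Pc[OF j(1) i] ec by (simp add: r_distr)
  qed
  have "P $$ (j, i) \<otimes> (?e [^] x1 \<oplus> ?e [^] x2) = P $$ (j, i) \<otimes> (?e [^] x3 \<oplus> ?e [^] x4)"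
    unfolding sum2 using rel[OF j(1)] Ac Pc i j by (intro finsum_cong') simp_all
  then show ?thesis using j Pc[OF j(1) i] ec by (simp add: m_lcancel)
qed

end

text \<open>The given independent vectors span the whole space, because over a finite field the injective map
  sending coefficients to linear combinations is also surjective.\<close>
lemma (in field) orthogonal_to_independent:
  fixes n :: nat
  assumes fin: "finite (carrier R)" and v: "\<And>i. i < n \<Longrightarrow> v i \<in> vecs R n"
    and indep: "lin_indep_family R n n v"
    and m: "\<And>k. k < n \<Longrightarrow> m k \<in> carrier R"
    and orth: "\<And>i. i < n \<Longrightarrow> (\<Oplus>k\<in>{..<n}. v i $ k \<otimes> m k) = \<zero>" and j: "j < n"
  shows "m j = \<zero>"
proof -
  let ?C = "{..<n} \<rightarrow>\<^sub>E carrier R"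
  define \<phi> where "\<phi> c = vec n (\<lambda>k. \<Oplus>i\<in>{..<n}. c i \<otimes> v i $ k)" for c
  have vc: "v i $ k \<in> carrier R" if "i < n" "k < n" for i k using v[OF that(1)] that(2) by (simp add: vecs_iff)
  have Cc: "c i \<in> carrier R" if "c \<in> ?C" "i < n" for c i using that by (simp add: PiE_iff)
  have \<phi>: "\<phi> c \<in> vecs R n" if "c \<in> ?C" for c
    unfolding \<phi>_def vecs_iff using vc Cc[OF that] by (simp add: finsum_closed Pi_def)
  have "inj_on \<phi> ?C"
  proof (rule inj_onI)
    fix c d assume cd: "c \<in> ?C" "d \<in> ?C" and eq: "\<phi> c = \<phi> d"
    let ?z = "\<lambda>i. c i \<ominus> d i"
    have "(\<Oplus>i\<in>{..<n}. ?z i \<otimes> v i $ k) = \<zero>" if k: "k < n" for k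
    proof -
      have s: "(\<Oplus>i\<in>{..<n}. c i \<otimes> v i $ k) = (\<Oplus>i\<in>{..<n}. d i \<otimes> v i $ k)"
        using arg_cong[OF eq, of "\<lambda>w. w $ k"] k by (simp add: \<phi>_def)
      have "(\<Oplus>i\<in>{..<n}. ?z i \<otimes> v i $ k) \<oplus> (\<Oplus>i\<in>{..<n}. d i \<otimes> v i $ k) = 
          (\<Oplus>i\<in>{..<n}. ?z i \<otimes> v i $ k \<oplus> d i \<otimes> v i $ k)"
        using vc k Cc[OF cd(1)] Cc[OF cd(2)] by (intro finsum_addf[symmetric]) simp_all
      also have "\<dots> = (\<Oplus>i\<in>{..<n}. c i \<otimes> v i $ k)"
      proof (intro finsum_cong' refl)
        fix i assume "i \<in> {..<n}"
        then have i: "c i \<in> carrier R" "d i \<in> carrier R" "v i $ k \<in> carrier R" using vc k Cc cd by simp_all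
        have "?z i \<otimes> v i $ k \<oplus> d i \<otimes> v i $ k = (?z i \<oplus> d i) \<otimes> v i $ k" using i by (simp add: l_distr)
        also have "?z i \<oplus> d i = c i" using i by (simp add: minus_eq a_assoc l_neg)
        finally show "?z i \<otimes> v i $ k \<oplus> d i \<otimes> v i $ k = c i \<otimes> v i $ k" .
      qed (use vc k Cc[OF cd(1)] in simp)
      also have "\<dots> = \<zero> \<oplus> (\<Oplus>i\<in>{..<n}. d i \<otimes> v i $ k)"
        using s vc k Cc[OF cd(2)] by (simp add: finsum_closed Pi_def)
      finally have e: "(\<Oplus>i\<in>{..<n}. ?z i \<otimes> v i $ k) \<oplus> (\<Oplus>i\<in>{..<n}. d i \<otimes> v i $ k) =
        \<zero> \<oplus> (\<Oplus>i\<in>{..<n}. d i \<otimes> v i $ k)" .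
      show ?thesis
        by (rule add.r_cancel[OF e]) (use vc k Cc[OF cd(1)] Cc[OF cd(2)] in \<open>simp_all add: finsum_closed Pi_def\<close>)
    qed
    then have ker: "\<forall>k<n. (\<Oplus>i\<in>{..<n}. ?z i \<otimes> v i $ k) = \<zero>" by simp
    have zc: "?z \<in> {..<n} \<rightarrow> carrier R" using Cc cd by simp
    have z: "\<forall>i<n. ?z i = \<zero>"
      by (rule bspec[OF indep[unfolded lin_indep_family_def], OF zc, THEN mp, OF ker])
    show "c = d"
    proof (rule PiE_ext[OF cd])
      fix i assume "i \<in> {..<n}"
      then show "c i = d i" using z Cc cd by (simp add: r_right_minus_eq)
    qed
  qed
  moreover have "card ?C = card (vecs R n)" using card_vecs(2)[OF fin, of n] by (simp add: card_PiE)
  moreover have "\<phi> ` ?C \<subseteq> vecs R n" using \<phi> by blast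
  ultimately have im: "\<phi> ` ?C = vecs R n"
    using card_vecs(1)[OF fin, of n] by (intro card_subset_eq) (simp_all add: card_image)
  \<comment> \<open>Pairing an expansion of the \<open>j\<close>-th unit vector with
    \<open>m\<close> isolates \<open>m j\<close> on one side and gives a combination of vanishing
    products on the other.\<close>
  let ?e = "vec n (\<lambda>k. if k = j then \<one> else \<zero>)"
  have "?e \<in> vecs R n" by (simp add: vecs_iff)
  then have "?e \<in> \<phi> ` ?C" unfolding im .
  then obtain c where c': "?e = \<phi> c" and c1: "c \<in> ?C" by (rule imageE)
  note c = c1 c'[symmetric]
  have ce: "(\<Oplus>i\<in>{..<n}. c i \<otimes> v i $ k) = (if j = k then \<one> else \<zero>)" if "k < n" for k
    using arg_cong[OF c(2), of "\<lambda>w. w $ k"] that unfolding \<phi>_def by (simp add: eq_commute)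
  have "m j = (\<Oplus>k\<in>{..<n}. (if j = k then \<one> else \<zero>) \<otimes> m k)"
    using finsum_delta_left[OF j, of m] m by simp
  also have "\<dots> = (\<Oplus>k\<in>{..<n}. (\<Oplus>i\<in>{..<n}. c i \<otimes> v i $ k) \<otimes> m k)"
    using ce m vc Cc[OF c(1)] by (intro finsum_cong') (simp_all add: finsum_closed Pi_def)
  also have "\<dots> = (\<Oplus>i\<in>{..<n}. c i \<otimes> (\<Oplus>k\<in>{..<n}. v i $ k \<otimes> m k))"
    using m vc Cc[OF c(1)] by (intro finsum_mult_assoc) simp_all
  also have "\<dots> = (\<Oplus>i\<in>{..<n}. \<zero>)"
    using orth Cc[OF c(1)] by (intro finsum_cong') simp_all
  also have "\<dots> = \<zero>" by (simp add: finsum_zero)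
  finally show ?thesis .
qed

text \<open>Applying \<open>W i\<close> shifts all four exponents of the relation by
  \<open>i\<close>. Read the other way round, column \<open>j\<close> of the difference of the
  \<open>W\<close> matrices is orthogonal to every \<open>u i\<close>, hence zero. \<open>W\<close>
  is abstract so that it covers the row orbit and, with transposed entries, the column
  orbit.\<close>

lemma (in field) independent_orbit_relation:
  fixes n x1 x2 x3 x4 :: nat
  assumes fin: "finite (carrier R)" and u: "\<And>i. u i \<in> vecs R n"
    and indep: "lin_indep_family R n n u"
    and W: "\<And>x k j. k < n \<Longrightarrow> j < n \<Longrightarrow> W x k j \<in> carrier R"
    and shift: "\<And>i x j. j < n \<Longrightarrow> u (i + x) $ j = (\<Oplus>k\<in>{..<n}. u i $ k \<otimes> W x k j)"
    and rel: "\<And>j. j < n \<Longrightarrow> u x1 $ j \<oplus> u x2 $ j = u x3 $ j \<oplus> u x4 $ j"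
    and kj: "k < n" "j < n"
  shows "W x1 k j \<oplus> W x2 k j = W x3 k j \<oplus> W x4 k j"
proof -
  have uc: "u i $ l \<in> carrier R" if "l < n" for i l using u[of i] that by (simp add: vecs_iff)
  have comb: "(\<Oplus>k\<in>{..<n}. u i $ k \<otimes> (W a k j \<oplus> W b k j)) = (\<Oplus>k\<in>{..<n}. (u a $ k \<oplus> u b $ k) \<otimes> W i k j)" for i a b
  proof -
    have "(\<Oplus>k\<in>{..<n}. u i $ k \<otimes> (W a k j \<oplus> W b k j)) = (\<Oplus>k\<in>{..<n}. u i $ k \<otimes> W a k j \<oplus> u i $ k \<otimes> W b k j)"
      using uc W kj by (intro finsum_cong') (simp_all add: r_distr)
    also have "\<dots> = u (i + a) $ j \<oplus> u (i + b) $ j"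
      unfolding shift[OF kj(2)] using uc W kj by (intro finsum_addf) simp_all
    \<comment> \<open>Here the commutation of powers enters: \<open>u i\<close> acted on by
      \<open>W a\<close> becomes \<open>u a\<close> acted on by \<open>W i\<close>.\<close>
    also have "\<dots> = u (a + i) $ j \<oplus> u (b + i) $ j" by (simp only: add.commute)
    also have "\<dots> = (\<Oplus>k\<in>{..<n}. u a $ k \<otimes> W i k j \<oplus> u b $ k \<otimes> W i k j)"
      unfolding shift[OF kj(2)] using uc W kj by (intro finsum_addf[symmetric]) simp_all
    also have "\<dots> = (\<Oplus>k\<in>{..<n}. (u a $ k \<oplus> u b $ k) \<otimes> W i k j)"
      using uc W kj by (intro finsum_cong') (simp_all add: l_distr)
    finally show ?thesis .
  qed
  let ?m = "\<lambda>k. (W x1 k j \<oplus> W x2 k j) \<ominus> (W x3 k j \<oplus> W x4 k j)"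
  have "?m k = \<zero>"
  proof (rule orthogonal_to_independent[OF fin _ indep, where m = ?m])
    show "u i \<in> vecs R n" for i by (rule u)
    show "?m k \<in> carrier R" if "k < n" for k using W that kj by simp
    show "k < n" by (rule kj)
    fix i assume "i < n"
    let ?s = "\<lambda>a b. \<Oplus>k\<in>{..<n}. u i $ k \<otimes> (W a k j \<oplus> W b k j)"
    have sc: "?s a b \<in> carrier R" for a b using uc W kj by (simp add: finsum_closed Pi_def)
    have eq: "?s x1 x2 = ?s x3 x4"
      unfolding comb using rel uc W kj by (intro finsum_cong') simp_all
    have "(\<Oplus>k\<in>{..<n}. u i $ k \<otimes> ?m k) \<oplus> ?s x3 x4 = 
        (\<Oplus>k\<in>{..<n}. u i $ k \<otimes> ?m k \<oplus> u i $ k \<otimes> (W x3 k j \<oplus> W x4 k j))"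
      using uc W kj by (intro finsum_addf[symmetric]) simp_all
    also have "\<dots> = ?s x1 x2"
    proof (intro finsum_cong' refl)
      fix k assume "k \<in> {..<n}"
      then have c: "u i $ k \<in> carrier R" "W x1 k j \<oplus> W x2 k j \<in> carrier R" "W x3 k j \<oplus> W x4 k j \<in> carrier R"
        using uc W kj by simp_all
      have "u i $ k \<otimes> ?m k \<oplus> u i $ k \<otimes> (W x3 k j \<oplus> W x4 k j) = u i $ k \<otimes> (?m k \<oplus> (W x3 k j \<oplus> W x4 k j))"
        using c by (simp only: r_distr minus_closed)
      also have "?m k \<oplus> (W x3 k j \<oplus> W x4 k j) = W x1 k j \<oplus> W x2 k j"
        using c(2,3) by (simp only: minus_eq a_assoc l_neg r_zero a_inv_closed)
      finally show "u i $ k \<otimes> ?m k \<oplus> u i $ k \<otimes> (W x3 k j \<oplus> W x4 k j) = u i $ k \<otimes> (W x1 k j \<oplus> W x2 k j)" .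
    qed (use uc W kj in simp)
    also have "\<dots> = \<zero> \<oplus> ?s x3 x4" using eq sc by simp
    finally have e: "(\<Oplus>k\<in>{..<n}. u i $ k \<otimes> ?m k) \<oplus> ?s x3 x4 = \<zero> \<oplus> ?s x3 x4" .
    show "(\<Oplus>k\<in>{..<n}. u i $ k \<otimes> ?m k) = \<zero>"
      by (rule add.r_cancel[OF e]) (use sc uc W kj in \<open>simp_all add: finsum_closed Pi_def\<close>)
  qed
  then show ?thesis using W kj by (simp add: r_right_minus_eq)
qed

section \<open>Moments of exponential sums\<close>

text \<open>Cauchy--Schwarz is used twice: on \<open>I\<close> against the constant 1, and on
  \<open>V\<close> after grouping by the fibres of \<open>f\<close>. The squares of the fibre sizes
  add up to the number of coinciding pairs.\<close>

lemma Cauchy_Schwarz_power4: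
  fixes f :: "'i \<Rightarrow> 'v" and Y :: "'v \<Rightarrow> real"
  assumes I: "finite I" and V: "finite V" and f: "f ` I \<subseteq> V" and Y: "\<And>v. v \<in> V \<Longrightarrow> 0 \<le> Y v"
  shows "(\<Sum>p\<in>I. Y (f p)) ^ 4 \<le>
    real (card I) ^ 2 * real (card {(p, p') \<in> I \<times> I. f p = f p'}) * (\<Sum>v\<in>V. Y v ^ 4)"
proof -
  define c where "c v = real (card {p \<in> I. f p = v})" for v
  have fib: "(\<Sum>p\<in>I. g (f p)) = (\<Sum>v\<in>V. c v * g v)" for g :: "'v \<Rightarrow> real"
  proof -
    have "(\<Sum>p\<in>I. g (f p)) = (\<Sum>v\<in>V. \<Sum>p\<in>{p \<in> I. f p = v}. g (f p))"
      by (rule sum.group[symmetric, OF I V f])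
    also have "\<dots> = (\<Sum>v\<in>V. c v * g v)" by (intro sum.cong) (simp_all add: c_def)
    finally show ?thesis .
  qed
  have sq: "(\<Sum>p\<in>I. Y (f p))^2 \<le> real (card I) * (\<Sum>p\<in>I. Y (f p)^2)"
    using Cauchy_Schwarz_ineq_sum[of "\<lambda>_. 1" "\<lambda>p. Y (f p)" I] by simp
  have "(\<Sum>p\<in>I. Y (f p)) ^ 4 = ((\<Sum>p\<in>I. Y (f p))^2)^2" by (simp flip: power_mult)
  also have "\<dots> \<le> (real (card I) * (\<Sum>p\<in>I. Y (f p)^2))^2"
    by (rule power_mono[OF sq]) simp
  also have "\<dots> = real (card I)^2 * (\<Sum>v\<in>V. c v * Y v^2)^2"
    by (simp add: power_mult_distrib fib[of "\<lambda>v. Y v^2"])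
  also have "\<dots> \<le> real (card I)^2 * ((\<Sum>v\<in>V. c v^2) * (\<Sum>v\<in>V. (Y v^2)^2))"
    by (intro mult_left_mono Cauchy_Schwarz_ineq_sum) simp
  also have "(\<Sum>v\<in>V. c v^2) = real (card {(p, p') \<in> I \<times> I. f p = f p'})"
  proof -
    have "(\<Sum>v\<in>V. c v^2) = (\<Sum>p\<in>I. c (f p))" by (simp add: fib[of c] power2_eq_square)
    also have "\<dots> = real (\<Sum>p\<in>I. card {p' \<in> I. f p' = f p})" by (simp add: c_def)
    also have "(\<Sum>p\<in>I. card {p' \<in> I. f p' = f p}) = card (SIGMA p:I. {p' \<in> I. f p' = f p})"
      using I by (simp add: card_SigmaI)
    also have "(SIGMA p:I. {p' \<in> I. f p' = f p}) = {(p, p') \<in> I \<times> I. f p = f p'}" by auto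
    finally show ?thesis .
  qed
  finally show ?thesis by (simp add: mult.assoc flip: power_mult)
qed

text \<open>The analytic part, separated from the matrices. In the application
  \<open>\<chi> y v\<close> is the character at a A^y v, \<open>w x\<close> is A^x b,
  \<open>d\<close> forms the differences of two such vectors, and \<open>Q\<close> is q^n.\<close>

lemma exp_sum_fourth_power_bounds:
  fixes \<chi> :: "nat \<Rightarrow> 'v \<Rightarrow> complex" and w :: "nat \<Rightarrow> 'v" and d :: "nat \<times> nat \<Rightarrow> 'v" and S :: complex and Q E :: real
  assumes V: "finite V" and \<tau>: "0 < \<tau>"
    and moment: "(\<Sum>v\<in>V. norm (\<Sum>y<\<tau>. \<chi> y v) ^ 4) \<le> Q * E"
    and w: "inj_on w {..<\<tau>}" "w ` {..<\<tau>} \<subseteq> V"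
    and wS: "\<And>x. x < \<tau> \<Longrightarrow> (\<Sum>y<\<tau>. \<chi> y (w x)) = S"
    and d: "d ` ({..<\<tau>} \<times> {..<\<tau>}) \<subseteq> V"
    and dS: "\<And>y. y < \<tau> \<Longrightarrow> (\<Sum>p\<in>{..<\<tau>} \<times> {..<\<tau>}. \<chi> y (d p)) = S * cnj S"
    and coll: "real (card {(p, p') \<in> ({..<\<tau>} \<times> {..<\<tau>}) \<times> ({..<\<tau>} \<times> {..<\<tau>}). d p = d p'}) \<le> E"
    and nonneg: "0 \<le> Q" "0 \<le> E"
  shows "real \<tau> * norm S ^ 4 \<le> Q * E" "norm S ^ 8 \<le> Q * E ^ 2"
proof -
  define Y where "Y v = norm (\<Sum>y<\<tau>. \<chi> y v)" for v
  have "real \<tau> * norm S ^ 4 = (\<Sum>x<\<tau>. Y (w x) ^ 4)" by (simp add: Y_def wS)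
  also have "\<dots> = (\<Sum>v\<in>w ` {..<\<tau>}. Y v ^ 4)" by (simp add: sum.reindex[OF w(1)])
  also have "\<dots> \<le> (\<Sum>v\<in>V. Y v ^ 4)" by (rule sum_mono2[OF V w(2)]) (simp add: Y_def)
  also have "\<dots> \<le> Q * E" using moment by (simp add: Y_def)
  finally show "real \<tau> * norm S ^ 4 \<le> Q * E" .
  \<comment> \<open>Summing |S|^2 over all \<open>y\<close> and exchanging the order brings in the
    inner sums whose fourth moment is known. The factor \<tau>^4 created on the left cancels against
    the square of the cardinality of \<open>?I\<close>.\<close>
  let ?I = "{..<\<tau>} \<times> {..<\<tau>}"
  have "real \<tau> * norm S ^ 2 = norm (\<Sum>y<\<tau>. S * cnj S)"
    by (simp add: norm_mult power2_eq_square)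
  also have "(\<Sum>y<\<tau>. S * cnj S) = (\<Sum>y<\<tau>. \<Sum>p\<in>?I. \<chi> y (d p))"
    by (rule sum.cong) (simp_all add: dS)
  also have "\<dots> = (\<Sum>p\<in>?I. \<Sum>y<\<tau>. \<chi> y (d p))" by (rule sum.swap)
  also have "norm \<dots> \<le> (\<Sum>p\<in>?I. Y (d p))" unfolding Y_def by (rule norm_sum)
  finally have "(real \<tau> * norm S ^ 2) ^ 4 \<le> (\<Sum>p\<in>?I. Y (d p)) ^ 4" by (rule power_mono) simp
  also have "\<dots> \<le> real (card ?I) ^ 2 * real (card {(p, p') \<in> ?I \<times> ?I. d p = d p'}) * (\<Sum>v\<in>V. Y v ^ 4)"
    by (rule Cauchy_Schwarz_power4[OF _ V d]) (simp_all add: Y_def)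
  also have "\<dots> \<le> real (card ?I) ^ 2 * E * (Q * E)"
    using coll moment nonneg by (intro mult_mono mult_left_mono) (simp_all add: Y_def sum_nonneg)
  also have "\<dots> = real \<tau> ^ 4 * (Q * E ^ 2)" by (simp add: power2_eq_square power4_eq_xxxx)
  finally have "real \<tau> ^ 4 * norm S ^ 8 \<le> real \<tau> ^ 4 * (Q * E ^ 2)"
    by (simp add: power_mult_distrib flip: power_mult)
  then show "norm S ^ 8 \<le> Q * E ^ 2" using \<tau> by simp
qed

lemma norm_power4_sum:
  fixes f :: "nat \<Rightarrow> complex"
  shows "complex_of_real (norm (\<Sum>y<\<tau>. f y) ^ 4) =
    (\<Sum>p\<in>({..<\<tau>} \<times> {..<\<tau>}) \<times> ({..<\<tau>} \<times> {..<\<tau>}).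
      f (fst (fst p)) * f (snd (fst p)) * cnj (f (fst (snd p))) * cnj (f (snd (snd p))))"
proof -
  let ?s = "\<Sum>y<\<tau>. f y" and ?I = "{..<\<tau>} \<times> {..<\<tau>}"
  have sq: "?s * ?s = (\<Sum>q\<in>?I. f (fst q) * f (snd q))"
    by (simp add: sum_product sum.cartesian_product case_prod_unfold)
  have gen: "sum F J * cnj (sum F J) = (\<Sum>p\<in>J \<times> J. F (fst p) * cnj (F (snd p)))"
    for F :: "nat \<times> nat \<Rightarrow> complex" and J
    unfolding cnj_sum sum_product by (simp add: sum.cartesian_product case_prod_unfold)
  have "norm ?s ^ 4 = (norm ?s ^ 2) ^ 2" by (simp flip: power_mult)
  then have "complex_of_real (norm ?s ^ 4) = (complex_of_real (norm ?s ^ 2)) ^ 2" by (simp only: of_real_power)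
  also have "\<dots> = (?s * cnj ?s) ^ 2" by (simp only: complex_norm_square)
  also have "\<dots> = (?s * ?s) * cnj (?s * ?s)" by (simp add: power2_eq_square mult_ac)
  also have "\<dots> = (\<Sum>p\<in>?I \<times> ?I. (f (fst (fst p)) * f (snd (fst p))) * cnj (f (fst (snd p)) * f (snd (snd p))))"
    unfolding sq by (rule gen)
  finally show ?thesis by (simp add: mult.assoc)
qed

section \<open>Additive characters of a finite field\<close>

lemma additive_character_add:
  "additive_character R \<psi> \<Longrightarrow> a \<in> carrier R \<Longrightarrow> b \<in> carrier R \<Longrightarrow> \<psi> (a \<oplus>\<^bsub>R\<^esub> b) = \<psi> a * \<psi> b"
  unfolding additive_character_def hom_def by simp

lemma (in abelian_group) additive_character_zero:
  assumes "additive_character G \<psi>"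
  shows "\<psi> \<zero> = 1"
proof -
  have "\<psi> \<zero> \<noteq> 0" using assms zero_closed unfolding additive_character_def hom_def Pi_def by simp
  then show ?thesis using additive_character_add[OF assms zero_closed zero_closed] by simp
qed

text \<open>A character is only required to have nonzero values; the finiteness of the group makes
  these values roots of unity.\<close>

lemma (in abelian_group) additive_character_norm_1:
  assumes "finite (carrier G)" "additive_character G \<psi>" "x \<in> carrier G"
  shows "norm (\<psi> x) = 1"
proof -
  note mult = additive_character_add[OF assms(2)]
  note z = additive_character_zero[OF assms(2)]
  have pow: "\<psi> ([k] \<cdot> x) = \<psi> x ^ k" for k :: nat
    by (induction k) (simp_all add: z mult assms(3) mult.commute)
  have o: "[card (carrier G)] \<cdot> x = \<zero>"
    using comm_group.power_order_eq_one[OF a_comm_group, of x] assms(1,3) by (simp add: add_pow_def)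
  have "norm (\<psi> x) ^ card (carrier G) = norm (\<psi> ([card (carrier G)] \<cdot> x))" by (simp add: pow norm_power)
  then have "norm (\<psi> x) ^ card (carrier G) = 1" unfolding o z by simp
  then have "norm (\<psi> x) ^ card (carrier G) = 1 ^ card (carrier G)" by simp
  moreover have "0 < card (carrier G)" using assms(1,3) card_gt_0_iff by fastforce
  ultimately show ?thesis by (intro power_eq_imp_eq_base[of "norm (\<psi> x)" "card (carrier G)" 1]) simp_all
qed

lemma (in abelian_group) additive_character_uminus:
  assumes "finite (carrier G)" "additive_character G \<psi>" "x \<in> carrier G"
  shows "\<psi> (\<ominus> x) = cnj (\<psi> x)"
proof -
  have "\<psi> x * \<psi> (\<ominus> x) = 1"
    using additive_character_add[OF assms(2,3), of "\<ominus> x"] additive_character_zero[OF assms(2)] assms(3)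
    by (simp add: r_neg)
  moreover have "\<psi> x * cnj (\<psi> x) = 1"
    using additive_character_norm_1[OF assms] complex_norm_square[of "\<psi> x"] by simp
  moreover have "\<psi> x \<noteq> 0" using additive_character_norm_1[OF assms] by auto
  ultimately show ?thesis by (metis mult_left_cancel)
qed

text \<open>For nonzero \<open>w\<close>, translation by a vector \<open>e\<close> whose product
  with \<open>w\<close> is some \<open>x\<close> with \<open>\<psi> x \<noteq> 1\<close> permutes
  the vectors and multiplies the sum by \<open>\<psi> x\<close>, so the sum vanishes.\<close>

lemma (in field) additive_character_orthogonality:
  fixes w :: "nat \<Rightarrow> 'a"
  assumes fin: "finite (carrier R)" and \<psi>: "nontrivial_additive_character R \<psi>"
    and w: "\<And>k. k < n \<Longrightarrow> w k \<in> carrier R"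
  shows "(\<Sum>v\<in>vecs R n. \<psi> (\<Oplus>k\<in>{..<n}. w k \<otimes> v $ k)) =
    (if \<forall>k<n. w k = \<zero> then of_nat (card (carrier R) ^ n) else 0)"
proof (cases "\<forall>k<n. w k = \<zero>")
  case True
  have "(\<Sum>v\<in>vecs R n. \<psi> (\<Oplus>k\<in>{..<n}. w k \<otimes> v $ k)) = (\<Sum>v\<in>vecs R n. 1)"
  proof (rule sum.cong)
    fix v assume v: "v \<in> vecs R n"
    have "(\<Oplus>k\<in>{..<n}. w k \<otimes> v $ k) = (\<Oplus>k\<in>{..<n}. \<zero>)"
      using True v by (intro finsum_cong') (simp_all add: vecs_iff)
    then show "\<psi> (\<Oplus>k\<in>{..<n}. w k \<otimes> v $ k) = 1"
      using additive_character_zero \<psi> by (simp add: finsum_zero nontrivial_additive_character_def)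
  qed simp
  then show ?thesis using True card_vecs(2)[OF fin, of n] by simp
next
  case False
  then obtain j where j: "j < n" "w j \<noteq> \<zero>" by blast
  obtain x where x: "x \<in> carrier R" "\<psi> x \<noteq> 1" and ac: "additive_character R \<psi>"
    using \<psi> unfolding nontrivial_additive_character_def by blast
  let ?V = "vecs R n"
  define F where "F v = \<psi> (\<Oplus>k\<in>{..<n}. w k \<otimes> v $ k)" for v
  \<comment> \<open>One coordinate, at a place where \<open>w\<close> is nonzero, is enough; it is
    scaled so that its product with \<open>w j\<close> is \<open>x\<close>.\<close>
  define e where "e k = (if k = j then inv (w j) \<otimes> x else \<zero>)" for k
  define T where "T v = vec n (\<lambda>k. v $ k \<oplus> e k)" for v
  have wj: "inv (w j) \<in> carrier R" "w j \<otimes> inv (w j) = \<one>"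
    using w[OF j(1)] j(2) by (simp_all add: field_Units)
  have ec: "e k \<in> carrier R" for k using wj x by (simp add: e_def)
  have wx: "w k \<otimes> e k = (if j = k then x else \<zero>)" if "k < n" for k
  proof (cases "j = k")
    case True
    have "w j \<otimes> (inv (w j) \<otimes> x) = (w j \<otimes> inv (w j)) \<otimes> x"
      using w[OF j(1)] wj(1) x(1) by (simp only: m_assoc)
    then show ?thesis using True wj(2) x(1) by (simp add: e_def)
  qed (use w[OF that] in \<open>simp add: e_def\<close>)
  have Tn: "T v \<in> ?V" if "v \<in> ?V" for v using that ec by (simp add: vecs_iff T_def)
  have inj: "inj_on T ?V"
  proof (rule inj_onI)
    fix v v' assume v: "v \<in> ?V" "v' \<in> ?V" "T v = T v'"
    show "v = v'"
    proof (rule eq_vecI)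
      fix k assume "k < dim_vec v'"
      then have k: "k < n" using v by (simp add: vecs_iff)
      have "v $ k \<oplus> e k = v' $ k \<oplus> e k" using arg_cong[OF v(3), of "\<lambda>u. u $ k"] k by (simp add: T_def)
      then show "v $ k = v' $ k" using v(1,2) k ec[of k] by (simp add: vecs_iff add.right_cancel)
    qed (use v in \<open>simp add: vecs_iff\<close>)
  qed
  have im: "T ` ?V = ?V"
    by (rule endo_inj_surj[OF card_vecs(1)[OF fin] _ inj]) (use Tn in blast)
  have FT: "F (T v) = F v * \<psi> x" if v: "v \<in> ?V" for v
  proof -
    have vc: "v $ k \<in> carrier R" if "k < n" for k using v that by (simp add: vecs_iff)
    have "(\<Oplus>k\<in>{..<n}. w k \<otimes> T v $ k) = (\<Oplus>k\<in>{..<n}. w k \<otimes> v $ k \<oplus> w k \<otimes> e k)"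
      using w vc ec by (intro finsum_cong') (simp_all add: T_def r_distr)
    also have "\<dots> = (\<Oplus>k\<in>{..<n}. w k \<otimes> v $ k) \<oplus> (\<Oplus>k\<in>{..<n}. w k \<otimes> e k)"
      using w vc ec by (intro finsum_addf) simp_all
    also have "(\<Oplus>k\<in>{..<n}. w k \<otimes> e k) = (\<Oplus>k\<in>{..<n}. if j = k then x else \<zero>)"
      using wx x by (intro finsum_cong') simp_all
    also have "\<dots> = x" using j x by (intro finsum_singleton) simp_all
    finally show ?thesis
      unfolding F_def using w vc x(1) by (simp add: additive_character_add[OF ac] finsum_closed Pi_def)
  qed
  have "(\<Sum>v\<in>?V. F v) = (\<Sum>v\<in>T ` ?V. F v)" by (simp only: im)
  also have "\<dots> = (\<Sum>v\<in>?V. F (T v))" by (simp add: sum.reindex[OF inj])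
  also have "\<dots> = (\<Sum>v\<in>?V. F v) * \<psi> x" by (simp add: FT sum_distrib_right)
  finally have "(\<Sum>v\<in>?V. F v) * (1 - \<psi> x) = 0" by (simp add: right_diff_distrib)
  then have "(\<Sum>v\<in>?V. F v) = 0" using x(2) by simp
  then show ?thesis unfolding if_not_P[OF False] F_def .
qed

lemma (in field) row_mult_col_diff:
  assumes "u \<in> vecs R n" "v \<in> vecs R n" "v' \<in> vecs R n"
  shows "row_mult_col R n u (vec n (\<lambda>k. v $ k \<ominus> v' $ k)) = row_mult_col R n u v \<ominus> row_mult_col R n u v'"
proof -
  have c: "u $ k \<in> carrier R" "v $ k \<in> carrier R" "v' $ k \<in> carrier R" if "k < n" for k
    using assms that by (simp_all add: vecs_iff)
  let ?d = "\<lambda>k. u $ k \<otimes> (v $ k \<ominus> v' $ k)"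
  have "(\<Oplus>k\<in>{..<n}. ?d k) \<oplus> (\<Oplus>k\<in>{..<n}. u $ k \<otimes> v' $ k) = (\<Oplus>k\<in>{..<n}. ?d k \<oplus> u $ k \<otimes> v' $ k)"
    using c by (intro finsum_addf[symmetric]) simp_all
  also have "\<dots> = (\<Oplus>k\<in>{..<n}. u $ k \<otimes> v $ k)"
  proof (intro finsum_cong' refl)
    fix k assume "k \<in> {..<n}"
    then have k: "u $ k \<in> carrier R" "v $ k \<in> carrier R" "v' $ k \<in> carrier R" using c by simp_all
    have "?d k \<oplus> u $ k \<otimes> v' $ k = u $ k \<otimes> ((v $ k \<ominus> v' $ k) \<oplus> v' $ k)"
      using k by (simp only: r_distr minus_closed)
    also have "(v $ k \<ominus> v' $ k) \<oplus> v' $ k = v $ k" using k by (simp only: minus_eq a_assoc l_neg r_zero a_inv_closed)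
    finally show "?d k \<oplus> u $ k \<otimes> v' $ k = u $ k \<otimes> v $ k" .
  qed (use c in simp)
  finally have e: "(\<Oplus>k\<in>{..<n}. ?d k) \<oplus> (\<Oplus>k\<in>{..<n}. u $ k \<otimes> v' $ k) = (\<Oplus>k\<in>{..<n}. u $ k \<otimes> v $ k)" .
  have cl: "(\<Oplus>k\<in>{..<n}. ?d k) \<in> carrier R" "(\<Oplus>k\<in>{..<n}. u $ k \<otimes> v' $ k) \<in> carrier R"
    using c by (simp_all add: finsum_closed Pi_def)
  have "row_mult_col R n u (vec n (\<lambda>k. v $ k \<ominus> v' $ k)) = (\<Oplus>k\<in>{..<n}. ?d k)"
    unfolding row_mult_col_def using c by (intro finsum_cong') simp_all
  also have "\<dots> = ((\<Oplus>k\<in>{..<n}. ?d k) \<oplus> (\<Oplus>k\<in>{..<n}. u $ k \<otimes> v' $ k)) \<ominus> (\<Oplus>k\<in>{..<n}. u $ k \<otimes> v' $ k)"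
    using cl by (simp only: minus_eq a_assoc r_neg r_zero a_inv_closed)
  finally show ?thesis unfolding e row_mult_col_def .
qed

text \<open>The expanded fourth power has one character in \<open>v\<close> per quadruple of
  exponents, and orthogonality keeps exactly the quadruples whose linear form in \<open>v\<close> is
  zero.\<close>

lemma (in field) fourth_moment:
  fixes u :: "nat \<Rightarrow> 'a vec"
  assumes fin: "finite (carrier R)" and \<psi>: "nontrivial_additive_character R \<psi>"
    and u: "\<And>y. u y \<in> vecs R n"
  shows "(\<Sum>v\<in>vecs R n. norm (\<Sum>y<\<tau>. \<psi> (row_mult_col R n (u y) v)) ^ 4) =
    real (card (carrier R) ^ n) * real (card {p \<in> ({..<\<tau>} \<times> {..<\<tau>}) \<times> ({..<\<tau>} \<times> {..<\<tau>}).
      \<forall>k<n. u (fst (fst p)) $ k \<oplus> u (snd (fst p)) $ k = u (fst (snd p)) $ k \<oplus> u (snd (snd p)) $ k})"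
    (is "?L = _ * real (card {p \<in> ?I. ?rel p})")
proof -
  have ac: "additive_character R \<psi>" using \<psi> by (simp add: nontrivial_additive_character_def)
  have uc: "u y $ k \<in> carrier R" if "k < n" for y k using u[of y] that by (simp add: vecs_iff)
  define w where "w p k = (u (fst (fst p)) $ k \<oplus> u (snd (fst p)) $ k) \<ominus> (u (fst (snd p)) $ k \<oplus> u (snd (snd p)) $ k)"
    for p :: "(nat \<times> nat) \<times> nat \<times> nat" and k
  have wc: "w p k \<in> carrier R" if "k < n" for p k unfolding w_def using uc[OF that] by simp
  have w0: "(\<forall>k<n. w p k = \<zero>) \<longleftrightarrow> ?rel p" for p
    unfolding w_def using uc by (simp add: r_right_minus_eq)
  have prod: "\<psi> (row_mult_col R n (u (fst (fst p))) v) * \<psi> (row_mult_col R n (u (snd (fst p))) v) *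
      cnj (\<psi> (row_mult_col R n (u (fst (snd p))) v)) * cnj (\<psi> (row_mult_col R n (u (snd (snd p))) v)) =
      \<psi> (\<Oplus>k\<in>{..<n}. w p k \<otimes> v $ k)" if v: "v \<in> vecs R n" for p v
  proof -
    have vc: "v $ k \<in> carrier R" if "k < n" for k using v that by (simp add: vecs_iff)
    define D where "D y = (\<Oplus>k\<in>{..<n}. u y $ k \<otimes> v $ k)" for y
    have Dc: "D y \<in> carrier R" for y unfolding D_def using uc vc by (simp add: finsum_closed Pi_def)
    have D2: "D y \<oplus> D y' = (\<Oplus>k\<in>{..<n}. (u y $ k \<oplus> u y' $ k) \<otimes> v $ k)" for y y'
    proof -
      have "D y \<oplus> D y' = (\<Oplus>k\<in>{..<n}. u y $ k \<otimes> v $ k \<oplus> u y' $ k \<otimes> v $ k)"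
        unfolding D_def using uc vc by (intro finsum_addf[symmetric]) simp_all
      also have "\<dots> = (\<Oplus>k\<in>{..<n}. (u y $ k \<oplus> u y' $ k) \<otimes> v $ k)"
        using uc vc by (intro finsum_cong') (simp_all add: l_distr)
      finally show ?thesis .
    qed
    define W where "W = (\<Oplus>k\<in>{..<n}. w p k \<otimes> v $ k)"
    have Wc: "W \<in> carrier R" unfolding W_def using wc vc by (simp add: finsum_closed Pi_def)
    \<comment> \<open>The subtracted terms are moved to the other side, so that additivity of
      \<open>\<psi>\<close> applies; they come back as conjugates, because the values have norm
      1.\<close>
    have "W \<oplus> (D (fst (snd p)) \<oplus> D (snd (snd p))) =
        (\<Oplus>k\<in>{..<n}. w p k \<otimes> v $ k \<oplus> (u (fst (snd p)) $ k \<oplus> u (snd (snd p)) $ k) \<otimes> v $ k)"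
      unfolding D2 W_def using wc uc vc by (intro finsum_addf[symmetric]) simp_all
    also have "\<dots> = D (fst (fst p)) \<oplus> D (snd (fst p))"
      unfolding D2
    proof (intro finsum_cong' refl)
      fix k assume "k \<in> {..<n}"
      then have k: "k < n" by simp
      let ?r = "u (fst (snd p)) $ k \<oplus> u (snd (snd p)) $ k" and ?l = "u (fst (fst p)) $ k \<oplus> u (snd (fst p)) $ k"
      have c: "?r \<in> carrier R" "?l \<in> carrier R" "v $ k \<in> carrier R" using uc vc k by simp_all
      have "w p k \<otimes> v $ k \<oplus> ?r \<otimes> v $ k = ((?l \<ominus> ?r) \<oplus> ?r) \<otimes> v $ k"
        unfolding w_def using c by (simp only: l_distr minus_closed)
      also have "(?l \<ominus> ?r) \<oplus> ?r = ?l" using c by (simp only: minus_eq a_assoc l_neg r_zero a_inv_closed)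
      finally show "w p k \<otimes> v $ k \<oplus> ?r \<otimes> v $ k = ?l \<otimes> v $ k" .
    qed (use uc vc in simp)
    finally have eq: "W \<oplus> (D (fst (snd p)) \<oplus> D (snd (snd p))) = D (fst (fst p)) \<oplus> D (snd (fst p))" .
    have "\<psi> W * (\<psi> (D (fst (snd p))) * \<psi> (D (snd (snd p)))) = \<psi> (D (fst (fst p))) * \<psi> (D (snd (fst p)))"
      using arg_cong[OF eq, of \<psi>] Dc Wc by (simp add: additive_character_add[OF ac])
    moreover have one: "\<psi> (D y) * cnj (\<psi> (D y)) = 1" for y
      using additive_character_norm_1[OF fin ac Dc] complex_norm_square[of "\<psi> (D y)"] by simp
    ultimately have "\<psi> (D (fst (fst p))) * \<psi> (D (snd (fst p))) * cnj (\<psi> (D (fst (snd p)))) * cnj (\<psi> (D (snd (snd p)))) =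
      \<psi> W * (\<psi> (D (fst (snd p))) * \<psi> (D (snd (snd p)))) * cnj (\<psi> (D (fst (snd p)))) * cnj (\<psi> (D (snd (snd p))))"
      by (simp only:)
    also have "\<dots> = \<psi> W * (\<psi> (D (fst (snd p))) * cnj (\<psi> (D (fst (snd p))))) * (\<psi> (D (snd (snd p))) * cnj (\<psi> (D (snd (snd p)))))"
      by (simp only: mult_ac)
    also have "\<dots> = \<psi> W" by (simp only: one mult_1_right)
    finally show ?thesis unfolding D_def W_def row_mult_col_def .
  qed
  have finI: "finite ?I" by simp
  have "complex_of_real ?L = (\<Sum>v\<in>vecs R n. \<Sum>p\<in>?I. \<psi> (\<Oplus>k\<in>{..<n}. w p k \<otimes> v $ k))"
    unfolding of_real_sum norm_power4_sum by (intro sum.cong refl) (rule prod)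
  also have "\<dots> = (\<Sum>p\<in>?I. \<Sum>v\<in>vecs R n. \<psi> (\<Oplus>k\<in>{..<n}. w p k \<otimes> v $ k))" by (rule sum.swap)
  also have "\<dots> = (\<Sum>p\<in>?I. if ?rel p then of_nat (card (carrier R) ^ n) else 0)"
    using additive_character_orthogonality[OF fin \<psi>, of n] wc by (simp only: w0)
  also have "\<dots> = (\<Sum>p\<in>{p \<in> ?I. ?rel p}. of_nat (card (carrier R) ^ n))"
    by (rule sum.inter_filter[OF finI, symmetric])
  also have "\<dots> = complex_of_real (real (card (carrier R) ^ n) * real (card {p \<in> ?I. ?rel p}))"
    by simp
  finally show ?thesis unfolding of_real_eq_iff .
qed

section \<open>The bound for matrix exponential sums\<close>

text \<open>The floor factor in \<open>kappa\<close> is at least 2, so the saving \<tau>^(1 / (2 n))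
  in the energy is at least the required \<tau>^(4 \<kappa>).\<close>

lemma kappa_le:
  assumes "2 \<le> n"
  shows "4 * kappa n \<le> 1 / (2 * real n)"
proof -
  define m where "m = \<lfloor>real n - 1 / 2 * real_of_int \<lfloor>(real n - 1) / 2\<rfloor>\<rfloor>"
  have "2 \<le> real n - 1 / 2 * real_of_int \<lfloor>(real n - 1) / 2\<rfloor>"
  \<comment> \<open>Estimating the inner floor by (n - 1) / 2 gives only 7 / 4 for
    \<open>n = 2\<close>, where its exact value 0 is needed.\<close>
  proof (cases "n = 2")
    case True
    have "\<lfloor>(real n - 1) / 2\<rfloor> = 0" unfolding True by (simp add: floor_eq_iff)
    then show ?thesis using True by simp
  next
    case False
    then have "3 \<le> real n" using assms by simp
    moreover have "2 \<le> x - 1 / 2 * y" if "3 \<le> x" "y \<le> (x - 1) / 2" for x y :: real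
      using that by argo
    ultimately show ?thesis using of_int_floor_le by blast
  qed
  then have m: "2 \<le> real_of_int m" unfolding m_def by (simp add: le_floor_iff)
  have "4 * kappa n = 1 / (real n * real_of_int m)" unfolding kappa_def m_def[symmetric] by (simp add: field_simps)
  also have "\<dots> \<le> 1 / (real n * 2)"
    using m assms by (intro divide_left_mono mult_left_mono mult_pos_pos) simp_all
  finally show ?thesis by (simp add: mult.commute)
qed

lemma kappa_1: "4 * kappa 1 = 1"
  by (simp add: kappa_def)

lemma (in field) energy_bound_kappa:
  fixes l :: "nat \<Rightarrow> 'a" and \<tau> n t :: nat
  assumes n: "0 < n" and \<tau>: "0 < \<tau>" and l: "\<And>i. i < n \<Longrightarrow> l i \<in> carrier R"
    and ltau: "\<And>i. i < n \<Longrightarrow> l i [^] \<tau> = \<one>"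
    and exact: "\<And>x. (\<And>i. i < n \<Longrightarrow> l i [^] (x::nat) = \<one>) \<Longrightarrow> \<tau> dvd x"
    and t: "0 < t" "(\<Otimes>i\<in>{..<n}. l i) [^] t = \<one>"
  shows "real (card (energy_set R n \<tau> l)) \<le> 3 * real n * real t * real \<tau> powr (3 - 4 * kappa n)"
proof (cases "n = 1")
  case True
  have "{..<n} = {0}" using True by auto
  then have "l 0 [^] t = \<one>" using t(2) l[of 0] True by simp
  then have "\<tau> dvd t" using exact[of t] True by simp
  then have le: "\<tau> \<le> t" using t(1) by (rule dvd_imp_le)
  have "real (card (energy_set R n \<tau> l)) \<le> real (\<tau> ^ 3)"
    using card_energy_set_le_cube(2)[OF \<tau> l ltau exact] by (simp only: of_nat_le_iff)
  also have "\<dots> = real \<tau> * real \<tau> ^ 2" by (simp add: power3_eq_cube power2_eq_square)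
  also have "\<dots> \<le> (3 * real t) * real \<tau> ^ 2" using le by (intro mult_right_mono) simp_all
  also have "real \<tau> ^ 2 = real \<tau> powr (3 - 4 * kappa n)"
    unfolding True kappa_1 using \<tau> by (simp add: powr_numeral)
  finally show ?thesis using True by simp
next
  case False
  then have n2: "2 \<le> n" using n by simp
  have "real (card (energy_set R n \<tau> l)) \<le> 3 * real n * real t * real \<tau> ^ 3 / real \<tau> powr (1 / (2 * real n))"
    by (rule energy_bound[OF n \<tau> l ltau exact t])
  also have "\<dots> = 3 * real n * real t * real \<tau> powr (3 - 1 / (2 * real n))"
    using \<tau> by (simp add: powr_diff powr_numeral)
  also have "\<dots> \<le> 3 * real n * real t * real \<tau> powr (3 - 4 * kappa n)"
    using kappa_le[OF n2] \<tau> by (intro mult_left_mono powr_mono) simp_all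
  finally show ?thesis .
qed

text \<open>The fourth and eighth roots are taken after replacing \<open>c\<close> by
  \<open>c ^ 4\<close> and \<open>c ^ 2\<close> by \<open>c ^ 8\<close>, which
  \<open>1 \<le> c\<close> permits; so the constant of the energy bound passes through
  unchanged.\<close>

lemma power_bounds_imp:
  fixes S E q \<tau> t c k :: real and n :: nat
  assumes pos: "0 < q" "0 < \<tau>" "0 < t" "1 \<le> c" "0 \<le> S" "0 \<le> E"
    and E: "E \<le> c * t * \<tau> powr (3 - 4 * k)"
    and S4: "\<tau> * S ^ 4 \<le> q ^ n * E" and S8: "S ^ 8 \<le> q ^ n * E ^ 2"
  shows "S \<le> c * (t powr (1/4) * \<tau> powr (1/2 - k) * q powr (real n / 4))"
    and "S \<le> c * (t powr (1/4) * \<tau> powr (3/4 - k) * q powr (real n / 8))"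
proof -
  have pw: "(x powr a) ^ m = x powr (a * real m)" if "0 < x" for x a :: real and m :: nat
    using that by (simp add: powr_powr flip: powr_realpow)
  have qn: "q ^ n = q powr real n" using pos by (simp add: powr_realpow)
  have c4: "c \<le> c ^ 4" "c ^ 2 \<le> c ^ 8" using pos by (simp_all add: self_le_power power_increasing)
  have "\<tau> * S ^ 4 \<le> q powr real n * (c * t * \<tau> powr (3 - 4 * k))"
    using S4 E pos unfolding qn by (meson mult_left_mono order_trans powr_ge_zero)
  also have "\<dots> = \<tau> * (c * (t * \<tau> powr (2 - 4 * k) * q powr real n))"
  proof -
    have "\<tau> powr (3 - 4 * k) = \<tau> powr (1 + (2 - 4 * k))" by simp
    also have "\<dots> = \<tau> * \<tau> powr (2 - 4 * k)" using pos by (simp only: powr_add powr_one)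
    finally show ?thesis by simp
  qed
  finally have "S ^ 4 \<le> c * (t * \<tau> powr (2 - 4 * k) * q powr real n)" using pos by simp
  also have "\<dots> \<le> c ^ 4 * (t * \<tau> powr (2 - 4 * k) * q powr real n)"
    using c4 pos by (intro mult_right_mono) simp_all
  also have "\<dots> = (c * (t powr (1/4) * \<tau> powr (1/2 - k) * q powr (real n / 4))) ^ 4"
    using pos by (simp add: power_mult_distrib pw left_diff_distrib mult.commute)
  finally show "S \<le> c * (t powr (1/4) * \<tau> powr (1/2 - k) * q powr (real n / 4))"
    using pos by (simp add: power_mono_iff)
  have "S ^ 8 \<le> q powr real n * (c * t * \<tau> powr (3 - 4 * k)) ^ 2"
    using S8 power_mono[OF E pos(6), of 2] unfolding qn by (meson mult_left_mono order_trans powr_ge_zero)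
  also have "\<dots> = c ^ 2 * (t ^ 2 * \<tau> powr (6 - 8 * k) * q powr real n)"
    using pos by (simp add: power_mult_distrib pw left_diff_distrib)
  also have "\<dots> \<le> c ^ 8 * (t ^ 2 * \<tau> powr (6 - 8 * k) * q powr real n)"
    using c4 pos by (intro mult_right_mono) simp_all
  also have "\<dots> = (c * (t powr (1/4) * \<tau> powr (3/4 - k) * q powr (real n / 8))) ^ 8"
    using pos by (simp add: power_mult_distrib pw left_diff_distrib powr_numeral mult.commute)
  finally show "S \<le> c * (t powr (1/4) * \<tau> powr (3/4 - k) * q powr (real n / 8))"
    using pos by (simp add: power_mono_iff)
qed

section \<open>Matrices and determinants under ring homomorphisms\<close>

lemma (in ring_hom_cring) map_mat_mult:
  assumes "A \<in> carrier (mat_monoid R n)" "B \<in> carrier (mat_monoid R n)"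
  shows "map_mat h (A \<otimes>\<^bsub>mat_monoid R n\<^esub> B) = map_mat h A \<otimes>\<^bsub>mat_monoid S n\<^esub> map_mat h B"
proof (rule eq_matI)
  have A: "A \<in> carrier_mat n n" "B \<in> carrier_mat n n" using assms by (simp_all only: mat_monoid_carrier_iff)
  fix i j assume "i < dim_row (map_mat h A \<otimes>\<^bsub>mat_monoid S n\<^esub> map_mat h B)" "j < dim_col (map_mat h A \<otimes>\<^bsub>mat_monoid S n\<^esub> map_mat h B)"
  then have ij: "i < n" "j < n" by simp_all
  have c: "A $$ (i, k) \<in> carrier R" "B $$ (k, j) \<in> carrier R" if "k < n" for k
    using assms ij that by (simp_all only: mat_monoid_carrier_iff)
  have "map_mat h (A \<otimes>\<^bsub>mat_monoid R n\<^esub> B) $$ (i, j) = h (\<Oplus>k\<in>{..<n}. A $$ (i, k) \<otimes> B $$ (k, j))"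
    using ij by (simp add: mat_monoid_mult_index)
  also have "\<dots> = (\<Oplus>\<^bsub>S\<^esub>k\<in>{..<n}. (h \<circ> (\<lambda>k. A $$ (i, k) \<otimes> B $$ (k, j))) k)"
    by (rule hom_finsum) (use c in simp)
  also have "\<dots> = (\<Oplus>\<^bsub>S\<^esub>k\<in>{..<n}. map_mat h A $$ (i, k) \<otimes>\<^bsub>S\<^esub> map_mat h B $$ (k, j))"
    using c ij carrier_matD[OF A(1)] carrier_matD[OF A(2)] by (intro S.finsum_cong') simp_all
  finally show "map_mat h (A \<otimes>\<^bsub>mat_monoid R n\<^esub> B) $$ (i, j) = (map_mat h A \<otimes>\<^bsub>mat_monoid S n\<^esub> map_mat h B) $$ (i, j)"
    using ij by (simp add: mat_monoid_mult_index)
qed simp_all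

lemma (in ring_hom_cring) map_mat_one:
  "map_mat h \<one>\<^bsub>mat_monoid R n\<^esub> = \<one>\<^bsub>mat_monoid S n\<^esub>"
  by (rule eq_matI) (simp_all add: mat_monoid_one_index)

lemma (in ring_hom_cring) map_mat_pow:
  fixes x :: nat
  assumes A: "A \<in> carrier (mat_monoid R n)"
  shows "map_mat h (A [^]\<^bsub>mat_monoid R n\<^esub> x) = map_mat h A [^]\<^bsub>mat_monoid S n\<^esub> x"
proof (induction x)
  case 0
  show ?case
    unfolding monoid.nat_pow_0[OF R.monoid_mat_monoid] monoid.nat_pow_0[OF S.monoid_mat_monoid] by (rule map_mat_one)
next
  case (Suc x)
  show ?case
    unfolding monoid.nat_pow_Suc[OF R.monoid_mat_monoid] monoid.nat_pow_Suc[OF S.monoid_mat_monoid]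
    by (simp only: map_mat_mult[OF R.mat_pow_closed[OF A] A] Suc)
qed

text \<open>Connects the determinant over the base field, whose order is \<open>t\<close>, with the
  product of the eigenvalues in the closure.\<close>

lemma (in ring_hom_cring) determinant_map_mat:
  assumes A: "A \<in> carrier (mat_monoid R n)"
  shows "determinant S n (map_mat h A) = h (determinant R n A)"
proof -
  have c: "A \<in> carrier_mat n n" "\<And>i j. i < n \<Longrightarrow> j < n \<Longrightarrow> A $$ (i, j) \<in> carrier R"
    using assms by (simp_all only: mat_monoid_carrier_iff)
  have pc: "(\<Otimes>i\<in>{..<n}. A $$ (i, p i)) \<in> carrier R" if "p permutes {..<n}" for p
    using c that by (intro R.finprod_closed) simp
  have hp: "h (\<Otimes>i\<in>{..<n}. A $$ (i, p i)) = (\<Otimes>\<^bsub>S\<^esub>i\<in>{..<n}. map_mat h A $$ (i, p i))" if p: "p permutes {..<n}" for p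
  proof -
    have "h (\<Otimes>i\<in>{..<n}. A $$ (i, p i)) = (\<Otimes>\<^bsub>S\<^esub>i\<in>{..<n}. (h \<circ> (\<lambda>i. A $$ (i, p i))) i)"
      by (rule hom_finprod) (use c p in simp)
    also have "\<dots> = (\<Otimes>\<^bsub>S\<^esub>i\<in>{..<n}. map_mat h A $$ (i, p i))"
      using c p carrier_matD[OF c(1)] by (intro S.finprod_cong') simp_all
    finally show ?thesis .
  qed
  have sg: "h (perm_sign R p) = perm_sign S p" for p
    by (simp add: perm_sign_def)
  have "h (determinant R n A) = (\<Oplus>\<^bsub>S\<^esub>p\<in>{p. p permutes {..<n}}. 
      (h \<circ> (\<lambda>p. perm_sign R p \<otimes> (\<Otimes>i\<in>{..<n}. A $$ (i, p i)))) p)"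
    unfolding determinant_perm_sign by (rule hom_finsum) (use pc in simp)
  also have "\<dots> = determinant S n (map_mat h A)"
    unfolding determinant_perm_sign
  proof (intro S.finsum_cong' refl)
    show "(\<lambda>p. perm_sign S p \<otimes>\<^bsub>S\<^esub> (\<Otimes>\<^bsub>S\<^esub>i\<in>{..<n}. map_mat h A $$ (i, p i))) \<in> {p. p permutes {..<n}} \<rightarrow> carrier S"
      using pc by (simp add: Pi_def flip: hp)
    fix p assume "p \<in> {p. p permutes {..<n}}"
    then have p: "p permutes {..<n}" by simp
    show "(h \<circ> (\<lambda>p. perm_sign R p \<otimes> (\<Otimes>i\<in>{..<n}. A $$ (i, p i)))) p =
        perm_sign S p \<otimes>\<^bsub>S\<^esub> (\<Otimes>\<^bsub>S\<^esub>i\<in>{..<n}. map_mat h A $$ (i, p i))"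
      using pc[OF p] by (simp only: comp_apply hom_mult R.perm_sign_closed sg hp[OF p])
  qed
  finally show ?thesis ..
qed

section \<open>Powers of a matrix and the orbits of its cyclic vectors\<close>

locale cyclic_matrix = field R for R (structure) +
  fixes n \<tau> t :: nat and A :: "'a mat" and a b :: "'a vec"
  assumes n: "0 < n" and fin: "finite (carrier R)"
    and A: "A \<in> carrier (GL R n)" and diag: "diagonalisable_over_closure R n A"
    and \<tau>_eq: "\<tau> = mult_order (GL R n) A" and t_eq: "t = mult_order R (determinant R n A)"
    and a: "a \<in> vecs R n" and b: "b \<in> vecs R n"
    and a_indep: "lin_indep_family R n n (\<lambda>i. row_mult_mat R n a (A [^]\<^bsub>GL R n\<^esub> i))"
    and b_indep: "lin_indep_family R n n (\<lambda>i. mat_mult_col R n (A [^]\<^bsub>GL R n\<^esub> i) b)"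
begin

abbreviation "M \<equiv> mat_monoid R n"

sublocale M: monoid M by (rule monoid_mat_monoid)

lemma A_unit: "A \<in> Units M" using A by (simp add: carrier_GL)

lemma A_closed: "A \<in> carrier M" by (rule M.Units_closed[OF A_unit])

lemma finite_GL: "finite (carrier (GL R n))"
proof (rule finite_subset)
  show "carrier (GL R n) \<subseteq> carrier M" unfolding carrier_GL by (rule subsetI) (rule M.Units_closed)
  show "finite (carrier M)" by (rule finite_mat_monoid[OF fin])
qed

lemma tau_pos: "0 < \<tau>" and pow_eq_one_iff: "A [^]\<^bsub>M\<^esub> (k::nat) = \<one>\<^bsub>M\<^esub> \<longleftrightarrow> \<tau> dvd k"
  using mult_order_group[OF group_GL finite_GL A] by (simp_all add: \<tau>_eq nat_pow_GL one_GL)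

lemma t_pos: "0 < t" and det_pow: "determinant R n A [^] t = \<one>"
  using mult_order_unit[OF fin determinant_Units[OF A_unit]] by (simp_all add: t_eq)

definition Apow :: "nat \<Rightarrow> 'a mat" where "Apow x = A [^]\<^bsub>M\<^esub> x"

lemma Apow_closed: "Apow x \<in> carrier M" unfolding Apow_def by (rule mat_pow_closed[OF A_closed])

lemma Apow_index_closed: "i < n \<Longrightarrow> j < n \<Longrightarrow> Apow x $$ (i, j) \<in> carrier R"
  using Apow_closed[of x] by (simp add: mat_monoid_carrier_iff)

lemma Apow_add: "Apow (x + y) = Apow x \<otimes>\<^bsub>M\<^esub> Apow y"
  unfolding Apow_def by (rule M.nat_pow_mult[OF A_closed, symmetric])

lemma Apow_periodic: "Apow (x + \<tau>) = Apow x"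
proof -
  have "Apow \<tau> = \<one>\<^bsub>M\<^esub>" unfolding Apow_def using pow_eq_one_iff by simp
  then show ?thesis unfolding Apow_add using Apow_closed[of x] by simp
qed

lemma Apow_inj: "inj_on Apow {..<\<tau>}"
proof -
  have *: "x = y" if "x \<le> y" "y < \<tau>" "Apow x = Apow y" for x y
  proof -
    have "Apow x \<otimes>\<^bsub>M\<^esub> Apow (y - x) = Apow x \<otimes>\<^bsub>M\<^esub> \<one>\<^bsub>M\<^esub>"
      using Apow_add[of x "y - x"] le_add_diff_inverse[OF that(1)] that(3) Apow_closed by simp
    moreover have "Apow x \<in> Units M" unfolding Apow_def by (rule M.Units_pow_closed[OF A_unit])
    ultimately have "Apow (y - x) = \<one>\<^bsub>M\<^esub>"
      using M.Units_l_cancel[OF _ Apow_closed M.one_closed] by simp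
    then have "\<tau> dvd y - x" unfolding Apow_def pow_eq_one_iff .
    then show ?thesis using that(1,2) nat_dvd_not_less[of "y - x" \<tau>] by (cases "x < y") simp_all
  qed
  show ?thesis
  proof (rule inj_onI)
    fix x y assume "x \<in> {..<\<tau>}" "y \<in> {..<\<tau>}" "Apow x = Apow y"
    then show "x = y" using *[of x y] *[of y x] by (cases "x \<le> y") simp_all
  qed
qed

definition row_orbit :: "nat \<Rightarrow> 'a vec" where "row_orbit x = row_mult_mat R n a (Apow x)"
definition col_orbit :: "nat \<Rightarrow> 'a vec" where "col_orbit x = mat_mult_col R n (Apow x) b"

lemma row_orbit_closed: "row_orbit x \<in> vecs R n"
  unfolding row_orbit_def by (rule row_mult_mat_closed[OF a Apow_closed])

lemma col_orbit_closed: "col_orbit x \<in> vecs R n"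
  unfolding col_orbit_def by (rule mat_mult_col_closed[OF Apow_closed b])

lemma row_orbit_relation:
  assumes "\<And>j. j < n \<Longrightarrow> row_orbit x1 $ j \<oplus> row_orbit x2 $ j = row_orbit x3 $ j \<oplus> row_orbit x4 $ j"
    and "k < n" "j < n"
  shows "Apow x1 $$ (k, j) \<oplus> Apow x2 $$ (k, j) = Apow x3 $$ (k, j) \<oplus> Apow x4 $$ (k, j)"
proof (rule independent_orbit_relation[OF fin row_orbit_closed, where W = "\<lambda>x k j. Apow x $$ (k, j)"])
  show "lin_indep_family R n n row_orbit"
    using a_indep by (simp only: row_orbit_def[abs_def] Apow_def nat_pow_GL)
  fix i x j assume j: "j < n"
  have "row_orbit (i + x) = row_mult_mat R n (row_orbit i) (Apow x)"
    unfolding row_orbit_def Apow_add by (rule row_mult_mat_assoc[OF a Apow_closed Apow_closed, symmetric])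
  then show "row_orbit (i + x) $ j = (\<Oplus>k\<in>{..<n}. row_orbit i $ k \<otimes> Apow x $$ (k, j))"
    using j by simp
qed (use assms Apow_index_closed in simp_all)

lemma col_orbit_relation:
  assumes "\<And>j. j < n \<Longrightarrow> col_orbit x1 $ j \<oplus> col_orbit x2 $ j = col_orbit x3 $ j \<oplus> col_orbit x4 $ j"
    and "k < n" "j < n"
  shows "Apow x1 $$ (k, j) \<oplus> Apow x2 $$ (k, j) = Apow x3 $$ (k, j) \<oplus> Apow x4 $$ (k, j)"
\<comment> \<open>The indices of \<open>W\<close> are exchanged: a matrix acting on a column is read
  as a row times the transpose.\<close>
proof (rule independent_orbit_relation[OF fin col_orbit_closed, where W = "\<lambda>x j k. Apow x $$ (k, j)"])
  show "lin_indep_family R n n col_orbit"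
    using b_indep by (simp only: col_orbit_def[abs_def] Apow_def nat_pow_GL)
  fix i x j assume j: "j < n"
  have "col_orbit (x + i) = mat_mult_col R n (Apow x) (col_orbit i)"
    unfolding col_orbit_def Apow_add by (rule mat_mult_col_assoc[OF b Apow_closed Apow_closed, symmetric])
  then have "col_orbit (i + x) $ j = (\<Oplus>k\<in>{..<n}. Apow x $$ (j, k) \<otimes> col_orbit i $ k)"
    using j by (simp add: add.commute)
  also have "\<dots> = (\<Oplus>k\<in>{..<n}. col_orbit i $ k \<otimes> Apow x $$ (j, k))"
    using j Apow_index_closed col_orbit_closed[of i]
    by (intro finsum_cong') (simp_all add: vecs_iff m_comm)
  finally show "col_orbit (i + x) $ j = (\<Oplus>k\<in>{..<n}. col_orbit i $ k \<otimes> Apow x $$ (j, k))" .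
qed (use assms Apow_index_closed in simp_all)

text \<open>An equality of two orbit vectors becomes a four-term relation after adding the vector
  with exponent 0 on both sides; the resulting equality of matrix powers gives the
  exponents.\<close>

lemma col_orbit_inj: "inj_on col_orbit {..<\<tau>}"
proof (rule inj_onI)
  fix x y assume xy: "x \<in> {..<\<tau>}" "y \<in> {..<\<tau>}" "col_orbit x = col_orbit y"
  have "Apow x = Apow y"
  proof (rule mat_monoid_eqI[OF Apow_closed Apow_closed])
    fix i j assume ij: "i < n" "j < n"
    have "Apow x $$ (i, j) \<oplus> Apow 0 $$ (i, j) = Apow y $$ (i, j) \<oplus> Apow 0 $$ (i, j)"
      by (rule col_orbit_relation[OF _ ij]) (simp only: xy(3))
    then show "Apow x $$ (i, j) = Apow y $$ (i, j)"
      using Apow_index_closed[OF ij] by (simp add: add.right_cancel)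
  qed
  then show "x = y" by (rule inj_onD[OF Apow_inj _ xy(1,2)])
qed

text \<open>The solutions of the energy equation on the level of matrices over the base field, where
  the character sums live. They are compared with \<open>energy_set\<close>, which lives on
  eigenvalues in the closure, only when they are counted.\<close>

definition relations :: "((nat \<times> nat) \<times> nat \<times> nat) set" where
  "relations = {p \<in> ({..<\<tau>} \<times> {..<\<tau>}) \<times> ({..<\<tau>} \<times> {..<\<tau>}). \<forall>k<n. \<forall>j<n.
     Apow (fst (fst p)) $$ (k, j) \<oplus> Apow (snd (fst p)) $$ (k, j) =
     Apow (fst (snd p)) $$ (k, j) \<oplus> Apow (snd (snd p)) $$ (k, j)}"

lemma finite_relations: "finite relations"
  by (rule finite_subset[of _ "({..<\<tau>} \<times> {..<\<tau>}) \<times> ({..<\<tau>} \<times> {..<\<tau>})"]) (simp_all add: relations_def subset_iff)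

text \<open>Over the algebraic closure the matrix becomes diagonalisable, and every matrix relation
  implies the same relation for each eigenvalue, so the energy bound for the eigenvalues
  applies.\<close>

lemma card_relations_le:
  "real (card relations) \<le> 3 * real n * real t * real \<tau> powr (3 - 4 * kappa n)"
proof -
  define K where "K = alg_closure"
  \<comment> \<open>\<open>indexed_const\<close> is polymorphic in the index type of the variables;
    the annotation selects the one on which the closure is built.\<close>
  define h where "h = (indexed_const :: 'a \<Rightarrow> ('a list \<times> nat) multiset \<Rightarrow> 'a)"
  have hK: "h \<in> Ring.ring_hom R K" unfolding K_def h_def by (rule alg_closureE(2))
  interpret K: field K
    using alg_closureE(1) unfolding K_def algebraic_closure_def by blast
  interpret h: ring_hom_cring R K h
    by unfold_locales (rule hK)
  have hinj: "inj_on h (carrier R)" unfolding h_def by (rule indexed_const_inj_on)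
  obtain P D where PD: "P \<in> carrier (GL K n)" "D \<in> carrier (mat_monoid K n)"
      "\<forall>i<n. \<forall>j<n. i \<noteq> j \<longrightarrow> D $$ (i, j) = \<zero>\<^bsub>K\<^esub>"
      "map_mat h A = P \<otimes>\<^bsub>mat_monoid K n\<^esub> D \<otimes>\<^bsub>mat_monoid K n\<^esub> inv\<^bsub>mat_monoid K n\<^esub> P"
    using diag unfolding diagonalisable_over_closure_def diagonalisable_def K_def h_def by (elim bexE conjE)
  interpret E: mat_diagonalisation K n "map_mat h A" P D
    using PD by unfold_locales (simp_all add: carrier_GL)
  have hpow: "map_mat h (Apow x) = map_mat h A [^]\<^bsub>mat_monoid K n\<^esub> x" for x
    unfolding Apow_def by (rule h.map_mat_pow[OF A_closed])
  have Ac: "Apow x \<in> carrier_mat n n" for x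
    using Apow_closed[of x] by (simp only: mat_monoid_carrier_iff)
  have hidx: "map_mat h (Apow x) $$ (k, j) = h (Apow x $$ (k, j))" if "k < n" "j < n" for x k j
    using that carrier_matD[OF Ac[of x]] by simp
  \<comment> \<open>Injectivity of \<open>h\<close> ensures that the order of the matrix does not
    drop in the closure, so \<tau> is the exact common exponent of the eigenvalues.\<close>
  have one: "(\<forall>i<n. E.eigenvalue i [^]\<^bsub>K\<^esub> x = \<one>\<^bsub>K\<^esub>) \<longleftrightarrow> \<tau> dvd x" for x :: nat
  proof -
    have "map_mat h (Apow x) = \<one>\<^bsub>mat_monoid K n\<^esub> \<longleftrightarrow> Apow x = \<one>\<^bsub>M\<^esub>"
    proof
      assume e: "map_mat h (Apow x) = \<one>\<^bsub>mat_monoid K n\<^esub>"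
      show "Apow x = \<one>\<^bsub>M\<^esub>"
      proof (rule mat_monoid_eqI[OF Apow_closed M.one_closed])
        fix i j assume ij: "i < n" "j < n"
        have "h (Apow x $$ (i, j)) = \<one>\<^bsub>mat_monoid K n\<^esub> $$ (i, j)"
          unfolding hidx[OF ij, symmetric] e ..
        also have "\<dots> = h (\<one>\<^bsub>M\<^esub> $$ (i, j))"
          by (simp add: mat_monoid_one_index[OF ij])
        finally show "Apow x $$ (i, j) = \<one>\<^bsub>M\<^esub> $$ (i, j)"
          by (rule inj_onD[OF hinj _ Apow_index_closed[OF ij]]) (use ij in \<open>simp add: mat_monoid_one_index\<close>)
      qed
    qed (simp add: h.map_mat_one)
    then show ?thesis
      unfolding hpow E.pow_eq_one_iff by (simp add: Apow_def pow_eq_one_iff)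
  qed
  have dett: "(\<Otimes>\<^bsub>K\<^esub>i\<in>{..<n}. E.eigenvalue i) [^]\<^bsub>K\<^esub> t = \<one>\<^bsub>K\<^esub>"
  proof -
    have "(\<Otimes>\<^bsub>K\<^esub>i\<in>{..<n}. E.eigenvalue i) = h (determinant R n A)"
      using E.determinant_eq h.determinant_map_mat[OF A_closed] by simp
    moreover have "h (determinant R n A) [^]\<^bsub>K\<^esub> t = h (determinant R n A [^] t)"
      using determinant_closed[OF A_closed] by (induction t) simp_all
    ultimately show ?thesis by (simp add: det_pow)
  qed
  have sub: "relations \<subseteq> energy_set K n \<tau> E.eigenvalue"
  proof
    fix p assume p: "p \<in> relations"
    obtain x1 x2 x3 x4 where px: "p = ((x1, x2), x3, x4)"
      by (rule that[of "fst (fst p)" "snd (fst p)" "fst (snd p)" "snd (snd p)"]) simp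
    have x: "x1 < \<tau>" "x2 < \<tau>" "x3 < \<tau>" "x4 < \<tau>" and rel: "\<And>k j. k < n \<Longrightarrow> j < n \<Longrightarrow>
        Apow x1 $$ (k, j) \<oplus> Apow x2 $$ (k, j) = Apow x3 $$ (k, j) \<oplus> Apow x4 $$ (k, j)"
      using p unfolding px relations_def by simp_all
    have "E.eigenvalue i [^]\<^bsub>K\<^esub> x1 \<oplus>\<^bsub>K\<^esub> E.eigenvalue i [^]\<^bsub>K\<^esub> x2 =
        E.eigenvalue i [^]\<^bsub>K\<^esub> x3 \<oplus>\<^bsub>K\<^esub> E.eigenvalue i [^]\<^bsub>K\<^esub> x4" if "i < n" for i
    proof (rule E.eigenvalue_relation[OF _ that])
      fix j k assume jk: "j < n" "k < n"
      show "(map_mat h A [^]\<^bsub>mat_monoid K n\<^esub> x1) $$ (j, k) \<oplus>\<^bsub>K\<^esub> (map_mat h A [^]\<^bsub>mat_monoid K n\<^esub> x2) $$ (j, k) =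
        (map_mat h A [^]\<^bsub>mat_monoid K n\<^esub> x3) $$ (j, k) \<oplus>\<^bsub>K\<^esub> (map_mat h A [^]\<^bsub>mat_monoid K n\<^esub> x4) $$ (j, k)"
        unfolding hpow[symmetric] hidx[OF jk] using arg_cong[OF rel[OF jk], of h] Apow_index_closed[OF jk]
        by simp
    qed
    then show "p \<in> energy_set K n \<tau> E.eigenvalue" unfolding px energy_set_def using x by simp
  qed
  have lt: "E.eigenvalue i [^]\<^bsub>K\<^esub> \<tau> = \<one>\<^bsub>K\<^esub>" if "i < n" for i using one[of \<tau>] that by simp
  have ex: "\<tau> dvd x" if "\<And>i. i < n \<Longrightarrow> E.eigenvalue i [^]\<^bsub>K\<^esub> x = \<one>\<^bsub>K\<^esub>" for x :: nat
    using one[of x] that by simp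
  have "card relations \<le> card (energy_set K n \<tau> E.eigenvalue)"
    by (rule card_mono[OF _ sub])
      (rule K.card_energy_set_le_cube(1)[OF tau_pos E.eigenvalue_closed lt ex])
  then have "real (card relations) \<le> real (card (energy_set K n \<tau> E.eigenvalue))" by simp
  also have "\<dots> \<le> 3 * real n * real t * real \<tau> powr (3 - 4 * kappa n)"
    by (rule K.energy_bound_kappa[OF n tau_pos E.eigenvalue_closed lt ex t_pos dett])
  finally show ?thesis .
qed

definition char_seq :: "('a \<Rightarrow> complex) \<Rightarrow> nat \<Rightarrow> complex" where
  "char_seq \<psi> x = \<psi> (row_mult_col R n (row_orbit x) b)"

text \<open>Pairing a A^y with A^x b gives a A^(y + x) b, so every vector of the column orbit
  reproduces the whole sum up to a shift.\<close>

lemma char_seq_add: "\<psi> (row_mult_col R n (row_orbit y) (col_orbit x)) = char_seq \<psi> (y + x)"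
proof -
  have "row_mult_col R n (row_orbit y) (col_orbit x) = row_mult_col R n (row_mult_mat R n (row_orbit y) (Apow x)) b"
    unfolding col_orbit_def by (rule row_mult_col_assoc[OF row_orbit_closed b Apow_closed, symmetric])
  also have "row_mult_mat R n (row_orbit y) (Apow x) = row_orbit (y + x)"
    unfolding row_orbit_def Apow_add by (rule row_mult_mat_assoc[OF a Apow_closed Apow_closed])
  finally show ?thesis by (simp add: char_seq_def)
qed

lemma sum_char_seq_shift: "(\<Sum>x<\<tau>. char_seq \<psi> (x + s)) = (\<Sum>x<\<tau>. char_seq \<psi> x)"
  by (rule sum_periodic_shift) (simp add: char_seq_def row_orbit_def Apow_periodic)

lemma matrix_exp_sum_eq: "matrix_exp_sum R n \<psi> a b A = (\<Sum>x<\<tau>. char_seq \<psi> x)"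
proof -
  have "matrix_exp_sum R n \<psi> a b A = (\<Sum>x = 1..\<tau>. char_seq \<psi> x)"
    unfolding matrix_exp_sum_def char_seq_def row_orbit_def Apow_def nat_pow_GL \<tau>_eq ..
  \<comment> \<open>The sum starts at exponent 1 and not at 0; periodicity removes this shift by
    one.\<close>
  also have "\<dots> = (\<Sum>x<\<tau>. char_seq \<psi> (x + 1))"
    by (rule sum.reindex_bij_witness[of _ "\<lambda>x. x + 1" "\<lambda>x. x - 1"]) auto
  finally show ?thesis unfolding sum_char_seq_shift .
qed

lemma matrix_exp_sum_bounds:
  assumes \<psi>: "nontrivial_additive_character R \<psi>"
  defines "S \<equiv> norm (matrix_exp_sum R n \<psi> a b A)" and "q \<equiv> real (card (carrier R))" and "E \<equiv> real (card relations)"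
  shows "real \<tau> * S ^ 4 \<le> q ^ n * E" "S ^ 8 \<le> q ^ n * E ^ 2"
proof -
  have ac: "additive_character R \<psi>" using \<psi> by (simp add: nontrivial_additive_character_def)
  let ?V = "vecs R n" and ?I = "{..<\<tau>} \<times> {..<\<tau>}"
  define d where "d p = vec n (\<lambda>k. col_orbit (fst p) $ k \<ominus> col_orbit (snd p) $ k)" for p
  let ?\<chi> = "\<lambda>y v. \<psi> (row_mult_col R n (row_orbit y) v)"
  have colc: "col_orbit x $ k \<in> carrier R" if "k < n" for x k
    using col_orbit_closed[of x] that by (simp add: vecs_iff)
  have moment: "(\<Sum>v\<in>?V. norm (\<Sum>y<\<tau>. ?\<chi> y v) ^ 4) \<le> q ^ n * E"
  proof -
    have "(\<Sum>v\<in>?V. norm (\<Sum>y<\<tau>. ?\<chi> y v) ^ 4) = real (card (carrier R) ^ n) * real (card {p \<in> ?I \<times> ?I.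
      \<forall>k<n. row_orbit (fst (fst p)) $ k \<oplus> row_orbit (snd (fst p)) $ k = row_orbit (fst (snd p)) $ k \<oplus> row_orbit (snd (snd p)) $ k})"
      (is "_ = _ * real (card ?X)")
      by (rule fourth_moment[OF fin \<psi> row_orbit_closed])
    also have "?X \<subseteq> relations"
    proof
      fix p assume "p \<in> ?X"
      then show "p \<in> relations"
        using row_orbit_relation[of "fst (fst p)" "snd (fst p)" "fst (snd p)" "snd (snd p)"]
        unfolding relations_def by simp
    qed
    then have "real (card ?X) \<le> E" unfolding E_def using card_mono[OF finite_relations] by simp
    then have "real (card (carrier R) ^ n) * real (card ?X) \<le> q ^ n * E"
      unfolding q_def by (simp add: mult_left_mono)
    finally show ?thesis .
  qed
  have wS: "(\<Sum>y<\<tau>. ?\<chi> y (col_orbit x)) = matrix_exp_sum R n \<psi> a b A" for x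
    unfolding char_seq_add matrix_exp_sum_eq by (rule sum_char_seq_shift)
  have dS: "(\<Sum>p\<in>?I. ?\<chi> y (d p)) = matrix_exp_sum R n \<psi> a b A * cnj (matrix_exp_sum R n \<psi> a b A)" for y
  proof -
    have s: "(\<Sum>x<\<tau>. char_seq \<psi> (y + x)) = matrix_exp_sum R n \<psi> a b A"
      unfolding matrix_exp_sum_eq using sum_char_seq_shift[of \<psi> y] by (simp add: add.commute)
    have "?\<chi> y (d p) = char_seq \<psi> (y + fst p) * cnj (char_seq \<psi> (y + snd p))" for p
    proof -
      let ?r = "\<lambda>x. row_mult_col R n (row_orbit y) (col_orbit x)"
      have rc: "?r x \<in> carrier R" for x by (rule row_mult_col_closed[OF row_orbit_closed col_orbit_closed])
      have "row_mult_col R n (row_orbit y) (d p) = ?r (fst p) \<ominus> ?r (snd p)"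
        unfolding d_def by (rule row_mult_col_diff[OF row_orbit_closed col_orbit_closed col_orbit_closed])
      then have "?\<chi> y (d p) = \<psi> (?r (fst p)) * \<psi> (\<ominus> ?r (snd p))"
        using additive_character_add[OF ac rc a_inv_closed[OF rc]] by (simp add: minus_eq)
      then show ?thesis unfolding additive_character_uminus[OF fin ac rc] char_seq_add .
    qed
    then have "(\<Sum>p\<in>?I. ?\<chi> y (d p)) = (\<Sum>p\<in>?I. char_seq \<psi> (y + fst p) * cnj (char_seq \<psi> (y + snd p)))" by simp
    also have "\<dots> = (\<Sum>x<\<tau>. char_seq \<psi> (y + x)) * cnj (\<Sum>x<\<tau>. char_seq \<psi> (y + x))"
      unfolding cnj_sum sum_product by (simp add: sum.cartesian_product case_prod_unfold)
    finally show ?thesis unfolding s .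
  qed
  have coll: "real (card {(p, p') \<in> ?I \<times> ?I. d p = d p'}) \<le> E"
  proof -
    \<comment> \<open>A coincidence of differences, x1 - x2 = x3 - x4 in terms of orbit vectors, is
      a relation x1 + x4 = x3 + x2; hence the exchange of \<open>x2\<close> and
      \<open>x4\<close>.\<close>
    let ?f = "\<lambda>((x1, x2), (x3, x4)). ((x1, x4), (x3, x2)) :: (nat \<times> nat) \<times> nat \<times> nat"
    let ?X = "{(p, p') \<in> ?I \<times> ?I. d p = d p'}"
    have "?f ` ?X \<subseteq> relations"
    proof
      fix z assume "z \<in> ?f ` ?X"
      then obtain p where p: "p \<in> ?X" "z = ?f p" by (rule imageE) 
      obtain x1 x2 x3 x4 where px: "p = ((x1, x2), x3, x4)"
      by (rule that[of "fst (fst p)" "snd (fst p)" "fst (snd p)" "snd (snd p)"]) simp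
      have x: "x1 < \<tau>" "x2 < \<tau>" "x3 < \<tau>" "x4 < \<tau>" and dd: "d (x1, x2) = d (x3, x4)"
        using p(1) unfolding px by simp_all
      have "col_orbit x1 $ j \<oplus> col_orbit x4 $ j = col_orbit x3 $ j \<oplus> col_orbit x2 $ j" if j: "j < n" for j
      proof -
        let ?c = "\<lambda>x. col_orbit x $ j"
        have e: "?c x1 \<ominus> ?c x2 = ?c x3 \<ominus> ?c x4"
          using arg_cong[OF dd, of "\<lambda>v. v $ j"] j by (simp add: d_def)
        have "?c x1 \<oplus> ?c x4 = (?c x1 \<ominus> ?c x2) \<oplus> (?c x2 \<oplus> ?c x4)"
          using colc[OF j] by (simp add: minus_eq a_assoc r_neg1)
        also have "\<dots> = (?c x3 \<ominus> ?c x4) \<oplus> (?c x4 \<oplus> ?c x2)"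
          unfolding e using colc[OF j] by (simp add: a_comm)
        also have "\<dots> = ?c x3 \<oplus> ?c x2"
          using colc[OF j] by (simp add: minus_eq a_assoc r_neg1)
        finally show ?thesis .
      qed
      from col_orbit_relation[OF this]
      show "z \<in> relations" unfolding p(2) px relations_def using x by simp
    qed
    moreover have "inj ?f" by (simp add: inj_def)
    then have "inj_on ?f ?X" by (rule inj_on_subset) (rule subset_UNIV)
    ultimately have "card ?X \<le> card relations"
      using card_inj_on_le[of ?f ?X relations] finite_relations by simp
    then show ?thesis unfolding E_def by simp
  qed
  have dV: "d ` ?I \<subseteq> ?V" by (rule image_subsetI) (simp add: d_def vecs_iff colc)
  have wV: "col_orbit ` {..<\<tau>} \<subseteq> ?V" using col_orbit_closed by blast
  show "real \<tau> * S ^ 4 \<le> q ^ n * E" "S ^ 8 \<le> q ^ n * E ^ 2"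
    using exp_sum_fourth_power_bounds[OF card_vecs(1)[OF fin] tau_pos moment col_orbit_inj wV wS dV dS coll]
    by (simp_all add: S_def q_def E_def)
qed

lemma norm_matrix_exp_sum_le:
  assumes \<psi>: "nontrivial_additive_character R \<psi>"
  defines "S \<equiv> norm (matrix_exp_sum R n \<psi> a b A)" and "q \<equiv> real (card (carrier R))"
  shows "S \<le> 3 * real n * (real t powr (1/4) * real \<tau> powr (1/2 - kappa n) * q powr (real n / 4))"
    and "S \<le> 3 * real n * (real t powr (1/4) * real \<tau> powr (3/4 - kappa n) * q powr (real n / 8))"
proof -
  have "0 < q" unfolding q_def using fin zero_closed card_gt_0_iff[of "carrier R"] by auto
  note * = power_bounds_imp[OF this _ _ _ _ _ card_relations_le
      matrix_exp_sum_bounds[OF \<psi>, folded q_def S_def]]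
  show "S \<le> 3 * real n * (real t powr (1/4) * real \<tau> powr (1/2 - kappa n) * q powr (real n / 4))"
    by (rule *(1)) (use tau_pos t_pos n in \<open>simp_all add: S_def\<close>)
  show "S \<le> 3 * real n * (real t powr (1/4) * real \<tau> powr (3/4 - kappa n) * q powr (real n / 8))"
    by (rule *(2)) (use tau_pos t_pos n in \<open>simp_all add: S_def\<close>)
qed

end

theorem theorem2p4:
  fixes n :: nat
  assumes "1 \<le> n"
  shows "\<exists>c::real. c > 0 \<and>
    (\<forall>(R :: 'a ring) (q::nat) (\<psi> :: 'a \<Rightarrow> complex) (A :: 'a mat) (\<tau>::nat) (t::nat)
       (a :: 'a vec) (b :: 'a vec).
      field R \<longrightarrow> finite (carrier R) \<longrightarrow> q = card (carrier R) \<longrightarrow>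
      nontrivial_additive_character R \<psi> \<longrightarrow>
      A \<in> carrier (GL R n) \<longrightarrow> diagonalisable_over_closure R n A \<longrightarrow>
      \<tau> = mult_order (GL R n) A \<longrightarrow> t = mult_order R (determinant R n A) \<longrightarrow>
      a \<in> vecs R n \<longrightarrow> b \<in> vecs R n \<longrightarrow>
      lin_indep_family R n n (\<lambda>i. row_mult_mat R n a (A [^]\<^bsub>GL R n\<^esub> i)) \<longrightarrow>
      lin_indep_family R n n (\<lambda>i. mat_mult_col R n (A [^]\<^bsub>GL R n\<^esub> i) b) \<longrightarrow>
      norm (matrix_exp_sum R n \<psi> a b A) \<le>
        (if real \<tau> > real q powr (real n / 2)
         then c * (real t powr (1/4) * real \<tau> powr (1/2 - kappa n) * real q powr (real n / 4))
         else c * (real t powr (1/4) * real \<tau> powr (3/4 - kappa n) * real q powr (real n / 8))))"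
\<comment> \<open>The constant of the energy bound, independent of the field and at least 1.\<close>
proof (intro exI[of _ "3 * real n"] conjI allI impI)
  show "0 < 3 * real n" using assms by simp
  fix R :: "'a ring" and q \<psi> A \<tau> t a b
  assume "field R" and "finite (carrier R)" and q: "q = card (carrier R)"
    and \<psi>: "nontrivial_additive_character R \<psi>"
    and "A \<in> carrier (GL R n)" "diagonalisable_over_closure R n A"
    and "\<tau> = mult_order (GL R n) A" "t = mult_order R (determinant R n A)"
    and "a \<in> vecs R n" "b \<in> vecs R n"
    and "lin_indep_family R n n (\<lambda>i. row_mult_mat R n a (A [^]\<^bsub>GL R n\<^esub> i))"
    and "lin_indep_family R n n (\<lambda>i. mat_mult_col R n (A [^]\<^bsub>GL R n\<^esub> i) b)"
  moreover have "0 < n" using assms by simp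
  ultimately interpret cyclic_matrix R n \<tau> t A a b
    by (intro cyclic_matrix.intro cyclic_matrix_axioms.intro)
  show "norm (matrix_exp_sum R n \<psi> a b A) \<le>
        (if real \<tau> > real q powr (real n / 2)
         then 3 * real n * (real t powr (1/4) * real \<tau> powr (1/2 - kappa n) * real q powr (real n / 4))
         else 3 * real n * (real t powr (1/4) * real \<tau> powr (3/4 - kappa n) * real q powr (real n / 8)))"
    using norm_matrix_exp_sum_le[OF \<psi>] unfolding q by simp
qed

end
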